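(* Consider the sparse logistic regression model with fixed design matrix $X\in\mathbb{R}^{n\times d}$ (rows $\mathbf{x}_1,\dots,\mathbf{x}_n$) of rank $r$, any $r$ columns of which are linearly independent: $Y_1,\dots,Y_n$ independent, $Y_i\sim Bin(1,p_i)$, $\ln\frac{p_i}{1-p_i}=\boldsymbol\beta^t\mathbf{x}_i$, with $\|\boldsymbol\beta\|_0\le d_0$. Let $0<h<\Delta<1/2$ and assume $$h\le|p_i-1/2|\le\Delta\quad\text{for all } i=1,\dots,n.$$ Let $\widehat M$ be the model selected by penalized maximum likelihood with the complexity penalty $Pen(|M|)=c|M|\ln\frac{de}{|M|}$ for $|M|=1,\dots,r-1$ and $Pen(r)=c\,r$, where $c>\frac{4}{\delta(1-\delta)}$ with $\delta=\frac12-\Delta$, and let $\widehat\eta_{\widehat M}(\mathbf{x})=I\{\widehat{\boldsymbol\beta}_{\widehat M}^t\mathbf{x}\ge0\}$. Then, for all $1\le d_0\le r$, $$\sup_{\eta^*\in\mathcal{C}_X(d_0,h)}\mathcal{E}_X(\widehat\eta_{\widehat M},\eta^* )\le C_1\min\left(\sqrt{\frac{1-4h^2}{1-4\Delta^2}\,\frac{\min\left(d_0\ln\frac{de}{d_0},r\right)}{n}}\ ,\ \frac{1-4h^2}{1-4\Delta^2}\,\frac{\min\left(d_0\ln\frac{de}{d_0},r\right)}{nh}\right)$$ for some constant $C_1>0$ depending at most on $c$ (not on $n,d,r,d_0,X,\boldsymbol\beta,h$), where the supremum is over the Bayes classifiers $\eta^*(\mathbf{x})=I\{\boldsymbol\beta^t\mathbf{x}\ge0\}$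 corresponding to all $\boldsymbol\beta\in\mathbb{R}^d$ with $\|\boldsymbol\beta\|_0\le d_0$ for which $p_i=\frac{\exp(\boldsymbol\beta^t\mathbf{x}_i)}{1+\exp(\boldsymbol\beta^t\mathbf{x}_i)}$ satisfies $h\le|p_i-1/2|\le\Delta$ for all $i=1,\dots,n$.
   Context: $\|\boldsymbol\beta\|_0$ is the number of nonzero entries of $\boldsymbol\beta$. $\mathcal{C}_X(d_0,h)$ is the set of classifiers $\eta(\mathbf{x})=I\{\boldsymbol\beta^t\mathbf{x}\ge0\}$ with $\boldsymbol\beta\in\mathbb{R}^d$, $\|\boldsymbol\beta\|_0\le d_0$ and $|\boldsymbol\beta^t\mathbf{x}_i|\ge\ln\left(\frac{1+2h}{1-2h}\right)$ (equivalently $|p_i-1/2|\ge h$) for all $i=1,\dots,n$. A model is a subset $M\subseteq\{1,\dots,d\}$; $\mathcal{B}_M=\{\boldsymbol\beta\in\mathbb{R}^d:\beta_j=0\text{ if }j\notin M\}$; $\widehat{\boldsymbol\beta}_M=\arg\max_{\widetilde{\boldsymbol\beta}\in\mathcal{B}_M}\sum_{i=1}^n\{\widetilde{\boldsymbol\beta}^t\mathbf{x}_iY_i-\ln(1+\exp(\widetilde{\boldsymbol\beta}^t\mathbf{x}_i))\}$; and $$\widehat M=\arg\min_{M:\,|M|\le r}\left\{\sum_{i=1}^n\left(\ln(1+\exp(\widehat{\boldsymbol\beta}_M^t\mathbf{x}_i))-\widehat{\boldsymbol\beta}_M^t\mathbf{x}_iY_i\right)+Pen(|M|)\right\},$$ with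 the convention $Pen(0)=0$. For a classifier $\eta$, $R_X(\eta)=\frac1n\sum_{i=1}^nP(Y_i\ne\eta(\mathbf{x}_i))$; for a data-dependent classifier it is the conditional error given the data, where the $Y_i$ to be predicted are new independent $Bin(1,p_i)$ variables. The misclassification excess risk is $\mathcal{E}_X(\widehat\eta,\eta^* )=ER_X(\widehat\eta)-R_X(\eta^* )=\frac1n\sum_{i=1}^nP(\widehat\eta(\mathbf{x}_i)\ne\eta^*(\mathbf{x}_i))|2p_i-1|$, where $\eta^*(\mathbf{x})=I\{\boldsymbol\beta^t\mathbf{x}\ge0\}$ for the true $\boldsymbol\beta$.
   Formalization: The argmax defining the maximum likelihood fit need not exist (separable data); there the criterion uses the supremum of the log-likelihood, and the classifier uses the sign of the unique, possibly infinite, limits of the linear predictors along likelihood-maximizing sequences. *)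

theory Defs
  imports "HOL-Probability.Probability" "Jordan_Normal_Form.DL_Rank"
begin

unbundle no vec_syntax
unbundle no inner_syntax

text \<open>
  The design matrix \<open>X\<close> has \<open>n = dim_row X\<close> rows \<open>x\<^sub>i = row X i\<close> and \<open>d = dim_col X\<close> columns;
  observations and covariates are numbered from \<open>0\<close>. A data set is a function \<open>y :: nat \<Rightarrow> bool\<close>,
  of which only the values at \<open>i < n\<close> matter, \<open>True\<close> standing for the label \<open>1\<close>.
\<close>

definition l0_norm :: "real vec \<Rightarrow> nat" where
  "l0_norm \<beta> = card {j. j < dim_vec \<beta> \<and> \<beta> $ j \<noteq> 0}"

text \<open>
  Independence of the columns is meant for the indexed family, hence the injectivity: two equal
  columns are dependent although they form a one-element set.
\<close>
definition any_cols_indep :: "real mat \<Rightarrow> nat \<Rightarrow> bool" where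
  "any_cols_indep X r \<longleftrightarrow> (\<forall>J \<subseteq> {..<dim_col X}. card J = r \<longrightarrow>
     inj_on (col X) J \<and>
     \<not> module.lin_dep class_ring (module_vec TYPE(real) (dim_row X)) (col X ` J))"

definition success_prob :: "real mat \<Rightarrow> real vec \<Rightarrow> nat \<Rightarrow> real" where
  "success_prob X \<beta> i = exp (\<beta> \<bullet> row X i) / (1 + exp (\<beta> \<bullet> row X i))"

definition data_pmf :: "real mat \<Rightarrow> real vec \<Rightarrow> (nat \<Rightarrow> bool) pmf" where
  "data_pmf X \<beta> = Pi_pmf {..<dim_row X} False (\<lambda>i. bernoulli_pmf (success_prob X \<beta> i))"

text \<open>Classifiers enter the risk only through their values \<open>\<eta> i\<close> at the design points \<open>x\<^sub>i\<close>.\<close>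

definition risk :: "real mat \<Rightarrow> real vec \<Rightarrow> (nat \<Rightarrow> bool) \<Rightarrow> real" where
  "risk X \<beta> \<eta> = (\<Sum>i<dim_row X.
     measure_pmf.prob (bernoulli_pmf (success_prob X \<beta> i)) {y. y \<noteq> \<eta> i}) / real (dim_row X)"

definition bayes_classifier :: "real vec \<Rightarrow> real vec \<Rightarrow> bool" where
  "bayes_classifier \<beta> x \<longleftrightarrow> \<beta> \<bullet> x \<ge> 0"

definition excess_risk :: "real mat \<Rightarrow> real vec \<Rightarrow> ((nat \<Rightarrow> bool) \<Rightarrow> nat \<Rightarrow> bool) \<Rightarrow> real" where
  "excess_risk X \<beta> \<eta>hat =
     measure_pmf.expectation (data_pmf X \<beta>) (\<lambda>y. risk X \<beta> (\<eta>hat y))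
     - risk X \<beta> (\<lambda>i. bayes_classifier \<beta> (row X i))"

definition loglik :: "real mat \<Rightarrow> (nat \<Rightarrow> bool) \<Rightarrow> real vec \<Rightarrow> real" where
  "loglik X y b = (\<Sum>i<dim_row X. (b \<bullet> row X i) * of_bool (y i) - ln (1 + exp (b \<bullet> row X i)))"

definition model_space :: "nat \<Rightarrow> nat set \<Rightarrow> real vec set" where
  "model_space d M = {b \<in> carrier_vec d. \<forall>j<d. j \<notin> M \<longrightarrow> b $ j = 0}"

definition is_mle :: "real mat \<Rightarrow> (nat \<Rightarrow> bool) \<Rightarrow> nat set \<Rightarrow> real vec \<Rightarrow> bool" where
  "is_mle X y M b \<longleftrightarrow> is_arg_max (loglik X y) (\<lambda>b. b \<in> model_space (dim_col X) M) b"

definition max_loglik :: "real mat \<Rightarrow> (nat \<Rightarrow> bool) \<Rightarrow> nat set \<Rightarrow> real" where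
  "max_loglik X y M = (SUP b \<in> model_space (dim_col X) M. loglik X y b)"

definition maximizing_seq ::
    "real mat \<Rightarrow> (nat \<Rightarrow> bool) \<Rightarrow> nat set \<Rightarrow> (nat \<Rightarrow> real vec) \<Rightarrow> bool" where
  "maximizing_seq X y M b \<longleftrightarrow> (\<forall>k. b k \<in> model_space (dim_col X) M) \<and>
     (\<lambda>k. loglik X y (b k)) \<longlonglongrightarrow> max_loglik X y M"

text \<open>
  For some data the likelihood of a model has no maximizer (the labels are separated, in full or in
  part, by a hyperplane), and under the logistic model this has positive probability as soon as the
  model contains a nonzero column. The maximum likelihood fit is then understood in the usual
  extended sense: the supremum of the likelihood replaces its maximum, and the linear predictor
  \<open>\<theta> i\<close> at \<open>x\<^sub>i\<close>, possibly infinite, is the limit of those of a likelihood-maximizing sequence.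
  The lemmas below show that this fit always exists and is unique.
\<close>
definition is_mle_predictor ::
    "real mat \<Rightarrow> (nat \<Rightarrow> bool) \<Rightarrow> nat set \<Rightarrow> (nat \<Rightarrow> ereal) \<Rightarrow> bool" where
  "is_mle_predictor X y M \<theta> \<longleftrightarrow>
     (if \<exists>b. is_mle X y M b
      then \<exists>b. is_mle X y M b \<and> (\<forall>i<dim_row X. \<theta> i = ereal (b \<bullet> row X i))
      else \<exists>b. maximizing_seq X y M b \<and>
             (\<forall>i<dim_row X. (\<lambda>k. ereal (b k \<bullet> row X i)) \<longlonglongrightarrow> \<theta> i))"

definition complexity_pen :: "real \<Rightarrow> nat \<Rightarrow> nat \<Rightarrow> nat \<Rightarrow> real" where
  "complexity_pen c d r k =
     (if k = 0 then 0
      else if k < r then c * real k * ln (real d * exp 1 / real k)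
      else c * real r)"

text \<open>There may be several minimizers; any of them may be selected.\<close>
definition is_selected_model :: "real \<Rightarrow> nat \<Rightarrow> real mat \<Rightarrow> (nat \<Rightarrow> bool) \<Rightarrow> nat set \<Rightarrow> bool" where
  "is_selected_model c r X y Mhat \<longleftrightarrow>
     is_arg_min (\<lambda>M. - max_loglik X y M + complexity_pen c (dim_col X) r (card M))
       (\<lambda>M. M \<subseteq> {..<dim_col X} \<and> card M \<le> r) Mhat"

definition admissible_coeffs :: "real mat \<Rightarrow> nat \<Rightarrow> real \<Rightarrow> real \<Rightarrow> real vec set" where
  "admissible_coeffs X d0 h \<Delta> =
     {\<beta> \<in> carrier_vec (dim_col X). l0_norm \<beta> \<le> d0 \<and>
        (\<forall>i<dim_row X. h \<le> \<bar>success_prob X \<beta> i - 1/2\<bar> \<and>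
                        \<bar>success_prob X \<beta> i - 1/2\<bar> \<le> \<Delta>)}"

lemma zero_in_model_space: "0\<^sub>v d \<in> model_space d M"
  by (auto simp: model_space_def)

lemma loglik_term_nonpos: "t * of_bool u - ln (1 + exp t) \<le> (0::real)"
proof (cases u)
  case True
  have "ln (exp t) \<le> ln (1 + exp t)"
    by (subst ln_le_cancel_iff) (auto intro: add_pos_pos)
  then show ?thesis using True by simp
next
  case False
  then show ?thesis by simp
qed

lemma bdd_above_loglik: "bdd_above (loglik X y ` A)"
  unfolding loglik_def by (intro bdd_aboveI2[of _ _ 0] sum_nonpos loglik_term_nonpos)

lemma loglik_le_max:
  "b \<in> model_space (dim_col X) M \<Longrightarrow> loglik X y b \<le> max_loglik X y M"
  unfolding max_loglik_def by (rule cSUP_upper[OF _ bdd_above_loglik])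

lemma max_loglik_eq_mle:
  assumes "is_mle X y M b"
  shows "max_loglik X y M = loglik X y b"
proof -
  have b: "b \<in> model_space (dim_col X) M"
    and m: "\<And>b'. b' \<in> model_space (dim_col X) M \<Longrightarrow> loglik X y b' \<le> loglik X y b"
    using assms unfolding is_mle_def is_arg_max_def by (auto simp: not_less)
  show ?thesis
    unfolding max_loglik_def by (rule cSup_eq_maximum) (use b m in auto)
qed

lemma ex_selected_model: "\<exists>Mhat. is_selected_model c r X y Mhat"
proof -
  let ?S = "{M. M \<subseteq> {..<dim_col X} \<and> card M \<le> r}"
  have "finite ?S" by (rule finite_subset[of _ "Pow {..<dim_col X}"]) auto
  moreover have "{} \<in> ?S" by simp
  ultimately obtain M where "is_arg_min
      (\<lambda>M. - max_loglik X y M + complexity_pen c (dim_col X) r (card M)) (\<lambda>M. M \<in> ?S) M"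
    using ex_is_arg_min_if_finite[of ?S] by blast
  then show ?thesis unfolding is_selected_model_def by auto
qed

lemma mle_maximizing_seq:
  assumes "is_mle X y M b"
  shows "maximizing_seq X y M (\<lambda>_. b)"
  using assms max_loglik_eq_mle[OF assms]
  by (auto simp: maximizing_seq_def is_mle_def is_arg_max_def)

lemma ex_maximizing_seq: "\<exists>b. maximizing_seq X y M b"
proof -
  let ?B = "model_space (dim_col X) M"
  have "\<exists>b\<in>?B. max_loglik X y M - 1 / real (Suc k) < loglik X y b" for k
    using less_cSUP_iff[OF _ bdd_above_loglik, of ?B "max_loglik X y M - 1 / real (Suc k)" X y]
      zero_in_model_space[of "dim_col X" M]
    by (auto simp: max_loglik_def[symmetric])
  then obtain b where b: "\<And>k. b k \<in> ?B"
      "\<And>k. max_loglik X y M - 1 / real (Suc k) < loglik X y (b k)"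
    by metis
  have "(\<lambda>k. max_loglik X y M - 1 / real (Suc k)) \<longlonglongrightarrow> max_loglik X y M - 0"
    by (intro tendsto_diff tendsto_const LIMSEQ_Suc lim_1_over_n)
  then have lim: "(\<lambda>k. max_loglik X y M - 1 / real (Suc k)) \<longlonglongrightarrow> max_loglik X y M" by simp
  have "(\<lambda>k. loglik X y (b k)) \<longlonglongrightarrow> max_loglik X y M"
    by (rule real_tendsto_sandwich[OF _ _ lim tendsto_const];
        intro always_eventually allI less_imp_le[OF b(2)] loglik_le_max b(1))
  with b show ?thesis by (auto simp: maximizing_seq_def)
qed

lemma subseq_ereal_family:
  fixes f :: "nat \<Rightarrow> nat \<Rightarrow> ereal"
  shows "\<exists>s \<theta>. strict_mono (s :: nat \<Rightarrow> nat) \<and> (\<forall>i<n. (\<lambda>k. f (s k) i) \<longlonglongrightarrow> \<theta> i)"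
proof (induction n)
  case 0
  show ?case by (auto intro: exI[of _ id] simp: strict_mono_id)
next
  case (Suc n)
  then obtain s \<theta> where s: "strict_mono (s :: nat \<Rightarrow> nat)"
      "\<And>i. i < n \<Longrightarrow> (\<lambda>k. f (s k) i) \<longlonglongrightarrow> \<theta> i"
    by blast
  obtain l t where t: "strict_mono (t :: nat \<Rightarrow> nat)"
      "((\<lambda>k. f (s k) n) \<circ> t) \<longlonglongrightarrow> l"
    using compact_complete_linorder[of "\<lambda>k. f (s k) n"] by blast
  have "(\<lambda>k. f ((s \<circ> t) k) i) \<longlonglongrightarrow> (\<theta>(n := l)) i" if "i < Suc n" for i
    using that t(2) LIMSEQ_subseq_LIMSEQ[OF s(2) t(1), of i]
    by (cases "i = n") (auto simp: o_def)
  with s(1) t(1) show ?case by (blast intro: strict_mono_o)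
qed

lemma ex_mle_predictor: "\<exists>\<theta>. is_mle_predictor X y M \<theta>"
proof (cases "\<exists>b. is_mle X y M b")
  case True
  then obtain b where "is_mle X y M b" by blast
  with True have "is_mle_predictor X y M (\<lambda>i. ereal (b \<bullet> row X i))"
    unfolding is_mle_predictor_def by (simp only: if_True) blast
  then show ?thesis by blast
next
  case False
  obtain b where b: "maximizing_seq X y M b" using ex_maximizing_seq by blast
  obtain s \<theta> where s: "strict_mono (s :: nat \<Rightarrow> nat)"
      "\<And>i. i < dim_row X \<Longrightarrow> (\<lambda>k. ereal (b (s k) \<bullet> row X i)) \<longlonglongrightarrow> \<theta> i"
    using subseq_ereal_family[of "dim_row X" "\<lambda>k i. ereal (b k \<bullet> row X i)"] by blast
  have "maximizing_seq X y M (b \<circ> s)"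
    using b LIMSEQ_subseq_LIMSEQ[OF _ s(1), of "\<lambda>k. loglik X y (b k)"]
    by (auto simp: maximizing_seq_def o_def)
  with False s(2) show ?thesis
    unfolding is_mle_predictor_def by (simp only: if_False o_def) blast
qed

lemma midpoint_gap:
  fixes s t :: real
  defines "u \<equiv> exp (s / 2)" and "v \<equiv> exp (t / 2)"
  shows "ln (1 + exp s) + ln (1 + exp t) - 2 * ln (1 + exp ((s + t) / 2)) =
         ln (1 + ((v - u) / (1 + u * v))\<^sup>2)"
proof -
  have p: "u > 0" "v > 0" by (auto simp: u_def v_def)
  have e: "exp s = u\<^sup>2" "exp t = v\<^sup>2" "exp ((s + t) / 2) = u * v"
    by (auto simp: u_def v_def power2_eq_square add_divide_distrib simp flip: exp_add)
  have q: "1 + u\<^sup>2 > 0" "1 + v\<^sup>2 > 0" "1 + u * v > 0"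
    using p by (auto intro: add_pos_nonneg)
  have "1 + ((v - u) / (1 + u * v))\<^sup>2 = (1 + u\<^sup>2) * (1 + v\<^sup>2) / (1 + u * v)\<^sup>2"
    using q(3) by (simp add: power_divide divide_simps) (simp add: power2_eq_square algebra_simps)
  also have "ln \<dots> = ln (1 + u\<^sup>2) + ln (1 + v\<^sup>2) - 2 * ln (1 + u * v)"
    using q by (simp add: ln_div ln_mult ln_realpow)
  finally show ?thesis by (simp add: e)
qed

lemma midpoint_gap_lower:
  fixes s t a b :: real
  assumes "s \<le> a" "a < b" "b \<le> t"
  shows "ln (1 + exp a) + ln (1 + exp b) - 2 * ln (1 + exp ((a + b) / 2))
       \<le> ln (1 + exp s) + ln (1 + exp t) - 2 * ln (1 + exp ((s + t) / 2))"
proof -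
  define u A B v where "u = exp (s / 2)" "A = exp (a / 2)" "B = exp (b / 2)" "v = exp (t / 2)"
  note d = this
  have o: "0 < u" "u \<le> A" "A < B" "B \<le> v" using assms by (auto simp: d)
  have "(v - u) * (1 + A * B) - (B - A) * (1 + u * v)
      = (v - B) + (A - u) + B * v * (A - u) + A * u * (v - B)"
    by (simp add: algebra_simps)
  also have "\<dots> \<ge> 0" using o by (intro add_nonneg_nonneg mult_nonneg_nonneg) auto
  finally have "(B - A) * (1 + u * v) \<le> (v - u) * (1 + A * B)" by simp
  moreover have "0 < 1 + A * B" "0 < 1 + u * v" using o by (auto intro!: add_pos_pos mult_pos_pos)
  ultimately have "(B - A) / (1 + A * B) \<le> (v - u) / (1 + u * v)"
    by (simp add: divide_simps mult.commute)
  moreover have "0 \<le> (B - A) / (1 + A * B)" using o \<open>0 < 1 + A * B\<close> by auto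
  ultimately have "((B - A) / (1 + A * B))\<^sup>2 \<le> ((v - u) / (1 + u * v))\<^sup>2"
    by (rule power_mono)
  then show ?thesis
    unfolding midpoint_gap d[symmetric]
    by (subst ln_le_cancel_iff) (auto intro: add_pos_nonneg)
qed

lemma midpoint_gap_pos:
  fixes a b :: real
  assumes "a < b"
  shows "0 < ln (1 + exp a) + ln (1 + exp b) - 2 * ln (1 + exp ((a + b) / 2))"
proof -
  have "exp (a / 2) < exp (b / 2)" using assms by simp
  moreover have "0 < 1 + exp (a / 2) * exp (b / 2)" by (intro add_pos_pos) auto
  ultimately have "0 < (exp (b / 2) - exp (a / 2)) / (1 + exp (a / 2) * exp (b / 2))" by simp
  then have "0 < ((exp (b / 2) - exp (a / 2)) / (1 + exp (a / 2) * exp (b / 2)))\<^sup>2"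
    by (rule zero_less_power)
  then show ?thesis unfolding midpoint_gap by (intro ln_gt_zero) linarith
qed

lemma midpoint_gap_nonneg:
  fixes a b :: real
  shows "0 \<le> ln (1 + exp a) + ln (1 + exp b) - 2 * ln (1 + exp ((a + b) / 2))"
  unfolding midpoint_gap by simp

lemma maximizing_seq_gap:
  assumes "maximizing_seq X y M b" "maximizing_seq X y M b'" "i < dim_row X"
  shows "(\<lambda>k. ln (1 + exp (b k \<bullet> row X i)) + ln (1 + exp (b' k \<bullet> row X i))
              - 2 * ln (1 + exp ((b k \<bullet> row X i + b' k \<bullet> row X i) / 2))) \<longlonglongrightarrow> 0"
    (is "?g i \<longlonglongrightarrow> 0")
proof -
  let ?d = "dim_col X" and ?m = "\<lambda>k. (1/2) \<cdot>\<^sub>v (b k + b' k)"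
  have c: "b k \<in> model_space ?d M" "b' k \<in> model_space ?d M" for k
    using assms by (auto simp: maximizing_seq_def)
  then have cv: "b k \<in> carrier_vec ?d" "b' k \<in> carrier_vec ?d" for k
    by (auto simp: model_space_def)
  have m: "?m k \<in> model_space ?d M" for k
    using c[of k] by (auto simp: model_space_def)
  have pm: "?m k \<bullet> row X j = (b k \<bullet> row X j + b' k \<bullet> row X j) / 2" if "j < dim_row X" for j k
    using cv[of k] by (simp add: add_scalar_prod_distrib[of _ ?d])
  have eq: "(\<Sum>j<dim_row X. ?g j k) = 2 * loglik X y (?m k) - loglik X y (b k) - loglik X y (b' k)"
    for k
    unfolding loglik_def sum_distrib_left sum_subtractf[symmetric]
    by (rule sum.cong) (auto simp: pm field_simps)
  have le: "?g i k \<le> 2 * max_loglik X y M - loglik X y (b k) - loglik X y (b' k)" for k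
  proof -
    have "?g i k \<le> (\<Sum>j<dim_row X. ?g j k)"
      using assms(3) by (intro member_le_sum midpoint_gap_nonneg) auto
    also have "\<dots> \<le> 2 * max_loglik X y M - loglik X y (b k) - loglik X y (b' k)"
      unfolding eq using loglik_le_max[OF m, of y k] by simp
    finally show ?thesis .
  qed
  have "(\<lambda>k. 2 * max_loglik X y M - loglik X y (b k) - loglik X y (b' k)) \<longlonglongrightarrow>
        2 * max_loglik X y M - max_loglik X y M - max_loglik X y M"
    using assms by (intro tendsto_intros) (auto simp: maximizing_seq_def)
  then have "(\<lambda>k. 2 * max_loglik X y M - loglik X y (b k) - loglik X y (b' k)) \<longlonglongrightarrow> 0" by simp
  then show ?thesis
    by (rule real_tendsto_sandwich[OF _ _ tendsto_const, rotated 2])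
       (intro always_eventually allI midpoint_gap_nonneg le)+
qed

lemma maximizing_seq_limit_le:
  assumes b: "maximizing_seq X y M b" "maximizing_seq X y M b'" and i: "i < dim_row X"
    and l: "(\<lambda>k. ereal (b k \<bullet> row X i)) \<longlonglongrightarrow> \<theta>" "(\<lambda>k. ereal (b' k \<bullet> row X i)) \<longlonglongrightarrow> \<theta>'"
  shows "\<theta>' \<le> \<theta>"
proof (rule ccontr)
  assume "\<not> \<theta>' \<le> \<theta>"
  then have "\<theta> < \<theta>'" by simp
  then obtain s where s: "\<theta> < ereal s" "ereal s < \<theta>'" using ereal_dense2 by blast
  obtain t where t: "ereal s < ereal t" "ereal t < \<theta>'" using ereal_dense2[OF s(2)] by blast
  have st: "s < t" using t by simp
  define \<delta> where "\<delta> = ln (1 + exp s) + ln (1 + exp t) - 2 * ln (1 + exp ((s + t) / 2))"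
  have "\<delta> > 0" unfolding \<delta>_def by (rule midpoint_gap_pos[OF st])
  have "\<forall>\<^sub>F k in sequentially. ereal (b k \<bullet> row X i) < ereal s"
    by (rule order_tendstoD(2)[OF l(1) s(1)])
  moreover have "\<forall>\<^sub>F k in sequentially. ereal t < ereal (b' k \<bullet> row X i)"
    by (rule order_tendstoD(1)[OF l(2) t(2)])
  moreover have "\<forall>\<^sub>F k in sequentially. ln (1 + exp (b k \<bullet> row X i)) + ln (1 + exp (b' k \<bullet> row X i))
              - 2 * ln (1 + exp ((b k \<bullet> row X i + b' k \<bullet> row X i) / 2)) < \<delta>"
    by (rule order_tendstoD(2)[OF maximizing_seq_gap[OF b i] \<open>\<delta> > 0\<close>])
  ultimately have "\<forall>\<^sub>F k in sequentially. False"
  proof eventually_elim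
    case (elim k)
    then show False
      using midpoint_gap_lower[of "b k \<bullet> row X i" s t "b' k \<bullet> row X i"] st by (simp add: \<delta>_def)
  qed
  then show False by simp
qed

lemma is_mle_predictor_imp_seq:
  assumes "is_mle_predictor X y M \<theta>"
  shows "\<exists>b. maximizing_seq X y M b \<and>
           (\<forall>i<dim_row X. (\<lambda>k. ereal (b k \<bullet> row X i)) \<longlonglongrightarrow> \<theta> i)"
proof (cases "\<exists>b. is_mle X y M b")
  case True
  then obtain b where "is_mle X y M b" "\<forall>i<dim_row X. \<theta> i = ereal (b \<bullet> row X i)"
    using assms unfolding is_mle_predictor_def by auto
  then show ?thesis by (intro exI[of _ "\<lambda>_. b"]) (auto intro: mle_maximizing_seq)
next
  case False
  then show ?thesis using assms unfolding is_mle_predictor_def by (simp only: if_False)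
qed

lemma mle_predictor_unique:
  assumes "is_mle_predictor X y M \<theta>" "is_mle_predictor X y M \<theta>'" "i < dim_row X"
  shows "\<theta> i = \<theta>' i"
proof -
  obtain b b' where "maximizing_seq X y M b" "maximizing_seq X y M b'"
    "(\<lambda>k. ereal (b k \<bullet> row X i)) \<longlonglongrightarrow> \<theta> i" "(\<lambda>k. ereal (b' k \<bullet> row X i)) \<longlonglongrightarrow> \<theta>' i"
    using is_mle_predictor_imp_seq[OF assms(1)] is_mle_predictor_imp_seq[OF assms(2)] assms(3)
    by blast
  then show ?thesis
    using maximizing_seq_limit_le[OF _ _ assms(3)] by (meson order_antisym)
qed

lemma excess_risk_alt:
  "excess_risk X \<beta> \<eta>hat = (\<Sum>i<dim_row X.
     measure_pmf.prob (data_pmf X \<beta>) {y. \<eta>hat y i \<noteq> bayes_classifier \<beta> (row X i)}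
       * \<bar>2 * success_prob X \<beta> i - 1\<bar>) / real (dim_row X)"
proof -
  let ?D = "data_pmf X \<beta>" and ?p = "success_prob X \<beta>"
  let ?s = "\<lambda>i. bayes_classifier \<beta> (row X i)"
  have p: "0 \<le> ?p i" "?p i \<le> 1" for i
    unfolding success_prob_def by (auto simp: divide_simps add_pos_pos intro: add_nonneg_nonneg)
  have ps: "?s i \<longleftrightarrow> 1 \<le> 2 * ?p i" for i
  proof -
    have "0 < 1 + exp (\<beta> \<bullet> row X i)" by (intro add_pos_pos) auto
    then have "1 \<le> 2 * ?p i \<longleftrightarrow> 1 \<le> exp (\<beta> \<bullet> row X i)"
      unfolding success_prob_def by (simp add: field_simps)
    then show ?thesis by (simp add: bayes_classifier_def)
  qed
  have pr: "measure_pmf.prob (bernoulli_pmf (?p i)) {y. y \<noteq> u} = (if u then 1 - ?p i else ?p i)"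
    for i u
  proof -
    have "{y. y \<noteq> u} = {\<not> u}" by auto
    then show ?thesis using p[of i] by (simp add: measure_pmf_single)
  qed
  define w where "w y i = (if \<eta>hat y i \<noteq> ?s i then \<bar>2 * ?p i - 1\<bar> else 0)" for y i
  have diff: "risk X \<beta> (\<eta>hat y) - risk X \<beta> ?s = (\<Sum>i<dim_row X. w y i) / real (dim_row X)" for y
    unfolding risk_def diff_divide_distrib[symmetric] sum_subtractf[symmetric] pr
    by (intro arg_cong2[where f = "(/)"] sum.cong refl) (auto simp: ps w_def)
  have r: "risk X \<beta> (\<eta>hat y) = risk X \<beta> ?s + (\<Sum>i<dim_row X. w y i) / real (dim_row X)" for y
    using diff[of y] by linarith
  have int: "integrable ?D (\<lambda>y. w y i)" for i
    by (rule measure_pmf.integrable_const_bound[of _ "\<bar>2 * ?p i - 1\<bar>"]) (auto simp: w_def)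
  have ex: "measure_pmf.expectation ?D (\<lambda>y. w y i) =
      measure_pmf.prob ?D {y. \<eta>hat y i \<noteq> ?s i} * \<bar>2 * ?p i - 1\<bar>" for i
  proof -
    have "(\<lambda>y. w y i) = (\<lambda>y. indicator {y. \<eta>hat y i \<noteq> ?s i} y * \<bar>2 * ?p i - 1\<bar>)"
      by (auto simp: w_def fun_eq_iff)
    then show ?thesis by simp
  qed
  have "excess_risk X \<beta> \<eta>hat = (\<Sum>i<dim_row X. measure_pmf.expectation ?D (\<lambda>y. w y i)) / real (dim_row X)"
    unfolding excess_risk_def r by (simp add: int)
  then show ?thesis by (simp only: ex)
qed

end

theory Submission
  imports Defs
begin

text \<open>
  Let \<open>l\<close> be the log-likelihood and \<open>U\<close> the sum of squared differences between fitted and true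
  success probabilities. The risk of the plug-in classifier is controlled by the expectation of \<open>U\<close>: a misclassified
  design point contributes at least a fixed multiple of \<open>(p - 1/2)\<^sup>2\<close>, which gives the bound in \<open>1/h\<close>
  directly and the square-root bound by Cauchy--Schwarz.

  Moving a maximizer slightly towards the true \<open>\<beta>\<close> raises the concave likelihood by a multiple of
  \<open>U\<close>, so it is enough to have, for each model of dimension \<open>k\<close> and every data-dependent choice \<open>b\<close> in it,
  an exponential moment \<open>E exp (\<lambda> (l b - l \<beta>)) \<le> exp (C (k + 1))\<close> with \<open>\<lambda>\<close> about \<open>1/8\<close> and \<open>C\<close> small
  enough that \<open>c > 4 / (\<delta> (1 - \<delta>))\<close> makes the penalty dominate the union bound over models.
  Such a bound, free of the design matrix, comes from a coding argument: a probability distribution on the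
  labels that dominates, for every \<open>b\<close> and up to the factor \<open>exp (C (k + 1))\<close>, the weighted geometric mean
  of the likelihoods of \<open>b\<close> and \<open>\<beta>\<close> yields it by summation over the labels. This distribution takes
  the rows in random order, uses the true law for the first \<open>m\<close> of them and a mixture of the true law with the
  Gibbs posterior of the preceding rows for every later one. The excess code length of a row is bounded by
  the posterior covariance of its linear predictor and its success probability, which rests on a moment
  inequality for log-concave densities; these covariances sum up to at most the dimension, by
  integration by parts.
\<close>

section \<open>Triangle-kernel integrals of the logistic function\<close>

text \<open>The exponential moment must involve neither the design nor a factor growing with
  \<open>n\<close>, and this shapes the code. Over any \<open>k\<close> rows the covariances total
  at most the dimension, so the row that happens to come last among \<open>k\<close> in random order
  costs \<open>1/k\<close> of it on average; starting after \<open>m = n div 2\<close> rows leaves a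
  harmonic sum close to \<open>ln 2\<close> instead of \<open>ln n\<close>, at the price of half the
  exponent. Mixing in the truth with weight \<open>\<kappa>\<close> keeps every code probability
  above \<open>\<kappa> * \<delta>\<close>, which is what converts a covariance into a code length,
  at the price of a factor \<open>1 - \<kappa>\<close>. With \<open>\<kappa> = 3/4\<close> the
  exponent is at least \<open>1/8\<close>. The threshold
  \<open>4 / (\<delta> * (1 - \<delta>))\<close> leaves very little room: hence the move towards the
  truth is only 1/100 of the way, binomial coefficients are estimated sharply, and small
  \<open>n\<close> are treated separately. Models of full size \<open>r\<close> all have the same
  linear predictors, so a single one of them enters the union bound, in accordance with their
  penalty without logarithm.\<close>

definition sg :: "real \<Rightarrow> real" where "sg t = 1 / (1 + exp (- t))"

text \<open>Integrating factor: \<open>exp (k * s) * F s\<close> is nondecreasing. The free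
  \<open>k\<close> lets the chains of derivatives below pass to \<open>F' + 2 * F\<close> where that
  is simpler than \<open>F'\<close>.\<close>

lemma nonneg_ode:
  fixes F :: "real \<Rightarrow> real"
  assumes d: "\<And>s. 0 \<le> s \<Longrightarrow> s \<le> C \<Longrightarrow> (F has_real_derivative F' s) (at s)"
    and F': "\<And>s. 0 \<le> s \<Longrightarrow> s \<le> C \<Longrightarrow> F' s + k * F s \<ge> 0" and 0: "F 0 \<ge> 0"
    and c: "0 \<le> c" "c \<le> C"
  shows "F c \<ge> 0"
proof -
  have "(\<lambda>s. exp (k * s) * F s) 0 \<le> (\<lambda>s. exp (k * s) * F s) c"
  proof (rule DERIV_nonneg_imp_nondecreasing[OF c(1)])
    fix s assume s: "0 \<le> s" "s \<le> c"
    then have "((\<lambda>s. exp (k * s) * F s) has_real_derivative exp (k * s) * (F' s + k * F s)) (at s)"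
      using c by (auto intro!: derivative_eq_intros d simp: algebra_simps)
    then show "\<exists>y. ((\<lambda>s. exp (k * s) * F s) has_real_derivative y) (at s) \<and> 0 \<le> y"
      using F'[of s] s c by (intro exI[of _ "exp (k * s) * (F' s + k * F s)"] conjI) auto
  qed
  then have "0 \<le> exp (k * c) * F c" using 0 by simp
  then show ?thesis by (simp add: zero_le_mult_iff)
qed

text \<open>Positivity is read off the expansion in the nonnegative quantities \<open>b\<close>, \<open>a - b\<close> and \<open>1 - a\<close>.\<close>

lemma kernel_slope_poly_pos:
  fixes a b :: real
  assumes "0 \<le> b" "b \<le> a" "a \<le> 1"
  shows "102 * a^6 - 24 * a^7 - 36 * a^6 * b + 28 * a^5 * b^2 + 160 * a^5 * b - 160 * a^5
     - 20 * a^4 * b^3 - 100 * a^4 * b^2 - 298 * a^4 * b + 100 * a^4 + 12 * a^3 * b^4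
     + 56 * a^3 * b^3 + 138 * a^3 * b^2 + 336 * a^3 * b - 168 * a^2 * b^5 - 450 * a^2 * b^4
     + 334 * a^2 * b^3 + 14 * a^2 * b^2 - 240 * a * b^6 - 360 * a * b^5 + 882 * a * b^4
     - 306 * a * b^3 \<ge> 0" (is "?l0 \<ge> 0")
    and "144 * a^3 * b - 864 * a^2 * b^5 + 840 * a^2 * b^4 - 120 * a^2 * b^3 - 960 * a * b^6
     + 1824 * a * b^5 - 984 * a * b^4 + 120 * a * b^3 \<ge> 0" (is "?l1 \<ge> 0")
proof -
  define d v where "d = a - b" and "v = 1 - a"
  have pos: "0 \<le> d" "0 \<le> v" using assms by (auto simp: d_def v_def)
  have "?l0 = 1790 * b^6 * d + 1632 * b^6 * v + 4796 * b^5 * d^2 + 5910 * b^5 * d * v + 1328 * b^5 * v^2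
     + 5370 * b^4 * d^3 + 8990 * b^4 * d^2 * v + 3794 * b^4 * d * v^2 + 144 * b^4 * v^3
     + 3524 * b^3 * d^4 + 8038 * b^3 * d^3 * v + 5616 * b^3 * d^2 * v^2 + 1130 * b^3 * d * v^3
     + 1430 * b^2 * d^5 + 4308 * b^2 * d^4 * v + 4420 * b^2 * d^3 * v^2 + 1622 * b^2 * d^2 * v^3
     + 288 * b * d^6 + 1064 * b * d^5 * v + 1410 * b * d^4 * v^2 + 736 * b * d^3 * v^3 + 18 * d^7
     + 82 * d^6 * v + 140 * d^5 * v^2 + 100 * d^4 * v^3"
    unfolding d_def v_def by Groebner_Basis.algebra
  also have "\<dots> \<ge> 0"
    using pos assms(1) by (intro add_nonneg_nonneg mult_nonneg_nonneg zero_le_power) simp_all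
  finally show "?l0 \<ge> 0" .
  \<comment> \<open>Both expansions are homogenized through \<open>b + d + v = 1\<close>. For
    \<open>?l0\<close> degree 7 is enough; for \<open>?l1\<close> degree 7 would leave a negative
    coefficient at \<open>b^5 * v^2\<close>, and two more factors \<open>b + d + v\<close> remove
    it, as in Polya's theorem on positive forms.\<close>
  have "?l1 = 1392 * b^8 * d + 1248 * b^8 * v + 5472 * b^7 * d^2 + 7368 * b^7 * d * v + 2184 * b^7 * v^2
     + 9504 * b^6 * d^3 + 17136 * b^6 * d^2 * v + 8664 * b^6 * d * v^2 + 888 * b^6 * v^3
     + 10320 * b^5 * d^4 + 24480 * b^5 * d^3 * v + 18936 * b^5 * d^2 * v^2 + 4992 * b^5 * d * v^3
     + 216 * b^5 * v^4 + 7920 * b^4 * d^5 + 24384 * b^4 * d^4 * v + 27336 * b^4 * d^3 * v^2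
     + 13464 * b^4 * d^2 * v^3 + 2856 * b^4 * d * v^4 + 264 * b^4 * v^5 + 4032 * b^3 * d^6
     + 15240 * b^3 * d^5 * v + 22080 * b^3 * d^4 * v^2 + 15120 * b^3 * d^3 * v^3
     + 4800 * b^3 * d^2 * v^4 + 552 * b^3 * d * v^5 + 1152 * b^2 * d^7 + 5040 * b^2 * d^6 * v
     + 8640 * b^2 * d^5 * v^2 + 7200 * b^2 * d^4 * v^3 + 2880 * b^2 * d^3 * v^4
     + 432 * b^2 * d^2 * v^5 + 144 * b * d^8 + 720 * b * d^7 * v + 1440 * b * d^6 * v^2
     + 1440 * b * d^5 * v^3 + 720 * b * d^4 * v^4 + 144 * b * d^3 * v^5"
    unfolding d_def v_def by Groebner_Basis.algebra
  also have "\<dots> \<ge> 0"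
    using pos assms(1) by (intro add_nonneg_nonneg mult_nonneg_nonneg zero_le_power) simp_all
  finally show "?l1 \<ge> 0" .
qed

text \<open>The polynomials left at the end of the chain in \<open>kernel_gap_nonneg\<close>. Here
  homogenization to degree 7 suffices for both.\<close>

lemma kernel_gap_poly_pos:
  fixes a b :: real
  assumes "0 \<le> b" "b \<le> a" "a \<le> 1"
  shows "24 * a^7 - 36 * a^6 * b - 126 * a^6 + 28 * a^5 * b^2 + 160 * a^5 * b + 272 * a^5
     - 20 * a^4 * b^3 - 100 * a^4 * b^2 - 298 * a^4 * b - 308 * a^4 + 12 * a^3 * b^4
     + 56 * a^3 * b^3 + 138 * a^3 * b^2 + 336 * a^3 * b + 192 * a^3 - 72 * a^2 * b^5
     - 222 * a^2 * b^4 + 22 * a^2 * b^3 - 34 * a^2 * b^2 - 32 * a^2 * b - 24 * a * b^5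
     + 90 * a * b^4 - 58 * a * b^3 \<ge> 0" (is "?l0 \<ge> 0")
    and "144 * a^3 * b - 288 * a^2 * b^5 + 168 * a^2 * b^4 - 24 * a^2 * b^3 + 96 * a * b^5
     - 120 * a * b^4 + 24 * a * b^3 \<ge> 0" (is "?l1 \<ge> 0")
proof -
  define d v where "d = a - b" and "v = 1 - a"
  have pos: "0 \<le> d" "0 \<le> v" using assms by (auto simp: d_def v_def)
  have "?l0 = 766 * b^6 * d + 640 * b^6 * v + 2948 * b^5 * d^2 + 3758 * b^5 * d * v + 992 * b^5 * v^2
     + 4690 * b^4 * d^3 + 8550 * b^4 * d^2 * v + 4466 * b^4 * d * v^2 + 576 * b^4 * v^3
     + 4000 * b^3 * d^4 + 9902 * b^3 * d^3 * v + 8064 * b^3 * d^2 * v^2 + 2338 * b^3 * d * v^3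
     + 160 * b^3 * v^4 + 1946 * b^2 * d^5 + 6224 * b^2 * d^4 * v + 7108 * b^2 * d^3 * v^2
     + 3350 * b^2 * d^2 * v^3 + 512 * b^2 * d * v^4 + 508 * b * d^6 + 2016 * b * d^5 * v
     + 3018 * b * d^4 * v^2 + 2048 * b * d^3 * v^3 + 544 * b * d^2 * v^4 + 54 * d^7
     + 262 * d^6 * v + 500 * d^5 * v^2 + 460 * d^4 * v^3 + 192 * d^3 * v^4"
    unfolding d_def v_def by Groebner_Basis.algebra
  also have "\<dots> \<ge> 0"
    using pos assms(1) by (intro add_nonneg_nonneg mult_nonneg_nonneg zero_le_power) simp_all
  finally show "?l0 \<ge> 0" .
  have "?l1 = 624 * b^6 * d + 480 * b^6 * v + 2112 * b^5 * d^2 + 2184 * b^5 * d * v + 360 * b^5 * v^2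
     + 2928 * b^4 * d^3 + 4320 * b^4 * d^2 * v + 1704 * b^4 * d * v^2 + 168 * b^4 * v^3
     + 2160 * b^3 * d^4 + 4344 * b^3 * d^3 * v + 2640 * b^3 * d^2 * v^2 + 456 * b^3 * d * v^3
     + 864 * b^2 * d^5 + 2160 * b^2 * d^4 * v + 1728 * b^2 * d^3 * v^2 + 432 * b^2 * d^2 * v^3
     + 144 * b * d^6 + 432 * b * d^5 * v + 432 * b * d^4 * v^2 + 144 * b * d^3 * v^3"
    unfolding d_def v_def by Groebner_Basis.algebra
  also have "\<dots> \<ge> 0"
    using pos assms(1) by (intro add_nonneg_nonneg mult_nonneg_nonneg zero_le_power) simp_all
  finally show "?l1 \<ge> 0" .
qed

text \<open>Setting for the integral of \<open>tri\<close> over the pairs \<open>x + e\<close>,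
  \<open>x - e\<close> with \<open>0 \<le> e \<le> c\<close>: \<open>P\<close>, \<open>R\<close> and
  \<open>H\<close> are the antiderivatives that occur in it. They enter through derivatives only,
  and \<open>r\<close>, \<open>w\<close> are separate symbols tied to \<open>a\<close> by polynomial
  relations, so that every identity becomes a question about polynomial ideals.\<close>

locale logistic_calculus =
  fixes x C :: real and P R H :: "real \<Rightarrow> real"
  fixes a b r w Y :: "real \<Rightarrow> real"
  assumes a_def: "a = (\<lambda>c. sg (x + c))" and b_def: "b = (\<lambda>c. sg (x - c))"
    and r_def: "r = (\<lambda>c. exp (x + c))" and w_def: "w = (\<lambda>c. exp (- (x + c)))"
    and Y_def: "Y = (\<lambda>c. ln (1 + exp (x + c)) - ln (1 + exp (x - c)))"
    and dP: "\<And>c. 0 \<le> c \<Longrightarrow> c \<le> C \<Longrightarrow> (P has_real_derivative a c * b c) (at c)"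
    and dR: "\<And>c. 0 \<le> c \<Longrightarrow> c \<le> C \<Longrightarrow> (R has_real_derivative a c * b c * (a c + b c)) (at c)"
    and dH: "\<And>c. 0 \<le> c \<Longrightarrow> c \<le> C \<Longrightarrow>
      (H has_real_derivative 2 * Y c + 4 * c * b c - a c - b c) (at c)"
    and at_0: "P 0 = 0" "R 0 = 0" "H 0 = 0"
begin

lemma rel: "a c * r c = r c - a c" "a c * w c = 1 - a c" "r c * w c = 1"
proof -
  have "1 + exp (- (x + c)) > 0" by (intro add_pos_pos) auto
  moreover have "exp (x + c) * exp (- (x + c)) = 1" by (simp flip: exp_add)
  ultimately show "a c * r c = r c - a c" "a c * w c = 1 - a c" "r c * w c = 1"
    by (auto simp: a_def r_def w_def sg_def field_simps)
qed

lemma DERIV_sg: "(sg has_real_derivative sg t - sg t ^ 2) (at t)"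
proof -
  have "1 + exp (- t) > 0" by (intro add_pos_pos) auto
  then show ?thesis unfolding sg_def
    by (auto intro!: derivative_eq_intros simp: power2_eq_square divide_simps)
qed

lemma dA: "(a has_real_derivative a c - a c ^ 2) (at c)"
  unfolding a_def by (rule DERIV_cong, rule DERIV_chain'[OF _ DERIV_sg]) (auto intro!: derivative_eq_intros)

lemma dB: "(b has_real_derivative b c ^ 2 - b c) (at c)"
  unfolding b_def by (rule DERIV_cong, rule DERIV_chain'[OF _ DERIV_sg]) (auto intro!: derivative_eq_intros)

lemma dr: "(r has_real_derivative r c) (at c)"
  unfolding r_def by (auto intro!: derivative_eq_intros)

lemma dw: "(w has_real_derivative - w c) (at c)"
  unfolding w_def by (auto intro!: derivative_eq_intros)

lemma dY: "(Y has_real_derivative a c + b c) (at c)"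
proof -
  have "1 + exp t > (0::real)" "exp t / (1 + exp t) = sg t" for t :: real
    by (auto simp: sg_def exp_minus field_simps add_pos_pos)
  then show ?thesis unfolding Y_def a_def b_def by (auto intro!: derivative_eq_intros)
qed

lemma ab: "0 < b c" "a c < 1" "0 \<le> c \<Longrightarrow> b c \<le> a c" "0 < a c" "b c < 1"
proof -
  have "1 + exp t > (0::real)" for t :: real by (simp add: add_pos_pos)
  then show "0 < b c" "a c < 1" "0 \<le> c \<Longrightarrow> b c \<le> a c" "0 < a c" "b c < 1"
    unfolding a_def b_def sg_def by (auto simp: field_simps add_pos_pos)
qed

lemma Y_0: "Y 0 = 0" by (simp add: Y_def)

lemma ab_0: "b 0 = a 0" by (simp add: a_def b_def)

text \<open>The integrand \<open>a * b\<close> of \<open>P\<close> decreases with the half-width: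
  its derivative is \<open>a * b * (b - a)\<close>.\<close>

lemma P_lower:
  assumes c: "0 \<le> c" "c \<le> C"
  shows "c * (a c * b c) \<le> P c"
proof -
  have "0 \<le> (\<lambda>c. P c - c * (a c * b c)) c"
  proof (rule nonneg_ode[where F' = "\<lambda>c. c * (a c * b c) * (a c - b c)" and k = 0, OF _ _ _ c])
    show "((\<lambda>c. P c - c * (a c * b c)) has_real_derivative c * (a c * b c) * (a c - b c)) (at c)"
      if "0 \<le> c" "c \<le> C" for c
      by (rule DERIV_cong, (rule derivative_intros dA dB dP[OF that])+) Groebner_Basis.algebra
    show "0 \<le> c * (a c * b c) * (a c - b c) + 0 * (P c - c * (a c * b c))"
      if "0 \<le> c" "c \<le> C" for c
      using that ab[of c] by simp
  qed (use at_0 in simp)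
  then show ?thesis by simp
qed

lemma R_upper:
  assumes c: "0 \<le> c" "c \<le> C"
  shows "R c \<le> 2 * P c"
proof -
  have "0 \<le> (\<lambda>c. 2 * P c - R c) c"
  proof (rule nonneg_ode[where F' = "\<lambda>c. a c * b c * (2 - a c - b c)" and k = 0, OF _ _ _ c])
    show "((\<lambda>c. 2 * P c - R c) has_real_derivative a c * b c * (2 - a c - b c)) (at c)"
      if "0 \<le> c" "c \<le> C" for c
      by (rule DERIV_cong, (rule derivative_intros dR[OF that] dP[OF that])+) Groebner_Basis.algebra
    show "0 \<le> a c * b c * (2 - a c - b c) + 0 * (2 * P c - R c)"
      if "0 \<le> c" "c \<le> C" for c
      using that ab[of c] by simp
  qed (use at_0 in simp)
  then show ?thesis by simp
qed

text \<open>The expression is the derivative of \<open>G0 - H\<close>. Four differentiations, two of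
  them after multiplication by \<open>exp (2 * c)\<close>, eliminate first \<open>Y\<close> and then
  the terms in \<open>P\<close> and \<open>R\<close> that are not multiplied by
  \<open>r ^ 2\<close>; the nonnegativity of the last derivative and of the initial values is
  carried back up the chain.\<close>

lemma kernel_slope_nonneg:
  assumes c: "0 \<le> c" "c \<le> C"
  shows "a c - 8 * b c ^ 2 * r c * c - 2 * b c ^ 2 * r c - 8 * b c ^ 2 * c - 2 * b c ^ 2 + b c * r c
     + 4 * b c * c - 2 * b c + 10 * r c * P c - r c * R c + r c - 4 * w c * P c + w c * R c
     - 2 * Y c \<ge> 0"
proof -
  define G where "G = (\<lambda>c. a c - 8 * b c ^ 2 * r c * c - 2 * b c ^ 2 * r c - 8 * b c ^ 2 * c - 2 * b c ^ 2 + b c * r c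
     + 4 * b c * c - 2 * b c + 10 * r c * P c - r c * R c + r c - 4 * w c * P c + w c * R c
     - 2 * Y c)"
  define K where "K = (\<lambda>c. a c - a c ^ 2 - 4 * a c * b c - 16 * b c ^ 3 * r c * c - 4 * b c ^ 3 * r c
     - 16 * b c ^ 3 * c - 4 * b c ^ 3 - 8 * b c ^ 2 * r c * c - 10 * b c ^ 2 * r c
     + 4 * b c ^ 2 * c - 9 * b c ^ 2 + 11 * b c * r c + 4 * b c * c - 4 * b c + 30 * r c * P c
     - 3 * r c * R c + 3 * r c - 4 * w c * P c + w c * R c - 4 * Y c)"
  define K1 where "K1 = (\<lambda>c. 2 * a c ^ 3 + 6 * a c ^ 2 * b c - 3 * a c ^ 2 - 2 * a c * b c ^ 2 - 22 * a c * b c - 3 * a c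
     - 48 * b c ^ 4 * r c * c - 12 * b c ^ 4 * r c - 48 * b c ^ 4 * c - 12 * b c ^ 4
     + 16 * b c ^ 3 * r c * c - 28 * b c ^ 3 * r c + 56 * b c ^ 3 * c - 22 * b c ^ 3
     + 8 * b c ^ 2 * r c * c + 10 * b c ^ 2 * r c - 4 * b c ^ 2 * c + 19 * b c ^ 2
     + 27 * b c * r c - 4 * b c * c + 30 * r c * P c - 3 * r c * R c + 3 * r c + 4 * w c * P c
     - w c * R c)"
  define M where "M = (\<lambda>c. 6 * a c ^ 4 + 12 * a c ^ 3 * b c - 10 * a c ^ 3 - 8 * a c ^ 2 * b c ^ 2 - 32 * a c ^ 2 * b c
     - a c ^ 2 + 4 * a c * b c ^ 3 + 12 * a c * b c ^ 2 + 44 * a c * b c + 8 * a c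
     - 192 * b c ^ 5 * r c ^ 2 * c - 48 * b c ^ 5 * r c ^ 2 - 192 * b c ^ 5 * r c * c
     - 48 * b c ^ 5 * r c + 96 * b c ^ 4 * r c ^ 2 * c - 120 * b c ^ 4 * r c ^ 2
     + 264 * b c ^ 4 * r c * c - 90 * b c ^ 4 * r c + 16 * b c ^ 3 * r c ^ 2 * c
     + 36 * b c ^ 3 * r c ^ 2 - 64 * b c ^ 3 * r c * c + 112 * b c ^ 3 * r c
     + 8 * b c ^ 2 * r c ^ 2 * c + 42 * b c ^ 2 * r c ^ 2 - 4 * b c ^ 2 * r c * c
     - 17 * b c ^ 2 * r c + 81 * b c * r c ^ 2 - 4 * b c * r c * c - 44 * b c * r c
     + 90 * r c ^ 2 * P c - 9 * r c ^ 2 * R c + 9 * r c ^ 2 - 8 * r c + 4 * P c - R c)"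
  define Q where "Q = (\<lambda>c. 54 * a c ^ 4 - 24 * a c ^ 5 - 36 * a c ^ 4 * b c + 28 * a c ^ 3 * b c ^ 2
     + 88 * a c ^ 3 * b c - 28 * a c ^ 3 - 20 * a c ^ 2 * b c ^ 3 - 44 * a c ^ 2 * b c ^ 2
     - 86 * a c ^ 2 * b c - 10 * a c ^ 2 + 12 * a c * b c ^ 4 + 16 * a c * b c ^ 3
     + 22 * a c * b c ^ 2 + 76 * a c * b c + 8 * a c - 960 * b c ^ 6 * r c ^ 2 * c
     - 240 * b c ^ 6 * r c ^ 2 - 960 * b c ^ 6 * r c * c - 240 * b c ^ 6 * r c
     + 960 * b c ^ 5 * r c ^ 2 * c - 528 * b c ^ 5 * r c ^ 2 + 1824 * b c ^ 5 * r c * c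
     - 360 * b c ^ 5 * r c - 144 * b c ^ 4 * r c ^ 2 * c + 444 * b c ^ 4 * r c ^ 2
     - 984 * b c ^ 4 * r c * c + 870 * b c ^ 4 * r c + 64 * b c ^ 3 * r c ^ 2
     + 120 * b c ^ 3 * r c * c - 322 * b c ^ 3 * r c + 80 * b c ^ 2 * r c ^ 2
     - 22 * b c ^ 2 * r c + 162 * b c * r c ^ 2 - 76 * b c * r c + 180 * r c ^ 2 * P c
     - 18 * r c ^ 2 * R c + 18 * r c ^ 2 - 8 * r c)"
  have dG: "(G has_real_derivative K c - 2 * G c) (at c)" if "0 \<le> c" "c \<le> C" for c
    unfolding G_def K_def
    by (rule DERIV_cong, (rule derivative_intros dA dB dr dw dY dP[OF that] dR[OF that])+)
       (simp, use rel(1,2)[of c] in Groebner_Basis.algebra)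
  have dK: "(K has_real_derivative K1 c) (at c)" if "0 \<le> c" "c \<le> C" for c
    unfolding K_def K1_def
    by (rule DERIV_cong, (rule derivative_intros dA dB dr dw dY dP[OF that] dR[OF that])+)
       (simp, use rel(1,2)[of c] in Groebner_Basis.algebra)
  have dK1: "(K1 has_real_derivative w c * M c - 2 * K1 c) (at c)" if "0 \<le> c" "c \<le> C" for c
    unfolding K1_def M_def
    by (rule DERIV_cong, (rule derivative_intros dA dB dr dw dY dP[OF that] dR[OF that])+)
       (simp, use rel(1,2)[of c] in Groebner_Basis.algebra)
  have dM: "(M has_real_derivative Q c) (at c)" if "0 \<le> c" "c \<le> C" for c
    unfolding M_def Q_def
    by (rule DERIV_cong, (rule derivative_intros dA dB dr dw dY dP[OF that] dR[OF that])+)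
       (simp, use rel(1,2)[of c] in Groebner_Basis.algebra)
  have ab0: "b 0 = a 0" by (simp add: a_def b_def)
  have a0: "0 \<le> a 0" "a 0 < 1" using ab(2,4)[of 0] by auto
  have pw: "a 0 ^ j \<le> a 0 ^ i" if "i \<le> j" for i j
    using a0 that by (intro power_decreasing) auto
  \<comment> \<open>At \<open>c = 0\<close> the two points coincide, so \<open>a = b\<close>; the
    factor \<open>1 - a\<close> clears the denominator of \<open>r = a / (1 - a)\<close>.\<close>
  have "G 0 * (1 - a 0) = 0" "K 0 * (1 - a 0) = 0"
    unfolding G_def K_def using rel(1)[of 0] ab0 at_0 Y_0 by (simp_all, Groebner_Basis.algebra+)
  then have G0: "G 0 = 0" and K0: "K 0 = 0" using a0 by auto
  have "K1 0 * (1 - a 0) = 24 * a 0^2 - 24 * a 0^4"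
    unfolding K1_def using rel(1)[of 0] ab0 at_0 by (simp, Groebner_Basis.algebra)
  also have "\<dots> \<ge> 0" using pw[of 2 4] by simp
  finally have K10: "K1 0 \<ge> 0" using a0 by (simp add: zero_le_mult_iff)
  have "M 0 * (1 - a 0) ^ 2 = 288 * a 0^4 - 64 * a 0^6 - 224 * a 0^5"
    unfolding M_def using rel(1)[of 0] ab0 at_0 by (simp, Groebner_Basis.algebra)
  also have "\<dots> \<ge> 0" using pw[of 4 5] pw[of 4 6] by simp
  finally have M0: "M 0 \<ge> 0" using a0 by (simp add: zero_le_mult_iff)
  have Q: "Q c \<ge> 0" if c: "0 \<le> c" "c \<le> C" for c
  proof -
    \<comment> \<open>The factor \<open>(1 - a) ^ 2\<close> clears \<open>r ^ 2\<close>. The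
      remaining transcendental part is nonnegative because
      \<open>180 * P - 18 * R \<ge> 144 * P \<ge> 144 * c * a * b\<close>.\<close>
    have "Q c * (1 - a c) ^ 2 = (102 * a c^6 - 24 * a c^7 - 36 * a c^6 * b c + 28 * a c^5 * b c^2 + 160 * a c^5 * b c
       - 160 * a c^5 - 20 * a c^4 * b c^3 - 100 * a c^4 * b c^2 - 298 * a c^4 * b c + 100 * a c^4
       + 12 * a c^3 * b c^4 + 56 * a c^3 * b c^3 + 138 * a c^3 * b c^2 + 336 * a c^3 * b c
       - 168 * a c^2 * b c^5 - 450 * a c^2 * b c^4 + 334 * a c^2 * b c^3 + 14 * a c^2 * b c^2
       - 240 * a c * b c^6 - 360 * a c * b c^5 + 882 * a c * b c^4 - 306 * a c * b c^3)
      + c * (144 * a c^3 * b c - 864 * a c^2 * b c^5 + 840 * a c^2 * b c^4 - 120 * a c^2 * b c^3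
       - 960 * a c * b c^6 + 1824 * a c * b c^5 - 984 * a c * b c^4 + 120 * a c * b c^3)
      + a c ^ 2 * (180 * P c - 18 * R c - 144 * (c * (a c * b c)))"
      unfolding Q_def using rel(1)[of c] by Groebner_Basis.algebra
    also have "\<dots> \<ge> 0"
    proof -
      note p = kernel_slope_poly_pos[OF less_imp_le[OF ab(1)] ab(3)[OF c(1)] less_imp_le[OF ab(2)]]
      have "0 \<le> a c ^ 2 * (180 * P c - 18 * R c - 144 * (c * (a c * b c)))"
        using P_lower[OF c] R_upper[OF c] by simp
      then show ?thesis
        by (rule add_nonneg_nonneg[OF add_nonneg_nonneg[OF p(1) mult_nonneg_nonneg[OF c(1) p(2)]]])
    qed
    finally show ?thesis using ab(2)[of c] by (simp add: zero_le_mult_iff)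
  qed
  have M: "M c \<ge> 0" if c: "0 \<le> c" "c \<le> C" for c
    using nonneg_ode[of C M Q 0, OF dM _ M0 c] Q by simp
  have K1: "K1 c \<ge> 0" if c: "0 \<le> c" "c \<le> C" for c
    using nonneg_ode[of C K1 _ 2, OF dK1 _ K10 c] M by (simp add: w_def)
  have K: "K c \<ge> 0" if c: "0 \<le> c" "c \<le> C" for c
    using nonneg_ode[of C K _ 0, OF dK _ _ c] K1 K0 by simp
  show ?thesis
    using nonneg_ode[of C G _ 2, OF dG _ _ c] K G0 by (simp add: G_def)
qed

text \<open>The same chain for the expression to which \<open>V_nonneg\<close> reduces when
  \<open>a \<le> 1/2\<close> and \<open>H\<close> is replaced by its upper bound
  \<open>G0\<close>.\<close>

lemma kernel_gap_nonneg:
  assumes c: "0 \<le> c" "c \<le> C"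
  shows "4 * b c * c - a c - 8 * b c * r c * c - 3 * b c * r c - 2 * b c + 10 * r c * P c - r c * R c
     + 3 * r c - 4 * w c * P c + w c * R c - 2 * Y c \<ge> 0"
proof -
  define G where "G = (\<lambda>c. 4 * b c * c - a c - 8 * b c * r c * c - 3 * b c * r c - 2 * b c + 10 * r c * P c - r c * R c
     + 3 * r c - 4 * w c * P c + w c * R c - 2 * Y c)"
  define K where "K = (\<lambda>c. a c ^ 2 - 4 * a c * b c - 5 * a c - 8 * b c ^ 2 * r c * c - 4 * b c ^ 2 * r c
     + 4 * b c ^ 2 * c - b c ^ 2 - 16 * b c * r c * c - 5 * b c * r c + 4 * b c * c - 4 * b c
     + 30 * r c * P c - 3 * r c * R c + 9 * r c - 4 * w c * P c + w c * R c - 4 * Y c)"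
  define K1 where "K1 = (\<lambda>c. 6 * a c ^ 2 * b c - 2 * a c ^ 3 + 7 * a c ^ 2 - 2 * a c * b c ^ 2 - 22 * a c * b c - 9 * a c
     - 16 * b c ^ 3 * r c * c - 8 * b c ^ 3 * r c + 8 * b c ^ 3 * c - 2 * b c ^ 3
     - 8 * b c ^ 2 * r c * c - 12 * b c ^ 2 * r c - 4 * b c ^ 2 * c + 3 * b c ^ 2
     + 11 * b c * r c - 4 * b c * c + 30 * r c * P c - 3 * r c * R c + 9 * r c + 4 * w c * P c
     - w c * R c)"
  define M where "M = (\<lambda>c. 12 * a c ^ 3 * b c - 6 * a c ^ 4 + 18 * a c ^ 3 - 8 * a c ^ 2 * b c ^ 2 - 32 * a c ^ 2 * b c
     - 19 * a c ^ 2 + 4 * a c * b c ^ 3 + 12 * a c * b c ^ 2 + 44 * a c * b c + 8 * a c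
     - 48 * b c ^ 4 * r c ^ 2 * c - 24 * b c ^ 4 * r c ^ 2 + 24 * b c ^ 4 * r c * c
     - 6 * b c ^ 4 * r c - 16 * b c ^ 3 * r c ^ 2 * c - 40 * b c ^ 3 * r c ^ 2
     - 16 * b c ^ 3 * r c * c + 12 * b c ^ 3 * r c - 8 * b c ^ 2 * r c ^ 2 * c
     - 12 * b c ^ 2 * r c ^ 2 - 4 * b c ^ 2 * r c * c - 17 * b c ^ 2 * r c + 49 * b c * r c ^ 2
     - 4 * b c * r c * c - 44 * b c * r c + 90 * r c ^ 2 * P c - 9 * r c ^ 2 * R c + 27 * r c ^ 2
     - 8 * r c + 4 * P c - R c)"
  define Q where "Q = (\<lambda>c. 24 * a c ^ 5 - 36 * a c ^ 4 * b c - 78 * a c ^ 4 + 28 * a c ^ 3 * b c ^ 2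
     + 88 * a c ^ 3 * b c + 92 * a c ^ 3 - 20 * a c ^ 2 * b c ^ 3 - 44 * a c ^ 2 * b c ^ 2
     - 86 * a c ^ 2 * b c - 46 * a c ^ 2 + 12 * a c * b c ^ 4 + 16 * a c * b c ^ 3
     + 22 * a c * b c ^ 2 + 76 * a c * b c + 8 * a c - 192 * b c ^ 5 * r c ^ 2 * c
     - 96 * b c ^ 5 * r c ^ 2 + 96 * b c ^ 5 * r c * c - 24 * b c ^ 5 * r c
     + 48 * b c ^ 4 * r c ^ 2 * c - 120 * b c ^ 4 * r c ^ 2 - 120 * b c ^ 4 * r c * c
     + 78 * b c ^ 4 * r c + 24 * b c ^ 3 * r c * c - 74 * b c ^ 3 * r c + 32 * b c ^ 2 * r c ^ 2
     - 22 * b c ^ 2 * r c + 130 * b c * r c ^ 2 - 76 * b c * r c + 180 * r c ^ 2 * P c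
     - 18 * r c ^ 2 * R c + 54 * r c ^ 2 - 8 * r c)"
  have dG: "(G has_real_derivative K c - 2 * G c) (at c)" if "0 \<le> c" "c \<le> C" for c
    unfolding G_def K_def
    by (rule DERIV_cong, (rule derivative_intros dA dB dr dw dY dP[OF that] dR[OF that])+)
       (simp, use rel(1,2)[of c] in Groebner_Basis.algebra)
  have dK: "(K has_real_derivative K1 c) (at c)" if "0 \<le> c" "c \<le> C" for c
    unfolding K_def K1_def
    by (rule DERIV_cong, (rule derivative_intros dA dB dr dw dY dP[OF that] dR[OF that])+)
       (simp, use rel(1,2)[of c] in Groebner_Basis.algebra)
  have dK1: "(K1 has_real_derivative w c * M c - 2 * K1 c) (at c)" if "0 \<le> c" "c \<le> C" for c
    unfolding K1_def M_def
    by (rule DERIV_cong, (rule derivative_intros dA dB dr dw dY dP[OF that] dR[OF that])+)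
       (simp, use rel(1,2)[of c] in Groebner_Basis.algebra)
  have dM: "(M has_real_derivative Q c) (at c)" if "0 \<le> c" "c \<le> C" for c
    unfolding M_def Q_def
    by (rule DERIV_cong, (rule derivative_intros dA dB dr dw dY dP[OF that] dR[OF that])+)
       (simp, use rel(1,2)[of c] in Groebner_Basis.algebra)
  have ab0: "b 0 = a 0" by (simp add: a_def b_def)
  have a0: "0 \<le> a 0" "a 0 < 1" using ab(2,4)[of 0] by auto
  have pw: "a 0 ^ j \<le> a 0 ^ i" if "i \<le> j" for i j
    using a0 that by (intro power_decreasing) auto
  have "G 0 * (1 - a 0) = 0" "K 0 * (1 - a 0) = 0"
    unfolding G_def K_def using rel(1)[of 0] ab0 at_0 Y_0 by (simp_all, Groebner_Basis.algebra+)
  then have G0: "G 0 = 0" and K0: "K 0 = 0" using a0 by auto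
  have "K1 0 * (1 - a 0) = 8 * a 0^2 - 8 * a 0^4"
    unfolding K1_def using rel(1)[of 0] ab0 at_0 by (simp, Groebner_Basis.algebra)
  also have "\<dots> \<ge> 0" using pw[of 2 4] by simp
  finally have K10: "K1 0 \<ge> 0" using a0 by (simp add: zero_le_mult_iff)
  have "M 0 * (1 - a 0) ^ 2 = 48 * a 0^4 - 16 * a 0^6 - 64 * a 0^5 + 32 * a 0^3"
    unfolding M_def using rel(1)[of 0] ab0 at_0 by (simp, Groebner_Basis.algebra)
  also have "\<dots> \<ge> 0" using pw[of 3 6] pw[of 4 5] pw[of 3 5] by simp
  finally have M0: "M 0 \<ge> 0" using a0 by (simp add: zero_le_mult_iff)
  have Q: "Q c \<ge> 0" if c: "0 \<le> c" "c \<le> C" for c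
  proof -
    have "Q c * (1 - a c) ^ 2 = (24 * a c^7 - 36 * a c^6 * b c - 126 * a c^6 + 28 * a c^5 * b c^2 + 160 * a c^5 * b c
       + 272 * a c^5 - 20 * a c^4 * b c^3 - 100 * a c^4 * b c^2 - 298 * a c^4 * b c - 308 * a c^4
       + 12 * a c^3 * b c^4 + 56 * a c^3 * b c^3 + 138 * a c^3 * b c^2 + 336 * a c^3 * b c
       + 192 * a c^3 - 72 * a c^2 * b c^5 - 222 * a c^2 * b c^4 + 22 * a c^2 * b c^3
       - 34 * a c^2 * b c^2 - 32 * a c^2 * b c - 24 * a c * b c^5 + 90 * a c * b c^4
       - 58 * a c * b c^3)
      + c * (144 * a c^3 * b c - 288 * a c^2 * b c^5 + 168 * a c^2 * b c^4 - 24 * a c^2 * b c^3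
       + 96 * a c * b c^5 - 120 * a c * b c^4 + 24 * a c * b c^3)
      + a c ^ 2 * (180 * P c - 18 * R c - 144 * (c * (a c * b c)))"
      unfolding Q_def using rel(1)[of c] by Groebner_Basis.algebra
    also have "\<dots> \<ge> 0"
    proof -
      note p = kernel_gap_poly_pos[OF less_imp_le[OF ab(1)] ab(3)[OF c(1)] less_imp_le[OF ab(2)]]
      have "0 \<le> a c ^ 2 * (180 * P c - 18 * R c - 144 * (c * (a c * b c)))"
        using P_lower[OF c] R_upper[OF c] by simp
      then show ?thesis
        by (rule add_nonneg_nonneg[OF add_nonneg_nonneg[OF p(1) mult_nonneg_nonneg[OF c(1) p(2)]]])
    qed
    finally show ?thesis using ab(2)[of c] by (simp add: zero_le_mult_iff)
  qed
  have M: "M c \<ge> 0" if c: "0 \<le> c" "c \<le> C" for c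
    using nonneg_ode[of C M Q 0, OF dM _ M0 c] Q by simp
  have K1: "K1 c \<ge> 0" if c: "0 \<le> c" "c \<le> C" for c
    using nonneg_ode[of C K1 _ 2, OF dK1 _ K10 c] M by (simp add: w_def)
  have K: "K c \<ge> 0" if c: "0 \<le> c" "c \<le> C" for c
    using nonneg_ode[of C K _ 0, OF dK _ _ c] K1 K0 by simp
  show ?thesis
    using nonneg_ode[of C G _ 2, OF dG _ _ c] K G0 by (simp add: G_def)
qed

definition "z c = a c - b c"
text \<open>Chosen so that \<open>Rk (a c) 0 c = a * (1 - a) * (G0 - H)\<close>: the bound
  \<open>H \<le> G0\<close> is the extreme case in which the third point of \<open>tri\<close>
  coincides with \<open>x + c\<close>.\<close>

definition "G0 c = (14 + 10 * r c + 4 * w c) * P c - (2 + r c + w c) * R c - 8 * c * b c * (1 + r c)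
  + (a c - b c) * (1 + r c)"

lemma H_le_G0:
  assumes c: "0 \<le> c" "c \<le> C"
  shows "H c \<le> G0 c"
proof -
  define G where "G = (\<lambda>c. a c - 8 * b c ^ 2 * r c * c - 2 * b c ^ 2 * r c - 8 * b c ^ 2 * c - 2 * b c ^ 2 + b c * r c + 4 * b c * c - 2 * b c + 10 * r c * P c - r c * R c + r c - 4 * w c * P c + w c * R c - 2 * Y c)"
  have "0 \<le> (\<lambda>c. G0 c - H c) c"
  proof (rule nonneg_ode[where F' = G and k = 0, OF _ _ _ c])
    show "((\<lambda>c. G0 c - H c) has_real_derivative G c) (at c)"
      if "0 \<le> c" "c \<le> C" for c
      unfolding G0_def G_def
      by (rule DERIV_cong, (rule derivative_intros dA dB dr dw dR[OF that] dP[OF that] dH[OF that])+)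
        (simp, use rel(1,2)[of c] in Groebner_Basis.algebra)
    show "0 \<le> G c + 0 * (G0 c - H c)" if "0 \<le> c" "c \<le> C" for c
      using kernel_slope_nonneg[OF that] by (simp add: G_def)
    show "0 \<le> G0 0 - H 0" using at_0 by (simp add: G0_def ab_0)
  qed
  then show ?thesis by simp
qed

lemma H_ge:
  assumes c: "0 \<le> c" "c \<le> C"
  shows "- Y c \<le> H c"
proof -
  have Y: "0 \<le> Y c" if "0 \<le> c" for c
    unfolding Y_def using that by (simp add: add_pos_pos)
  have "0 \<le> (\<lambda>c. H c + Y c) c"
  proof (rule nonneg_ode[where F' = "\<lambda>c. 2 * Y c + 4 * c * b c" and k = 0, OF _ _ _ c])
    show "((\<lambda>c. H c + Y c) has_real_derivative 2 * Y c + 4 * c * b c) (at c)"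
      if "0 \<le> c" "c \<le> C" for c
      by (rule DERIV_cong, (rule derivative_intros dY dH[OF that])+) simp
    show "0 \<le> 2 * Y c + 4 * c * b c + 0 * (H c + Y c)" if "0 \<le> c" "c \<le> C" for c
      using that ab[of c] Y by simp
  qed (use at_0 Y_0 in simp)
  then show ?thesis by simp
qed

text \<open>\<open>Y\<close> is \<open>ln X\<close> for
  \<open>X = (1 - b) / (1 - a) \<ge> 1\<close>, and
  \<open>ln X \<le> (X - 1 / X) / 2\<close>.\<close>

lemma Y_le: assumes "0 \<le> c" shows "Y c \<le> (a c - b c) * (2 - a c - b c) / (2 * (1 - a c) * (1 - b c))"
proof -
  define X where "X = (1 - b c) / (1 - a c)"
  have X: "X \<ge> 1" using ab[of c] assms by (simp add: X_def)
  have e: "1 + exp t > 0" "1 - sg t = 1 / (1 + exp t)" for t :: real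
  proof -
    show p: "1 + exp t > 0" by (simp add: add_pos_pos)
    have "sg t = exp t / (1 + exp t)" by (simp add: sg_def exp_minus field_simps)
    then show "1 - sg t = 1 / (1 + exp t)" using p by (simp add: field_simps)
  qed
  have "Y c = ln X"
    unfolding Y_def X_def a_def b_def e using e(1)[of "x + c"] e(1)[of "x - c"]
    by (simp add: ln_div less_imp_neq[symmetric])
  also have "\<dots> \<le> (X - 1 / X) / 2"
  proof -
    have "(\<lambda>x. ln x - (x - 1 / x) / 2) X \<le> (\<lambda>x. ln x - (x - 1 / x) / 2) 1"
    proof (rule DERIV_nonpos_imp_nonincreasing[OF X])
      fix s :: real assume s: "1 \<le> s" "s \<le> X"
      have "((\<lambda>x. ln x - (x - 1 / x) / 2) has_real_derivative - ((1 - 1 / s)\<^sup>2 / 2)) (at s)"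
        using s by (auto intro!: derivative_eq_intros simp: field_simps power2_eq_square)
      then show "\<exists>y. ((\<lambda>x. ln x - (x - 1 / x) / 2) has_real_derivative y) (at s) \<and> y \<le> 0"
        by (intro exI conjI) auto
    qed
    then show ?thesis by simp
  qed
  also have "\<dots> = (a c - b c) * (2 - a c - b c) / (2 * (1 - a c) * (1 - b c))"
    using ab[of c] assms by (auto simp: X_def field_simps)
  finally show ?thesis .
qed

text \<open>What remains of \<open>V_nonneg\<close> for \<open>a > 1/2\<close> once \<open>H\<close>
  is replaced by its lower bound \<open>- Y\<close>. After \<open>Y_le\<close> and clearing of
  denominators a lower bound for the derivative is again a form in \<open>b\<close>,
  \<open>d\<close>, \<open>v\<close> with nonnegative coefficients.\<close>

lemma W_nonneg:
  assumes c: "0 \<le> c" "c \<le> C"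
  shows "0 \<le> 6 * P c - (1 + 2 * a c) * Y c - 4 * c * b c + (a c - b c) * (3 + 2 * r c)" (is "0 \<le> ?W c")
proof (rule nonneg_ode[where k = 0, OF _ _ _ c])
  let ?W' = "\<lambda>c. 6 * (a c * b c) - 2 * a c * (1 - a c) * Y c - (1 + 2 * a c) * (a c + b c) - 4 * b c
     + 4 * c * b c * (1 - b c) + (a c * (1 - a c) + b c * (1 - b c)) * (3 + 2 * r c) + 2 * (a c - b c) * r c"
  show "(?W has_real_derivative ?W' c) (at c)" if "0 \<le> c" "c \<le> C" for c
    by (rule DERIV_cong, (rule derivative_intros dA dB dr dY dP[OF that])+) Groebner_Basis.algebra
  show "0 \<le> ?W' c + 0 * ?W c" if "0 \<le> c" "c \<le> C" for c
  proof -
    have l: "0 < a c" "0 < b c" "b c \<le> a c" "a c < 1" "b c < 1" using that ab[of c] by auto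
    define d v where "d = a c - b c" and "v = 1 - a c"
    have dv: "0 \<le> d" "0 < v" "a c = b c + d" "1 - b c = d + v" "b c = 1 - d - v" using l by (auto simp: d_def v_def)
    have "2 * a c * (1 - a c) * Y c \<le> 2 * a c * (1 - a c) * ((a c - b c) * (2 - a c - b c) / (2 * (1 - a c) * (1 - b c)))"
      using l that by (intro mult_left_mono Y_le) auto
    also have "\<dots> = a c * (a c - b c) * (2 - a c - b c) / (1 - b c)"
      using l by (simp add: divide_simps)
    finally have lower: "?W' c \<ge> 6 * (a c * b c) - a c * (a c - b c) * (2 - a c - b c) / (1 - b c) - (1 + 2 * a c) * (a c + b c) - 4 * b c
     + 0 + (a c * (1 - a c) + b c * (1 - b c)) * (3 + 2 * r c) + 2 * (a c - b c) * r c"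
      using l that by (intro add_mono diff_mono) auto
    define D where "D = a c * (a c - b c) * (2 - a c - b c) / (1 - b c)"
    have D: "D * (1 - b c) = a c * (a c - b c) * (2 - a c - b c)" using l by (simp add: D_def)
    have k: "0 < (1 - a c) * (1 - b c)" using l by simp
    have "(6 * (a c * b c) - D - (1 + 2 * a c) * (a c + b c) - 4 * b c
     + 0 + (a c * (1 - a c) + b c * (1 - b c)) * (3 + 2 * r c) + 2 * (a c - b c) * r c) * ((1 - a c) * (1 - b c))
     = 4 * b c^2 * d^2 + 4 * b c^2 * d * v + 6 * b c * d^3 + 9 * b c * d^2 * v + 2 * b c * d * v^2
     + 2 * d^4 + 2 * d^3 * v + d^2 * v^2 + 2 * d * v^3"
      unfolding d_def v_def using rel(1)[of c] D by Groebner_Basis.algebra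
    also have "\<dots> \<ge> 0"
      using dv l by (intro add_nonneg_nonneg mult_nonneg_nonneg zero_le_power) simp_all
    finally have "0 \<le> 6 * (a c * b c) - D - (1 + 2 * a c) * (a c + b c) - 4 * b c
     + 0 + (a c * (1 - a c) + b c * (1 - b c)) * (3 + 2 * r c) + 2 * (a c - b c) * r c"
      using mult_pos_pos[OF _ k] k by (simp only: zero_le_mult_iff) linarith
    then show ?thesis using lower unfolding D_def[symmetric] by linarith
  qed
qed (use at_0 Y_0 ab_0 in simp)

text \<open>Up to the factor \<open>a\<close> this is the derivative of \<open>Rk\<close> in
  \<open>h\<close> at \<open>h = 0\<close>. The sign of \<open>1 - 2 * a\<close> decides whether
  \<open>H\<close> has to be bounded above, by \<open>G0\<close>, or below, by
  \<open>- Y\<close>.\<close>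

lemma V_nonneg:
  assumes c: "0 \<le> c" "c \<le> C"
  shows "0 \<le> (1 - a c) * (6 * P c - (1 - 2 * a c) * H c - 2 * Y c - 4 * c * b c + (a c - b c))
    + 2 * (a c - b c)" (is "0 \<le> (1 - a c) * ?B + _")
proof -
  have e: "(1 - a c) * ?B + 2 * (a c - b c) = (1 - a c) * (?B + 2 * (a c - b c) * (1 + r c))"
    using rel(1)[of c] by Groebner_Basis.algebra
  have "0 \<le> ?B + 2 * (a c - b c) * (1 + r c)"
  proof (cases "a c \<le> 1 / 2")
    case True
    have "0 \<le> 6 * P c - (1 - 2 * a c) * G0 c - 2 * Y c - 4 * c * b c + (a c - b c) + 2 * (a c - b c) * (1 + r c)"
    proof -
      have "6 * P c - (1 - 2 * a c) * G0 c - 2 * Y c - 4 * c * b c + (a c - b c) + 2 * (a c - b c) * (1 + r c)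
        = 4 * b c * c - a c - 8 * b c * r c * c - 3 * b c * r c - 2 * b c + 10 * r c * P c - r c * R c + 3 * r c - 4 * w c * P c + w c * R c - 2 * Y c"
        unfolding G0_def using rel(1,2)[of c] by Groebner_Basis.algebra
      then show ?thesis using kernel_gap_nonneg[OF c] by (simp only:)
    qed
    moreover have "(1 - 2 * a c) * H c \<le> (1 - 2 * a c) * G0 c"
      using H_le_G0[OF c] True by (intro mult_left_mono) auto
    ultimately show ?thesis by linarith
  next
    case False
    then have "(2 * a c - 1) * (- Y c) \<le> (2 * a c - 1) * H c"
      using H_ge[OF c] by (intro mult_left_mono) auto
    then show ?thesis using W_nonneg[OF c] by (simp add: algebra_simps)
  qed
  then show ?thesis unfolding e using ab(2)[of c] by simp
qed

lemma Y_nonneg: "0 \<le> c \<Longrightarrow> 0 \<le> Y c"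
  unfolding Y_def by (simp add: add_pos_pos)

lemma Z_le:
  assumes c: "0 \<le> c"
  shows "Y c - (a c - b c) \<le> a c * Y c"
proof -
  have "0 \<le> (\<lambda>c. a c * Y c - Y c + (a c - b c)) c"
  proof (rule nonneg_ode[where F' = "\<lambda>c. (a c - a c ^ 2) * Y c + b c * (a c - b c)" and k = 0, OF _ _ _ c])
    show "((\<lambda>c. a c * Y c - Y c + (a c - b c)) has_real_derivative
      (a c - a c ^ 2) * Y c + b c * (a c - b c)) (at c)" for c
      by (rule DERIV_cong, (rule derivative_intros dA dB dY)+) Groebner_Basis.algebra
    show "0 \<le> (a c - a c ^ 2) * Y c + b c * (a c - b c) + 0 * (a c * Y c - Y c + (a c - b c))"
      if "0 \<le> c" for c
    proof -
      have "a c - a c ^ 2 = a c * (1 - a c)" by Groebner_Basis.algebra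
      then have "0 \<le> a c - a c ^ 2" using ab(2,4)[of c] by simp
      then show ?thesis using that ab[of c] Y_nonneg[of c] by simp
    qed
  qed (use Y_0 ab_0 in auto)
  then show ?thesis by simp
qed

text \<open>With \<open>A = sg (x + c + h)\<close> this is the integral of
  \<open>tri (x + c + h) (x + e) (x - e)\<close> over \<open>0 \<le> e \<le> c\<close>.\<close>

definition "Rk A h c = A ^ 2 * (H c + 2 * h * Y c)
  - A * (H c + 4 * c * b c - (a c - b c) - 6 * P c + 2 * h * (Y c - (a c - b c)))
  + 4 * (P c - c * a c * b c) - R c"

text \<open>Induction on the position of the third point: at \<open>h = 0\<close> the claim is
  \<open>H_le_G0\<close>, and the derivative in \<open>h\<close> is nonnegative since its bracket
  \<open>B\<close> is smallest at \<open>h = 0\<close>, where \<open>V_nonneg\<close>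
  applies.\<close>

lemma Rk_nonneg:
  assumes c: "0 \<le> c" "c \<le> C" and h: "0 \<le> h"
  shows "0 \<le> Rk (sg (x + c + h)) h c"
proof (rule nonneg_ode[where k = 0 and F = "\<lambda>h. Rk (sg (x + c + h)) h c", OF _ _ _ h order_refl])
  have "Rk (a c) 0 c = a c * (1 - a c) * (G0 c - H c)"
    unfolding Rk_def G0_def using rel(1,2)[of c] by Groebner_Basis.algebra
  also have "\<dots> \<ge> 0" using H_le_G0[OF c] ab(2,4)[of c] by simp
  finally show "0 \<le> Rk (sg (x + c + 0)) 0 c" by (simp add: a_def)
  define B where "B A h = 6 * P c - (1 - 2 * A) * H c - 2 * Y c - 4 * c * b c + (a c - b c)
    + 2 * h * (2 * A * Y c - (Y c - (a c - b c)))" for A h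
  let ?A = "\<lambda>h. sg (x + c + h)"
  have dA': "(?A has_real_derivative ?A h - ?A h ^ 2) (at h)" for h
    by (rule DERIV_cong, rule DERIV_chain'[OF _ DERIV_sg]) (auto intro!: derivative_eq_intros)
  show "((\<lambda>h. Rk (?A h) h c) has_real_derivative ?A h * ((1 - ?A h) * B (?A h) h + 2 * (a c - b c))) (at h)" for h
    unfolding Rk_def B_def
    by (rule DERIV_cong, (rule derivative_intros dA')+) (simp, Groebner_Basis.algebra)
  fix s assume s: "0 \<le> s" "s \<le> h"
  have sgb: "0 < sg t" "sg t < 1" for t :: real by (simp_all add: sg_def add_pos_pos divide_simps)
  have mono: "sg t \<le> sg u" if "t \<le> u" for t u using that by (simp add: sg_def frac_le add_pos_pos)
  define A where "A = ?A s"
  have A: "a c \<le> A" "A < 1" "0 < A" using mono[of "x + c" "x + c + s"] s sgb by (auto simp: a_def A_def)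
  \<comment> \<open>The logarithmic derivative of \<open>sg\<close> is at most 1. This is what
    allows the gain \<open>s * A * Y\<close> to absorb \<open>(A - a) * H\<close>, which may be as
    low as \<open>- (A - a) * Y\<close>.\<close>
  have "A - a c \<le> s * A"
  proof -
    have "0 \<le> (\<lambda>s. s * ?A s - ?A s + a c) s"
    proof (rule nonneg_ode[where k = 0, OF _ _ _ s(1) order_refl])
      show "((\<lambda>s. s * ?A s - ?A s + a c) has_real_derivative s * (?A s * (1 - ?A s)) + ?A s ^ 2) (at s)" for s
        by (rule DERIV_cong, (rule derivative_intros dA')+) Groebner_Basis.algebra
      show "0 \<le> s * (?A s * (1 - ?A s)) + ?A s ^ 2 + 0 * (s * ?A s - ?A s + a c)" if "0 \<le> s" for s
        using that sgb[of "x + c + s"] by simp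
    qed (simp add: a_def)
    then show ?thesis by (simp add: A_def)
  qed
  then have "(A - a c) * (- Y c) \<ge> - (s * A) * Y c"
    using mult_right_mono[of "A - a c" "s * A" "Y c"] Y_nonneg[OF c(1)] by simp
  moreover have "(A - a c) * H c \<ge> (A - a c) * (- Y c)"
    using H_ge[OF c] A by (intro mult_left_mono) auto
  moreover have "0 \<le> s * (A * Y c - (Y c - (a c - b c)))"
    using Z_le[OF c(1)] mult_right_mono[OF A(1) Y_nonneg[OF c(1)]] s by simp
  moreover have "B A s - B (a c) 0 = 2 * ((A - a c) * H c) + 2 * (s * A * Y c) + 2 * (s * (A * Y c - (Y c - (a c - b c))))"
    unfolding B_def by Groebner_Basis.algebra
  ultimately have B: "B (a c) 0 \<le> B A s" by simp
  have "0 \<le> (1 - A) * B A s + 2 * (a c - b c)"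
  proof (cases "0 \<le> B A s")
    case True
    then show ?thesis using A ab(3)[OF c(1)] by simp
  next
    case False
    have "(1 - a c) * B (a c) 0 \<le> (1 - A) * B (a c) 0"
      using A False B by (intro mult_right_mono_neg) auto
    also have "\<dots> \<le> (1 - A) * B A s" using A B by (intro mult_left_mono) auto
    finally show ?thesis using V_nonneg[OF c] by (simp add: B_def)
  qed
  then show "0 \<le> ?A s * ((1 - ?A s) * B (?A s) s + 2 * (a c - b c)) + 0 * Rk (?A s) s c"
    using A by (simp add: A_def)
qed

end

text \<open>Symmetric in its arguments. Integrated against a product density it yields six times the
  difference of the two sides of \<open>logistic_moment_inequality\<close>. It has no fixed sign:
  for two equal arguments and a third one tending to minus infinity it becomes negative.\<close>

definition tri :: "real \<Rightarrow> real \<Rightarrow> real \<Rightarrow> real" where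
  "tri a1 a2 a3 = (let u = sg a1; v = sg a2; w = sg a3 in
     2 * (u * v * (u - v) * (a1 - a2) + u * w * (u - w) * (a1 - a3) + v * w * (v - w) * (a2 - a3))
     - (u * (v - w)\<^sup>2 + v * (u - w)\<^sup>2 + w * (u - v)\<^sup>2))"

text \<open>Positivity appears after averaging over pairs symmetric about \<open>x\<close>, with the
  largest point \<open>x + L\<close> held fixed. \<open>Rk A (L - e) e\<close> is an antiderivative
  in \<open>e\<close>, because \<open>A\<close> depends on \<open>x + L\<close> only.\<close>

lemma tri_integral_nonneg:
  assumes c: "0 \<le> c" "c \<le> L"
  shows "((\<lambda>e. tri (x + L) (x + e) (x - e)) has_integral J) {0..c} \<Longrightarrow> 0 \<le> J"
proof -
  define a b where "a = (\<lambda>c. sg (x + c))" and "b = (\<lambda>c. sg (x - c))"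
  define Y where "Y = (\<lambda>c. ln (1 + exp (x + c)) - ln (1 + exp (x - c)))"
  have ne: "1 + exp (t::real) \<noteq> 0" for t by (simp add: add_pos_pos less_imp_neq[symmetric])
  have sgc: "continuous_on S (\<lambda>s. sg (f s))" if "continuous_on S f" for S and f :: "real \<Rightarrow> real"
    unfolding sg_def using that ne by (intro continuous_intros) auto
  have lnc: "continuous_on S (\<lambda>s. ln (1 + exp (f s)))" if "continuous_on S f" for S and f :: "real \<Rightarrow> real"
    using that ne by (intro continuous_intros) auto
  have anti: "\<exists>G. G 0 = 0 \<and> (\<forall>s. 0 \<le> s \<longrightarrow> s \<le> c \<longrightarrow> (G has_real_derivative f s) (at s))"
    if f: "continuous_on {-1..c+1} f" for f :: "real \<Rightarrow> real"
  proof -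
    obtain g where g: "\<And>s. s \<in> {-1..c+1} \<Longrightarrow> (g has_vector_derivative f s) (at s within {-1..c+1})"
      using antiderivative_continuous[OF f] by blast
    have "(g has_real_derivative f s) (at s)" if "0 \<le> s" "s \<le> c" for s
      using g[of s] that at_within_Icc_at[of "-1" s "c+1"]
      by (simp add: has_real_derivative_iff_has_vector_derivative)
    then show ?thesis
      by (intro exI[of _ "\<lambda>s. g s - g 0"]) (auto intro!: derivative_eq_intros)
  qed
  have cont: "continuous_on S (\<lambda>s. a s * b s)" "continuous_on S (\<lambda>s. a s * b s * (a s + b s))"
    "continuous_on S (\<lambda>s. 2 * Y s + 4 * s * b s - a s - b s)" for S
    unfolding a_def b_def Y_def by (intro continuous_intros sgc lnc)+
  obtain P where P: "P 0 = 0" "\<And>s. 0 \<le> s \<Longrightarrow> s \<le> c \<Longrightarrow> (P has_real_derivative a s * b s) (at s)"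
    using anti[of "\<lambda>s. a s * b s", OF cont(1)] by blast
  obtain R where R: "R 0 = 0" "\<And>s. 0 \<le> s \<Longrightarrow> s \<le> c \<Longrightarrow> (R has_real_derivative a s * b s * (a s + b s)) (at s)"
    using anti[of "\<lambda>s. a s * b s * (a s + b s)", OF cont(2)] by blast
  obtain H where H: "H 0 = 0" "\<And>s. 0 \<le> s \<Longrightarrow> s \<le> c \<Longrightarrow> (H has_real_derivative 2 * Y s + 4 * s * b s - a s - b s) (at s)"
    using anti[of "\<lambda>s. 2 * Y s + 4 * s * b s - a s - b s", OF cont(3)] by blast
  interpret logistic_calculus x c P R H a b "\<lambda>c. exp (x + c)" "\<lambda>c. exp (- (x + c))" Y
    by unfold_locales (use P R H in \<open>auto simp: a_def b_def Y_def\<close>)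
  define A where "A = sg (x + L)"
  have "((\<lambda>e. tri (x + L) (x + e) (x - e)) has_integral Rk A (L - c) c - Rk A (L - 0) 0) {0..c}"
  proof (rule fundamental_theorem_of_calculus[OF c(1)])
    fix e assume "e \<in> {0..c}"
    then have e': "0 \<le> e" "e \<le> c" by auto
    have "((\<lambda>e. Rk A (L - e) e) has_real_derivative tri (x + L) (x + e) (x - e)) (at e)"
      unfolding Rk_def
    proof (rule DERIV_cong, (rule derivative_intros dA dB dY P(2)[OF e'] R(2)[OF e'] H(2)[OF e'])+, goal_cases)
      case 1
      have "tri (x + L) (x + e) (x - e) =
        2 * (A * a e * (A - a e) * (L - e) + A * b e * (A - b e) * (L + e) + a e * b e * (a e - b e) * (2 * e))
        - (A * (a e - b e)\<^sup>2 + a e * (A - b e)\<^sup>2 + b e * (A - a e)\<^sup>2)"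
        by (simp add: tri_def Let_def A_def a_def b_def)
      then show ?case by Groebner_Basis.algebra
    qed
    then show "((\<lambda>e. Rk A (L - e) e) has_vector_derivative tri (x + L) (x + e) (x - e)) (at e within {0..c})"
      by (simp add: has_real_derivative_iff_has_vector_derivative has_vector_derivative_at_within)
  qed
  note I = this
  have R0: "Rk A (L - 0) 0 = 0" unfolding Rk_def using at_0 Y_0 ab_0 by simp
  have Rc: "0 \<le> Rk A (L - c) c" using Rk_nonneg[of c "L - c"] c by (simp add: A_def)
  show "0 \<le> J" if "((\<lambda>e. tri (x + L) (x + e) (x - e)) has_integral J) {0..c}"
    using has_integral_unique[OF that I] Rc unfolding R0 by linarith
qed

section \<open>A moment inequality for midpoint-decreasing densities\<close>

lemma sg_pos: "0 < sg t" and sg_less_1: "sg t < 1"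
  by (simp_all add: sg_def add_pos_pos divide_simps)

lemma sg_mono: "a \<le> b \<Longrightarrow> sg a \<le> sg b"
  by (simp add: sg_def frac_le add_pos_pos)

lemma continuous_on_sg [continuous_intros]:
  "continuous_on S f \<Longrightarrow> continuous_on S (\<lambda>s. sg (f s))"
  unfolding sg_def by (intro continuous_intros) (auto simp: add_pos_pos less_imp_neq[symmetric])

lemma sg_measurable [measurable]: "sg \<in> borel_measurable borel"
  by (intro borel_measurable_continuous_onI continuous_intros)

lemma tri_measurable [measurable]:
  assumes [measurable]: "f \<in> borel_measurable M" "g \<in> borel_measurable M" "h \<in> borel_measurable M"
  shows "(\<lambda>x. tri (f x) (g x) (h x)) \<in> borel_measurable M"
  unfolding tri_def Let_def by measurable

lemma tri_commute12: "tri a b c = tri b a c"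
  unfolding tri_def Let_def by Groebner_Basis.algebra
lemma tri_commute23: "tri a b c = tri a c b"
  unfolding tri_def Let_def by Groebner_Basis.algebra

lemma abs_tri_le: "\<bar>tri a b c\<bar> \<le> 4 * ((1 + \<bar>a\<bar>) * (1 + \<bar>b\<bar>) * (1 + \<bar>c\<bar>))"
proof -
  have p: "\<bar>sg s * sg t * (sg s - sg t) * (s - t)\<bar> \<le> \<bar>s\<bar> + \<bar>t\<bar>" for s t
  proof -
    have "\<bar>sg s * sg t * (sg s - sg t) * (s - t)\<bar> = \<bar>sg s * sg t * (sg s - sg t)\<bar> * \<bar>s - t\<bar>"
      by (simp add: abs_mult)
    also have "\<dots> \<le> 1 * (\<bar>s\<bar> + \<bar>t\<bar>)"
    proof (rule mult_mono)
      have "\<bar>sg s - sg t\<bar> \<le> 1" using sg_pos[of s] sg_pos[of t] sg_less_1[of s] sg_less_1[of t] by linarith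
      moreover have "\<bar>sg s * sg t\<bar> \<le> 1" using sg_pos[of s] sg_pos[of t] sg_less_1[of s] sg_less_1[of t]
        by (simp add: mult_le_one abs_mult)
      ultimately show "\<bar>sg s * sg t * (sg s - sg t)\<bar> \<le> 1" by (simp only: abs_mult[of "sg s * sg t"] mult_le_one abs_ge_zero)
    qed auto
    finally show ?thesis by simp
  qed
  have q: "\<bar>sg s * (sg t - sg r)\<^sup>2\<bar> \<le> 1" for s t r
  proof -
    have "\<bar>sg t - sg r\<bar> \<le> 1" using sg_pos[of r] sg_pos[of t] sg_less_1[of r] sg_less_1[of t] by linarith
    then have "(sg t - sg r)\<^sup>2 \<le> 1" by (simp add: abs_square_le_1)
    then show ?thesis using sg_pos[of s] sg_less_1[of s] by (simp add: abs_mult mult_le_one)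
  qed
  have "\<bar>tri a b c\<bar> \<le> 2 * ((\<bar>a\<bar> + \<bar>b\<bar>) + (\<bar>a\<bar> + \<bar>c\<bar>) + (\<bar>b\<bar> + \<bar>c\<bar>)) + 3"
  proof -
    have "\<bar>2 * (p1 + p2 + p3) - (q1 + q2 + q3)\<bar> \<le> 2 * (u1 + u2 + u3) + 3"
      if "\<bar>p1\<bar> \<le> u1" "\<bar>p2\<bar> \<le> u2" "\<bar>p3\<bar> \<le> u3" "\<bar>q1\<bar> \<le> 1" "\<bar>q2\<bar> \<le> 1" "\<bar>q3\<bar> \<le> 1"
      for p1 p2 p3 q1 q2 q3 u1 u2 u3 :: real
      using that by (auto simp: abs_le_iff)
    from this[OF p[of a b] p[of a c] p[of b c] q[of a b c] q[of b a c] q[of c a b]]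
    show ?thesis unfolding tri_def Let_def .
  qed
  also have "\<dots> \<le> 4 * (1 + \<bar>a\<bar> + \<bar>b\<bar> + \<bar>c\<bar>)" by simp
  also have "\<dots> \<le> 4 * ((1 + \<bar>a\<bar>) * (1 + \<bar>b\<bar>) * (1 + \<bar>c\<bar>))"
    by (simp add: algebra_simps)
  finally show ?thesis .
qed

lemma integrable_pairI:
  fixes f :: "real \<Rightarrow> real \<Rightarrow> real"
  assumes [measurable]: "case_prod f \<in> borel_measurable (lborel \<Otimes>\<^sub>M lborel)"
    and i: "\<And>a. integrable lborel (f a)"
    and B: "integrable lborel B" and le: "\<And>a. (LINT b|lborel. \<bar>f a b\<bar>) \<le> B a"
  shows "integrable (lborel \<Otimes>\<^sub>M lborel) (case_prod f)"
proof (rule lborel_pair.Fubini_integrable)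
  show "AE x in lborel. integrable lborel (\<lambda>y. case (x, y) of (x, xa) \<Rightarrow> f x xa)" using i by simp
  show "integrable lborel (\<lambda>x. LINT y|lborel. norm (case (x, y) of (x, xa) \<Rightarrow> f x xa))"
    by (rule Bochner_Integration.integrable_bound[OF B])
      (auto intro!: AE_I2 order_trans[OF le] Bochner_Integration.integral_nonneg)
qed simp

lemma integrable_pair_prod:
  fixes f :: "real \<Rightarrow> real \<Rightarrow> real"
  assumes [measurable]: "case_prod f \<in> borel_measurable (lborel \<Otimes>\<^sub>M lborel)"
    and B: "integrable lborel B" and B': "integrable lborel B'"
    and le: "\<And>a b. \<bar>f a b\<bar> \<le> B a * B' b"
  shows "integrable lborel (f a)" "integrable (lborel \<Otimes>\<^sub>M lborel) (case_prod f)"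
    "(LINT b|lborel. \<bar>f a b\<bar>) \<le> B a * (LINT b|lborel. B' b)"
proof -
  have i: "integrable lborel (f a)" for a
    by (rule Bochner_Integration.integrable_bound[of _ "\<lambda>b. B a * B' b"])
      (use B' le in \<open>auto intro!: AE_I2 order_trans[OF le]\<close>)
  have l: "(LINT b|lborel. \<bar>f a b\<bar>) \<le> B a * (LINT b|lborel. B' b)" for a
  proof -
    have "(LINT b|lborel. \<bar>f a b\<bar>) \<le> (LINT b|lborel. B a * B' b)"
      using i[of a] B' le by (intro integral_mono) auto
    then show ?thesis using B' by simp
  qed
  show "integrable lborel (f a)" "(LINT b|lborel. \<bar>f a b\<bar>) \<le> B a * (LINT b|lborel. B' b)" by (fact i l)+
  show "integrable (lborel \<Otimes>\<^sub>M lborel) (case_prod f)"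
    by (rule integrable_pairI[OF assms(1) i _ l]) (use B in simp)
qed

lemma integral_swap_dom:
  fixes f :: "real \<Rightarrow> real \<Rightarrow> real"
  assumes "case_prod f \<in> borel_measurable (lborel \<Otimes>\<^sub>M lborel)"
    and "integrable lborel B" and "integrable lborel B'"
    and "\<And>a b. \<bar>f a b\<bar> \<le> B a * B' b"
  shows "(LINT a|lborel. LINT b|lborel. f a b) = (LINT b|lborel. LINT a|lborel. f a b)"
  using lborel_pair.Fubini_integral[OF integrable_pair_prod(2)[OF assms]] by simp

text \<open>Second mean value theorem: a weight decreasing on \<open>{0..L}\<close> turns the
  integral into a nonnegative combination of the unweighted integrals over \<open>{0..c}\<close> and
  \<open>{0..L}\<close>.\<close>

lemma even_tri_integral_nonneg:
  fixes \<psi> :: "real \<Rightarrow> real"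
  assumes nn: "\<And>e. 0 \<le> \<psi> e" and even: "\<And>e. \<psi> (- e) = \<psi> e"
    and mono: "\<And>e e'. 0 \<le> e \<Longrightarrow> e \<le> e' \<Longrightarrow> \<psi> e' \<le> \<psi> e"
    and [measurable]: "\<psi> \<in> borel_measurable borel"
  shows "0 \<le> (LINT e|lborel. \<psi> e * tri t (x + e) (x - e) * indicat_real {..t} (x + e) * indicat_real {..t} (x - e))"
    (is "0 \<le> (LINT e|lborel. ?h e)")
\<comment> \<open>Without integrability the integral is 0 by convention; for \<open>x > t\<close>
  the two indicators never hold together.\<close>
proof (cases "integrable lborel ?h \<and> x \<le> t")
  case False
  show ?thesis
  proof (cases "integrable lborel ?h")
    case True
    then have "?h = (\<lambda>e. 0)" using False by (auto simp: fun_eq_iff indicator_def)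
    then show ?thesis by simp
  qed (simp add: not_integrable_integral_eq)
next
  case True
  define L where "L = t - x"
  have L: "0 \<le> L" "t = x + L" using True by (auto simp: L_def)
  define T where "T e = tri (x + L) (x + e) (x - e)" for e
  have T_even: "T (- e) = T e" for e unfolding T_def by (simp add: tri_commute23)
  have cont: "continuous_on S T" for S
    unfolding T_def tri_def Let_def by (intro continuous_intros)
  have Tint: "T integrable_on {a..b}" for a b by (intro integrable_continuous_real cont)
  have R: "0 \<le> integral {0..c} T" if "0 \<le> c" "c \<le> L" for c
    using tri_integral_nonneg[OF that, of x] Tint[of 0 c] unfolding T_def by (auto dest: integrable_integral)
  obtain c where c: "c \<in> {0..L}" and
    "((\<lambda>e. (- \<psi> e) * T e) has_integral ((- \<psi> 0) * integral {0..c} T + (- \<psi> L) * integral {c..L} T)) {0..L}"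
    using second_mean_value_theorem_full[OF Tint[of 0 L] L(1), of "\<lambda>e. - \<psi> e"] mono by auto
  note n = has_integral_neg[OF this(2)]
  have "- (- \<psi> 0 * integral {0..c} T + - \<psi> L * integral {c..L} T) = \<psi> 0 * integral {0..c} T + \<psi> L * integral {c..L} T"
    by simp
  then have hi: "((\<lambda>e. \<psi> e * T e) has_integral (\<psi> 0 * integral {0..c} T + \<psi> L * integral {c..L} T)) {0..L}"
    (is "(_ has_integral ?v) _") using n by (simp add: add.commute)
  have "integral {0..L} T = integral {0..c} T + integral {c..L} T"
    using c Tint by (intro Henstock_Kurzweil_Integration.integral_combine[symmetric]) auto
  then have "?v = (\<psi> 0 - \<psi> L) * integral {0..c} T + \<psi> L * integral {0..L} T" by (simp add: algebra_simps)
  also have "\<dots> \<ge> 0" using R[of c] R[of L] c L mono[of 0 L] nn[of L] by (intro add_nonneg_nonneg mult_nonneg_nonneg) auto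
  finally have v: "0 \<le> ?v" .
  have hi': "((\<lambda>e. \<psi> e * T e) has_integral ?v) {-L..-0}"
    using has_integral_reflect_real[where f = "\<lambda>e. \<psi> e * T e" and a = 0 and b = L] hi L by (simp add: even T_even)
  have "((\<lambda>e. \<psi> e * T e) has_integral (?v + ?v)) {-L..L}"
    by (rule has_integral_combine[OF _ _ hi'[simplified] hi]) (use L in auto)
  then have "(?h has_integral (?v + ?v)) {-L..L}"
    by (rule has_integral_eq[rotated]) (auto simp: T_def L(2) indicator_def)
  then have "(?h has_integral (?v + ?v)) UNIV"
    by (rule has_integral_on_superset) (auto simp: indicator_def L(2))
  moreover have "(?h has_integral (LINT e|lborel. ?h e)) UNIV"
    using True has_integral_integral_lborel by blast
  ultimately have "(LINT e|lborel. ?h e) = ?v + ?v" using has_integral_unique by blast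
  then show ?thesis using v by simp
qed


text \<open>All that is used of log-concavity: for a fixed midpoint, the product of the densities at
  two points decreases with their distance. The moment condition matches the growth bound
  \<open>abs_tri_le\<close>, so that all integrals can be interchanged.\<close>

locale midpoint_decreasing =
  fixes \<rho> :: "real \<Rightarrow> real"
  assumes rho_measurable [measurable]: "\<rho> \<in> borel_measurable borel"
    and rho_nonneg: "\<And>a. 0 \<le> \<rho> a"
    and rho_mono: "\<And>x e e'. 0 \<le> e \<Longrightarrow> e \<le> e' \<Longrightarrow> \<rho> (x + e') * \<rho> (x - e') \<le> \<rho> (x + e) * \<rho> (x - e)"
    and rho_integrable: "integrable lborel (\<lambda>a. (1 + \<bar>a\<bar>) * \<rho> a)"
begin

abbreviation "B \<equiv> \<lambda>a. (1 + \<bar>a\<bar>) * \<rho> a"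

lemma B_nonneg: "0 \<le> B a" using rho_nonneg by simp

lemma abs_rho_tri_le: "\<bar>\<rho> b * \<rho> c * tri a b c\<bar> \<le> (4 * (1 + \<bar>a\<bar>)) * (B b * B c)"
proof -
  have "\<bar>\<rho> b * \<rho> c * tri a b c\<bar> = \<rho> b * \<rho> c * \<bar>tri a b c\<bar>" using rho_nonneg by (simp add: abs_mult)
  also have "\<dots> \<le> \<rho> b * \<rho> c * (4 * ((1 + \<bar>a\<bar>) * (1 + \<bar>b\<bar>) * (1 + \<bar>c\<bar>)))"
    using rho_nonneg by (intro mult_left_mono abs_tri_le) auto
  finally show ?thesis by (simp add: algebra_simps)
qed

text \<open>In the variables midpoint \<open>x\<close> and half-difference \<open>e\<close> of
  \<open>a\<close> and \<open>b\<close>, the inner integral is the one of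
  \<open>even_tri_integral_nonneg\<close>, for every \<open>x\<close>.\<close>

lemma tri_double_integral_nonneg:
  "0 \<le> (LINT a|lborel. LINT b|lborel. \<rho> a * \<rho> b * tri t a b * indicat_real {..t} a * indicat_real {..t} b)"
proof -
  define f where "f a b = \<rho> a * \<rho> b * tri t a b * indicat_real {..t} a * indicat_real {..t} b" for a b
  have [measurable]: "case_prod f \<in> borel_measurable (lborel \<Otimes>\<^sub>M lborel)" unfolding f_def by measurable
  have fle: "\<bar>f a b\<bar> \<le> (4 * (1 + \<bar>t\<bar>) * B a) * B b" for a b
  proof -
    have "\<bar>f a b\<bar> \<le> \<bar>\<rho> a * \<rho> b * tri t a b\<bar>" by (auto simp: f_def indicator_def)
    then show ?thesis using abs_rho_tri_le[of a b t] by (simp add: mult_ac)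
  qed
  define g where "g a x = f a (- a + 2 * x)" for a x
  have [measurable]: "case_prod g \<in> borel_measurable (lborel \<Otimes>\<^sub>M lborel)"
    unfolding g_def f_def by measurable
  have fi: "integrable lborel (f a)" for a
    by (rule integrable_pair_prod(1)[OF _ _ rho_integrable fle]) (use rho_integrable in auto)
  have gi: "integrable lborel (g a)" for a
    unfolding g_def using lborel_integrable_real_affine[OF fi[of a], of 2 "- a"] by simp
  have gl: "(LINT x|lborel. \<bar>g a x\<bar>) \<le> (4 * (1 + \<bar>t\<bar>) * B a) * (LINT b|lborel. B b)" for a
  proof -
    have "(LINT b|lborel. \<bar>f a b\<bar>) = 2 * (LINT x|lborel. \<bar>g a x\<bar>)"
      using lborel_integral_real_affine[of 2 "\<lambda>b. \<bar>f a b\<bar>" "- a"] by (simp add: g_def)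
    moreover have "0 \<le> (LINT x|lborel. \<bar>g a x\<bar>)" by (intro Bochner_Integration.integral_nonneg) auto
    moreover have "(LINT b|lborel. \<bar>f a b\<bar>) \<le> (4 * (1 + \<bar>t\<bar>) * B a) * (LINT b|lborel. B b)"
      by (rule integrable_pair_prod(3)[OF _ _ rho_integrable fle]) (use rho_integrable in auto)
    ultimately show ?thesis by linarith
  qed
  have "(LINT b|lborel. f a b) = 2 * (LINT x|lborel. g a x)" for a
    using lborel_integral_real_affine[of 2 "f a" "- a"] by (simp add: g_def)
  then have "(LINT a|lborel. LINT b|lborel. f a b) = 2 * (LINT a|lborel. LINT x|lborel. g a x)" by simp
  moreover have "(LINT a|lborel. LINT x|lborel. g a x) = (LINT x|lborel. LINT a|lborel. g a x)"
    using lborel_pair.Fubini_integral[OF integrable_pairI[OF _ gi _ gl]] rho_integrable by simp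
  moreover have "0 \<le> (LINT x|lborel. LINT a|lborel. g a x)"
  proof (rule Bochner_Integration.integral_nonneg)
    fix x
    have "(LINT a|lborel. g a x) = (LINT e|lborel. g (x + e) x)"
      using lborel_integral_real_affine[of 1 "\<lambda>a. g a x" x] by simp
    also have "\<dots> = (LINT e|lborel. (\<rho> (x + e) * \<rho> (x - e)) * tri t (x + e) (x - e) * indicat_real {..t} (x + e) * indicat_real {..t} (x - e))"
      by (simp add: g_def f_def algebra_simps)
    also have "\<dots> \<ge> 0"
      by (rule even_tri_integral_nonneg) (use rho_nonneg rho_mono in \<open>auto simp: mult.commute\<close>)
    finally show "0 \<le> (LINT a|lborel. g a x)" .
  qed
  ultimately show ?thesis by (simp add: f_def)
qed

lemma triple_swap:
  fixes G :: "real \<Rightarrow> real \<Rightarrow> real \<Rightarrow> real"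
  assumes [measurable]: "(\<lambda>(a, b, c). G a b c) \<in> borel_measurable (lborel \<Otimes>\<^sub>M lborel \<Otimes>\<^sub>M lborel)"
    and le: "\<And>a b c. \<bar>G a b c\<bar> \<le> 4 * B a * (B b * B c)"
  shows "(LINT a|lborel. LINT b|lborel. LINT c|lborel. G a b c) = (LINT b|lborel. LINT a|lborel. LINT c|lborel. G a b c)"
    and "(LINT a|lborel. LINT b|lborel. LINT c|lborel. G a b c) = (LINT a|lborel. LINT c|lborel. LINT b|lborel. G a b c)"
    and "integrable lborel (\<lambda>a. LINT b|lborel. LINT c|lborel. G a b c)"
    and "integrable lborel (\<lambda>b. LINT c|lborel. G a b c)"
    and "integrable lborel (\<lambda>c. G a b c)"
proof -
  have m: "case_prod (G a) \<in> borel_measurable (lborel \<Otimes>\<^sub>M lborel)" for a by measurable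
  have bi: "integrable lborel (\<lambda>b. 4 * B a * B b)" for a
    using rho_integrable by simp
  have le': "\<bar>G a b c\<bar> \<le> (4 * B a * B b) * B c" for a b c
    using le[of a b c] by (simp add: mult_ac)
  have i: "integrable lborel (G a b)" for a b
    by (rule integrable_pair_prod(1)[OF m bi rho_integrable le'])
  have l: "(LINT c|lborel. \<bar>G a b c\<bar>) \<le> 4 * B a * B b * (LINT c|lborel. B c)" for a b
    by (rule integrable_pair_prod(3)[OF m bi rho_integrable le'])
  have l': "\<bar>LINT c|lborel. G a b c\<bar> \<le> 4 * B a * (B b * (LINT c|lborel. B c))" for a b
    using order_trans[OF integral_norm_bound[of lborel "G a b", unfolded real_norm_def] l[of a b]]
    by (simp add: mult_ac)
  have "(\<lambda>x. case (fst (fst x), snd (fst x), snd x) of (a, b, c) \<Rightarrow> G a b c)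
    \<in> borel_measurable ((lborel \<Otimes>\<^sub>M lborel) \<Otimes>\<^sub>M lborel)"
    by (rule measurable_compose[OF _ assms(1)]) measurable
  then have [measurable]: "(\<lambda>x. G (fst (fst x)) (snd (fst x)) (snd x)) \<in> borel_measurable ((borel \<Otimes>\<^sub>M borel) \<Otimes>\<^sub>M borel)"
    by (simp cong: measurable_cong_sets add: split_beta')
  have m2: "(\<lambda>(a, b). LINT c|lborel. G a b c) \<in> borel_measurable (lborel \<Otimes>\<^sub>M lborel)" by measurable
  show "(LINT a|lborel. LINT b|lborel. LINT c|lborel. G a b c) = (LINT b|lborel. LINT a|lborel. LINT c|lborel. G a b c)"
    by (rule integral_swap_dom[OF m2 _ _ l']) (use rho_integrable in auto)
  show "(LINT a|lborel. LINT b|lborel. LINT c|lborel. G a b c) = (LINT a|lborel. LINT c|lborel. LINT b|lborel. G a b c)"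
  proof (rule Bochner_Integration.integral_cong[OF refl])
    show "(LINT b|lborel. LINT c|lborel. G a b c) = (LINT c|lborel. LINT b|lborel. G a b c)" for a
      by (rule integral_swap_dom[OF m bi rho_integrable le'])
  qed
  have ii: "integrable lborel (\<lambda>b. LINT c|lborel. G a b c)" for a
    by (rule integrable_pair_prod(1)[OF m2 _ _ l']) (use rho_integrable in auto)
  then show "integrable lborel (\<lambda>b. LINT c|lborel. G a b c)" .
  show "integrable lborel (\<lambda>c. G a b c)" by (fact i)
  show "integrable lborel (\<lambda>a. LINT b|lborel. LINT c|lborel. G a b c)"
  proof (rule Bochner_Integration.integrable_bound[of _ "\<lambda>a. 4 * B a * (LINT b|lborel. B b * (LINT c|lborel. B c))"])
    show "AE a in lborel. norm (LINT b|lborel. LINT c|lborel. G a b c) \<le> norm (4 * B a * (LINT b|lborel. B b * (LINT c|lborel. B c)))"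
    proof (rule AE_I2)
      fix a
      have "\<bar>LINT b|lborel. LINT c|lborel. G a b c\<bar> \<le> (LINT b|lborel. \<bar>LINT c|lborel. G a b c\<bar>)"
        using integral_norm_bound[of lborel "\<lambda>b. LINT c|lborel. G a b c"] by simp
      also have "\<dots> \<le> 4 * B a * (LINT b|lborel. B b * (LINT c|lborel. B c))"
        by (rule integrable_pair_prod(3)[OF m2 _ _ l']) (use rho_integrable in auto)
      finally show "norm (LINT b|lborel. LINT c|lborel. G a b c) \<le> norm (4 * B a * (LINT b|lborel. B b * (LINT c|lborel. B c)))"
        by simp
    qed
  qed (use rho_integrable in auto)
qed

text \<open>The space is split according to which variable is the largest, ties going to the earlier
  one. By symmetry of \<open>tri\<close> each piece is an integral of the double integrals above,
  with \<open>t\<close> the largest variable; strict and weak bounds differ on null sets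
  only.\<close>

lemma tri_triple_integral_nonneg:
  "0 \<le> (LINT a|lborel. LINT b|lborel. LINT c|lborel. \<rho> a * \<rho> b * \<rho> c * tri a b c)"
proof -
  define F where "F a b c = \<rho> a * \<rho> b * \<rho> c * tri a b c" for a b c
  have Fle: "\<bar>F a b c\<bar> \<le> 4 * B a * (B b * B c)" for a b c
  proof -
    have "\<bar>F a b c\<bar> = \<rho> a * \<bar>\<rho> b * \<rho> c * tri a b c\<bar>" using rho_nonneg by (simp add: F_def abs_mult)
    also have "\<dots> \<le> \<rho> a * ((4 * (1 + \<bar>a\<bar>)) * (B b * B c))" using rho_nonneg by (intro mult_left_mono abs_rho_tri_le)
    finally show ?thesis by (simp add: mult_ac)
  qed
  have ind: "\<bar>F a b c * (if P then 1 else 0) * (if Q then 1 else 0)\<bar> \<le> 4 * B a * (B b * B c)" for a b c P Q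
    using Fle[of a b c] B_nonneg[of a] B_nonneg[of b] B_nonneg[of c] by auto
  define G1 where "G1 a b c = F a b c * (if b \<le> a then 1 else 0) * (if c \<le> a then 1 else 0)" for a b c
  define G2 where "G2 a b c = F a b c * (if a < b then 1 else 0) * (if c \<le> b then 1 else 0)" for a b c
  define G3 where "G3 a b c = F a b c * (if a < c then 1 else 0) * (if b < c then 1 else 0)" for a b c
  have [measurable]: "(\<lambda>(a, b, c). G1 a b c) \<in> borel_measurable (lborel \<Otimes>\<^sub>M lborel \<Otimes>\<^sub>M lborel)"
    "(\<lambda>(a, b, c). G2 a b c) \<in> borel_measurable (lborel \<Otimes>\<^sub>M lborel \<Otimes>\<^sub>M lborel)"
    "(\<lambda>(a, b, c). G3 a b c) \<in> borel_measurable (lborel \<Otimes>\<^sub>M lborel \<Otimes>\<^sub>M lborel)"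
    unfolding G1_def G2_def G3_def F_def by measurable
  have le: "\<bar>G1 a b c\<bar> \<le> 4 * B a * (B b * B c)" "\<bar>G2 a b c\<bar> \<le> 4 * B a * (B b * B c)"
    "\<bar>G3 a b c\<bar> \<le> 4 * B a * (B b * B c)" for a b c
    unfolding G1_def G2_def G3_def by (rule ind)+
  have m: "(\<lambda>(a, b, c). G1 a b c) \<in> borel_measurable (lborel \<Otimes>\<^sub>M lborel \<Otimes>\<^sub>M lborel)"
    "(\<lambda>(a, b, c). G2 a b c) \<in> borel_measurable (lborel \<Otimes>\<^sub>M lborel \<Otimes>\<^sub>M lborel)"
    "(\<lambda>(a, b, c). G3 a b c) \<in> borel_measurable (lborel \<Otimes>\<^sub>M lborel \<Otimes>\<^sub>M lborel)" by measurable
  note s1 = triple_swap[OF m(1) le(1)] and s2 = triple_swap[OF m(2) le(2)] and s3 = triple_swap[OF m(3) le(3)]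
  have "F a b c = G1 a b c + (G2 a b c + G3 a b c)" for a b c
    by (auto simp: G1_def G2_def G3_def)
  then have split: "(LINT a|lborel. LINT b|lborel. LINT c|lborel. F a b c) =
    (LINT a|lborel. LINT b|lborel. LINT c|lborel. G1 a b c) + ((LINT a|lborel. LINT b|lborel. LINT c|lborel. G2 a b c)
      + (LINT a|lborel. LINT b|lborel. LINT c|lborel. G3 a b c))"
    using s1(3-5) s2(3-5) s3(3-5) by simp
  have K: "0 \<le> (LINT t|lborel. \<rho> t * (LINT a|lborel. LINT b|lborel. \<rho> a * \<rho> b * tri t a b * indicat_real {..t} a * indicat_real {..t} b))"
    by (intro Bochner_Integration.integral_nonneg mult_nonneg_nonneg tri_double_integral_nonneg rho_nonneg)
  have less_le: "(LINT a|lborel. f a * (if a < t then 1 else 0)) = (LINT a|lborel. f a * indicat_real {..t} a)"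
    if [measurable]: "f \<in> borel_measurable borel" for f :: "real \<Rightarrow> real" and t
    by (rule integral_cong_AE, measurable)
      (use AE_lborel_singleton[of t] in eventually_elim, auto simp: indicator_def)
  have "(LINT a|lborel. LINT b|lborel. LINT c|lborel. G1 a b c) \<ge> 0"
  proof -
    have "(LINT b|lborel. LINT c|lborel. G1 t b c) = \<rho> t * (LINT a|lborel. LINT b|lborel. \<rho> a * \<rho> b * tri t a b * indicat_real {..t} a * indicat_real {..t} b)" for t
      unfolding integral_mult_right_zero[symmetric]
      by (intro Bochner_Integration.integral_cong refl) (auto simp: G1_def F_def indicator_def)
    then show ?thesis using K by simp
  qed
  moreover have "(LINT a|lborel. LINT b|lborel. LINT c|lborel. G2 a b c) \<ge> 0"
  proof -
    have "(LINT a|lborel. LINT c|lborel. G2 a t c) = \<rho> t * (LINT a|lborel. LINT b|lborel. \<rho> a * \<rho> b * tri t a b * indicat_real {..t} a * indicat_real {..t} b)" for t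
    proof -
      have "(LINT a|lborel. LINT c|lborel. G2 a t c) =
          (LINT a|lborel. (\<rho> t * (LINT c|lborel. \<rho> a * \<rho> c * tri t a c * indicat_real {..t} c)) * (if a < t then 1 else 0))"
        unfolding integral_mult_right_zero[symmetric] integral_mult_left_zero[symmetric]
        by (intro Bochner_Integration.integral_cong refl) (auto simp: G2_def F_def indicator_def tri_commute12[of _ t])
      also have "\<dots> = (LINT a|lborel. (\<rho> t * (LINT c|lborel. \<rho> a * \<rho> c * tri t a c * indicat_real {..t} c)) * indicat_real {..t} a)"
        by (rule less_le) measurable
      also have "\<dots> = \<rho> t * (LINT a|lborel. LINT b|lborel. \<rho> a * \<rho> b * tri t a b * indicat_real {..t} a * indicat_real {..t} b)"
        unfolding integral_mult_right_zero[symmetric] integral_mult_left_zero[symmetric]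
        by (intro Bochner_Integration.integral_cong refl) (auto simp: indicator_def)
      finally show ?thesis .
    qed
    then show ?thesis using K s2(1) by simp
  qed
  moreover have "(LINT a|lborel. LINT b|lborel. LINT c|lborel. G3 a b c) \<ge> 0"
  proof -
    define G3' where "G3' a c b = G3 a b c" for a b c
    have "(LINT a|lborel. LINT b|lborel. LINT c|lborel. G3 a b c) = (LINT a|lborel. LINT c|lborel. LINT b|lborel. G3' a c b)"
      using s3(2) by (simp add: G3'_def)
    also have "\<dots> = (LINT c|lborel. LINT a|lborel. LINT b|lborel. G3' a c b)"
    proof (rule triple_swap(1))
      show "(\<lambda>(a, b, c). G3' a b c) \<in> borel_measurable (lborel \<Otimes>\<^sub>M lborel \<Otimes>\<^sub>M lborel)"
        unfolding G3'_def G3_def F_def by measurable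
      show "\<bar>G3' a b c\<bar> \<le> 4 * B a * (B b * B c)" for a b c
        using ind[of a c b "a < b" "c < b"] by (simp add: G3'_def G3_def mult.commute)
    qed
    also have "\<dots> = (LINT t|lborel. \<rho> t * (LINT a|lborel. LINT b|lborel. \<rho> a * \<rho> b * tri t a b * indicat_real {..t} a * indicat_real {..t} b))"
    proof (intro Bochner_Integration.integral_cong refl)
      fix t
      have "(LINT a|lborel. LINT b|lborel. G3' a t b) =
          (LINT a|lborel. (\<rho> t * (LINT b|lborel. (\<rho> a * \<rho> b * tri t a b) * (if b < t then 1 else 0))) * (if a < t then 1 else 0))"
        unfolding integral_mult_right_zero[symmetric] integral_mult_left_zero[symmetric]
        by (intro Bochner_Integration.integral_cong refl)
          (auto simp: G3'_def G3_def F_def indicator_def tri_commute12[of t] tri_commute23[of _ t])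
      also have "\<dots> = (LINT a|lborel. (\<rho> t * (LINT b|lborel. (\<rho> a * \<rho> b * tri t a b) * indicat_real {..t} b)) * (if a < t then 1 else 0))"
      proof -
        have "(LINT b|lborel. (\<rho> a * \<rho> b * tri t a b) * (if b < t then 1 else 0)) =
            (LINT b|lborel. (\<rho> a * \<rho> b * tri t a b) * indicat_real {..t} b)" for a
          by (rule less_le) measurable
        then show ?thesis by simp
      qed
      also have "\<dots> = (LINT a|lborel. (\<rho> t * (LINT b|lborel. (\<rho> a * \<rho> b * tri t a b) * indicat_real {..t} b)) * indicat_real {..t} a)"
        by (rule less_le) measurable
      also have "\<dots> = \<rho> t * (LINT a|lborel. LINT b|lborel. \<rho> a * \<rho> b * tri t a b * indicat_real {..t} a * indicat_real {..t} b)"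
        unfolding integral_mult_right_zero[symmetric] integral_mult_left_zero[symmetric]
        by (intro Bochner_Integration.integral_cong refl) (auto simp: indicator_def)
      finally show "(LINT a|lborel. LINT b|lborel. G3' a t b) = \<rho> t * (LINT a|lborel. LINT b|lborel. \<rho> a * \<rho> b * tri t a b * indicat_real {..t} a * indicat_real {..t} b)" .
    qed
    finally show ?thesis using K by simp
  qed
  ultimately show ?thesis using split by (simp add: F_def)
qed

definition "I n = (LINT a|lborel. \<rho> a * sg a ^ n)"
definition "J n = (LINT a|lborel. \<rho> a * (sg a ^ n * a))"

lemma integrable_rho_mult:
  assumes [measurable]: "f \<in> borel_measurable borel" and le: "\<And>a. \<bar>f a\<bar> \<le> 1 + \<bar>a\<bar>"
  shows "integrable lborel (\<lambda>a. \<rho> a * f a)"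
proof (rule Bochner_Integration.integrable_bound[OF rho_integrable])
  show "AE x in lborel. norm (\<rho> x * f x) \<le> norm (B x)"
    using mult_left_mono[OF le rho_nonneg] rho_nonneg by (intro AE_I2) (simp add: abs_mult mult.commute)
qed measurable

lemma integral_rho_quadratic:
  "(LINT a|lborel. \<rho> a * (k0 + k1 * sg a + k2 * sg a ^ 2 + k3 * (sg a * a) + k4 * (sg a ^ 2 * a))) =
     k0 * I 0 + k1 * I 1 + k2 * I 2 + k3 * J 1 + k4 * J 2"
proof -
  have le: "sg a ^ n \<le> 1" "0 \<le> sg a ^ n" for a n
    using sg_pos[of a] sg_less_1[of a] by (auto intro!: power_le_one)
  have "integrable lborel (\<lambda>a. \<rho> a * sg a ^ n)" for n
    by (rule integrable_rho_mult) (use le[where n = n] in \<open>auto intro: order_trans[of _ 1]\<close>)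
  note i = this this[of 0, simplified] this[of 1, simplified]
  have "integrable lborel (\<lambda>a. \<rho> a * (sg a ^ n * a))" for n
    by (rule integrable_rho_mult)
      (use le[where n = n] in \<open>auto simp: abs_mult intro: order_trans[OF mult_right_mono[OF le(1)]]\<close>)
  note j = this this[of 1, simplified]
  have "(LINT a|lborel. \<rho> a * (k0 + k1 * sg a + k2 * sg a ^ 2 + k3 * (sg a * a) + k4 * (sg a ^ 2 * a))) =
    (LINT a|lborel. k0 * \<rho> a + k1 * (\<rho> a * sg a) + k2 * (\<rho> a * sg a ^ 2) + k3 * (\<rho> a * (sg a * a)) + k4 * (\<rho> a * (sg a ^ 2 * a)))"
    by (intro Bochner_Integration.integral_cong refl) Groebner_Basis.algebra
  also have "\<dots> = k0 * I 0 + k1 * I 1 + k2 * I 2 + k3 * J 1 + k4 * J 2"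
    using i j by (simp add: I_def J_def)
  finally show ?thesis .
qed

text \<open>Divided by \<open>I 0 * I 1 ^ 2\<close> it says: under the density proportional to
  \<open>\<rho> a * sg a\<close>, the mean of \<open>sg a\<close> exceeds \<open>I 1 / I 0\<close>,
  its mean under \<open>\<rho>\<close>, by at most twice the covariance of \<open>sg a\<close> and
  \<open>a\<close>. The proof integrates \<open>tri\<close> one variable at a time.\<close>

theorem logistic_moment_inequality:
  "I 0 * I 1 * I 2 - I 1 ^ 3 \<le> 2 * I 0 * (I 1 * J 2 - I 2 * J 1)"
proof -
  note q = integral_rho_quadratic
  have 1: "(LINT c|lborel. \<rho> a * \<rho> b * \<rho> c * tri a b c) = \<rho> a * (\<rho> b *
     ((2 * (sg a * sg b * (sg a - sg b) * (a - b)) - sg a * sg b ^ 2 - sg b * sg a ^ 2) * I 0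
      + (2 * sg a ^ 2 * a + 2 * sg b ^ 2 * b + 4 * sg a * sg b - (sg a - sg b) ^ 2) * I 1
      + (- 2 * sg a * a - 2 * sg b * b - sg a - sg b) * I 2 + (- 2 * sg a ^ 2 - 2 * sg b ^ 2) * J 1
      + (2 * sg a + 2 * sg b) * J 2))" for a b
    unfolding q[symmetric] integral_mult_right_zero[symmetric] tri_def Let_def
    by (intro Bochner_Integration.integral_cong refl) Groebner_Basis.algebra
  have 2: "(LINT b|lborel. LINT c|lborel. \<rho> a * \<rho> b * \<rho> c * tri a b c) = \<rho> a *
     ((I 1 * (2 * sg a ^ 2 * a - sg a ^ 2) + I 2 * (- 2 * sg a * a - sg a) - 2 * J 1 * sg a ^ 2 + 2 * J 2 * sg a) * I 0
      + (I 0 * (2 * sg a ^ 2 * a - sg a ^ 2) + 2 * J 2 + 6 * I 1 * sg a - I 2) * I 1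
      + (I 0 * (- 2 * sg a * a - sg a) - 2 * J 1 - I 1) * I 2
      + (- 2 * I 0 * sg a ^ 2 - 2 * I 2) * J 1 + (2 * I 0 * sg a + 2 * I 1) * J 2)" for a
  proof -
    have "(LINT b|lborel. LINT c|lborel. \<rho> a * \<rho> b * \<rho> c * tri a b c) = \<rho> a * (LINT b|lborel. \<rho> b *
      (((2 * sg a ^ 2 * a - sg a ^ 2) * 0 + I 1 * (2 * sg a ^ 2 * a - sg a ^ 2) + I 2 * (- 2 * sg a * a - sg a) - 2 * J 1 * sg a ^ 2 + 2 * J 2 * sg a) * 0
       + ((2 * sg a ^ 2 * a) * I 1 - sg a ^ 2 * I 1 - (2 * sg a * a + sg a) * I 2 - 2 * sg a ^ 2 * J 1 + 2 * sg a * J 2)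
       + ((2 * sg a ^ 2 * a - sg a ^ 2) * I 0 + 6 * sg a * I 1 - I 2 + 2 * J 2) * sg b
       + ((- 2 * sg a * a - sg a) * I 0 - I 1 - 2 * J 1) * sg b ^ 2
       + (- 2 * sg a ^ 2 * I 0 - 2 * I 2) * (sg b * b)
       + (2 * sg a * I 0 + 2 * I 1) * (sg b ^ 2 * b)))"
      unfolding 1 integral_mult_right_zero[symmetric]
      by (intro Bochner_Integration.integral_cong refl) Groebner_Basis.algebra
    then show ?thesis unfolding q by Groebner_Basis.algebra
  qed
  have "(LINT a|lborel. LINT b|lborel. LINT c|lborel. \<rho> a * \<rho> b * \<rho> c * tri a b c) =
    (LINT a|lborel. \<rho> a * ((4 * I 1 * J 2 - I 1 * I 2 - 4 * I 2 * J 1 - I 2 * I 1)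
      + (4 * I 0 * J 2 + 6 * I 1 ^ 2 - 2 * I 0 * I 2) * sg a + (- 4 * I 0 * J 1 - 2 * I 0 * I 1) * sg a ^ 2
      + (- 4 * I 0 * I 2) * (sg a * a) + 4 * I 0 * I 1 * (sg a ^ 2 * a)))"
    unfolding 2 by (intro Bochner_Integration.integral_cong refl) Groebner_Basis.algebra
  also have "\<dots> = 6 * (2 * I 0 * (I 1 * J 2 - I 2 * J 1) - (I 0 * I 1 * I 2 - I 1 ^ 3))"
    unfolding q by Groebner_Basis.algebra
  finally show ?thesis using tri_triple_integral_nonneg by simp
qed

end

section \<open>Log-concave functions and their marginals\<close>

lemma layer_cake:
  fixes f :: "real \<Rightarrow> real"
  assumes [measurable]: "f \<in> borel_measurable borel" and nn: "\<And>x. 0 \<le> f x"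
  shows "(\<integral>\<^sup>+x. ennreal (f x) \<partial>lborel) =
    (\<integral>\<^sup>+s. emeasure lborel {x. s < f x} * indicator {0..} s \<partial>lborel)"
proof -
  have "ennreal (f x) = (\<integral>\<^sup>+s. indicator {0..<f x} s \<partial>lborel)" for x
    using nn[of x] by simp
  then have "(\<integral>\<^sup>+x. ennreal (f x) \<partial>lborel) = (\<integral>\<^sup>+x. \<integral>\<^sup>+s. indicator {0..<f x} s \<partial>lborel \<partial>lborel)"
    by simp
  also have "\<dots> = (\<integral>\<^sup>+x. \<integral>\<^sup>+s. indicator {0..} s * indicator {s. s < f x} s \<partial>lborel \<partial>lborel)"
    by (intro nn_integral_cong) (auto simp: indicator_def)
  also have "\<dots> = (\<integral>\<^sup>+s. \<integral>\<^sup>+x. indicator {0..} s * indicator {x. s < f x} x \<partial>lborel \<partial>lborel)"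
    by (subst lborel_pair.Fubini') (measurable, simp add: indicator_def)
  also have "\<dots> = (\<integral>\<^sup>+s. emeasure lborel {x. s < f x} * indicator {0..} s \<partial>lborel)"
    by (intro nn_integral_cong) (simp add: nn_integral_cmult_indicator mult.commute)
  finally show ?thesis .
qed

lemma emeasure_convex_le:
  fixes A :: "real set"
  assumes A: "A \<in> sets borel" "A \<noteq> {}" and le: "\<And>a b. a \<in> A \<Longrightarrow> b \<in> A \<Longrightarrow> b - a \<le> D"
  shows "emeasure lborel A \<le> ennreal D"
proof -
  obtain a0 where a0: "a0 \<in> A" using A by blast
  have bd: "bdd_above A" "bdd_below A"
  proof -
    show "bdd_above A" by (rule bdd_aboveI[of _ "a0 + D"]) (use le[OF a0] in fastforce)
    show "bdd_below A" by (rule bdd_belowI[of _ "a0 - D"]) (use le[OF _ a0] in fastforce)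
  qed
  have "Sup A \<le> Inf A + D"
  proof (rule cSup_least[OF A(2)])
    fix b assume b: "b \<in> A"
    have "b - D \<le> Inf A" by (rule cInf_greatest[OF A(2)]) (use le[OF _ b] in fastforce)
    then show "b \<le> Inf A + D" by simp
  qed
  moreover have "A \<subseteq> {Inf A..Sup A}" using bd by (auto intro: cInf_lower cSup_upper)
  then have "emeasure lborel A \<le> emeasure lborel {Inf A..Sup A}" by (intro emeasure_mono) auto
  moreover have "Inf A \<le> Sup A" using cInf_lower[OF a0 bd(2)] cSup_upper[OF a0 bd(1)] by simp
  ultimately show ?thesis by (simp add: order_trans[OF _ ennreal_leI])
qed

text \<open>One-dimensional Brunn-Minkowski. The convex combination of a segment in \<open>A\<close>
  with a segment in \<open>B\<close> is a segment of the combined length inside \<open>C\<close>;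
  the lengths are pushed to their suprema first in \<open>A\<close>, then in
  \<open>B\<close>.\<close>

lemma measure_convex_comb_le:
  fixes A B C :: "real set"
  assumes A: "A \<in> sets borel" "A \<noteq> {}" "convex A" and B: "B \<in> sets borel" "B \<noteq> {}" "convex B"
    and C: "C \<in> sets borel" "emeasure lborel C < \<infinity>" and t: "0 < t" "t < 1"
    and sub: "\<And>a b. a \<in> A \<Longrightarrow> b \<in> B \<Longrightarrow> (1 - t) * a + t * b \<in> C"
  shows "ennreal (1 - t) * emeasure lborel A + ennreal t * emeasure lborel B \<le> emeasure lborel C"
proof -
  define m where "m = measure lborel C"
  have m: "emeasure lborel C = ennreal m" using C by (simp add: m_def emeasure_eq_ennreal_measure)
  have key: "(1 - t) * (a' - a) + t * (b' - b) \<le> m" if "a \<in> A" "a' \<in> A" "b \<in> B" "b' \<in> B" "a \<le> a'" "b \<le> b'" for a a' b b'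
  proof -
    let ?p = "(1 - t) * a + t * b" and ?q = "(1 - t) * a' + t * b'"
    have pq: "?p \<le> ?q" using that t by (intro add_mono mult_left_mono) auto
    have "{?p..?q} \<subseteq> C"
    proof
      fix x assume x: "x \<in> {?p..?q}"
      have "\<exists>u. 0 \<le> u \<and> u \<le> 1 \<and> x = (1 - u) * p + u * q" if "p \<le> x" "x \<le> q" for p q :: real
      proof (cases "p = q")
        case False
        define u where "u = (x - p) / (q - p)"
        have "u * (q - p) = x - p" "0 \<le> u" "u \<le> 1" using False that by (auto simp: u_def)
        then show ?thesis by (intro exI[of _ u]) (auto simp: algebra_simps)
      qed (use that in \<open>auto intro: exI[of _ 0]\<close>)
      then obtain u where u: "0 \<le> u" "u \<le> 1" "x = (1 - u) * ?p + u * ?q" using x by auto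
      have "(1 - u) * a + u * a' \<in> A" "(1 - u) * b + u * b' \<in> B"
        using convexD[OF A(3) \<open>a \<in> A\<close> \<open>a' \<in> A\<close>, of "1 - u" u] convexD[OF B(3) \<open>b \<in> B\<close> \<open>b' \<in> B\<close>, of "1 - u" u] u by auto
      moreover have "(1 - t) * ((1 - u) * a + u * a') + t * ((1 - u) * b + u * b') = x"
        unfolding u(3) by Groebner_Basis.algebra
      ultimately show "x \<in> C" using sub by metis
    qed
    then have "emeasure lborel {?p..?q} \<le> emeasure lborel C" using C by (intro emeasure_mono) auto
    then have "ennreal (?q - ?p) \<le> ennreal m" using pq m by simp
    then have "?q - ?p \<le> m" by (simp add: m_def)
    then show ?thesis by (simp add: algebra_simps)
  qed
  have key': "(1 - t) * (a' - a) + t * (b' - b) \<le> m" if "a \<in> A" "a' \<in> A" "b \<in> B" "b' \<in> B" for a a' b b'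
  proof -
    have "(1 - t) * (a' - a) \<le> (1 - t) * (max a a' - min a a')" "t * (b' - b) \<le> t * (max b b' - min b b')"
      using t by (auto intro!: mult_left_mono)
    moreover have "max a a' \<in> A" "min a a' \<in> A" "max b b' \<in> B" "min b b' \<in> B" using that by (auto simp: max_def min_def)
    ultimately show ?thesis using key[of "min a a'" "max a a'" "min b b'" "max b b'"] by linarith
  qed
  obtain b0 where b0: "b0 \<in> B" using B by blast
  have A': "emeasure lborel A \<le> ennreal ((m - t * (b' - b)) / (1 - t))" if "b \<in> B" "b' \<in> B" for b b'
    using key'[OF _ _ that] t by (intro emeasure_convex_le A) (simp add: field_simps)
  have fA: "emeasure lborel A < \<infinity>" using le_less_trans[OF A'[OF b0 b0] ennreal_less_top] by simp
  have "measure lborel A \<le> (m - t * (b' - b)) / (1 - t)" if "b \<in> B" "b' \<in> B" for b b'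
  proof -
    obtain a0 where "a0 \<in> A" using A by blast
    then have "0 \<le> (m - t * (b' - b)) / (1 - t)" using key'[of a0 a0 b b'] that t by simp
    then show ?thesis using A'[OF that] fA
      by (simp add: emeasure_eq_ennreal_measure ennreal_le_iff)
  qed
  then have "b' - b \<le> (m - (1 - t) * measure lborel A) / t" if "b \<in> B" "b' \<in> B" for b b'
    using that t by (simp add: field_simps)
  then have B': "emeasure lborel B \<le> ennreal ((m - (1 - t) * measure lborel A) / t)"
    by (intro emeasure_convex_le B)
  have "0 \<le> (m - (1 - t) * measure lborel A) / t"
    using \<open>\<And>b' b. b \<in> B \<Longrightarrow> b' \<in> B \<Longrightarrow> b' - b \<le> _\<close>[OF b0 b0] by simp
  have "ennreal t * emeasure lborel B \<le> ennreal t * ennreal ((m - (1 - t) * measure lborel A) / t)"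
    by (intro mult_left_mono B') simp
  also have "\<dots> = ennreal (m - (1 - t) * measure lborel A)"
    using t \<open>0 \<le> (m - (1 - t) * measure lborel A) / t\<close> by (simp flip: ennreal_mult)
  finally have "ennreal (1 - t) * emeasure lborel A + ennreal t * emeasure lborel B \<le>
      ennreal (1 - t) * ennreal (measure lborel A) + ennreal (m - (1 - t) * measure lborel A)"
    using fA by (simp add: emeasure_eq_ennreal_measure add_left_mono)
  also have "\<dots> = ennreal m"
    using t \<open>0 \<le> (m - (1 - t) * measure lborel A) / t\<close>
    by (simp add: zero_le_divide_iff flip: ennreal_mult ennreal_plus)
  finally show ?thesis by (simp add: m)
qed

lemma weighted_am_gm:
  fixes a b t :: real
  assumes "0 < a" "0 < b" "0 < t" "t < 1"
  shows "a powr (1 - t) * b powr t \<le> (1 - t) * a + t * b"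
proof -
  have "exp ((1 - t) * ln a + t * ln b) \<le> (1 - t) * exp (ln a) + t * exp (ln b)"
    using convex_onD[OF exp_convex, of t "ln a" "ln b"] assms by simp
  then show ?thesis using assms by (simp add: powr_def exp_add)
qed

lemma integral_lborel_pos:
  fixes k :: "real \<Rightarrow> real"
  assumes "integrable lborel k" "\<And>x. 0 < k x"
  shows "0 < (LINT x|lborel. k x)"
proof -
  have "0 \<le> (LINT x|lborel. k x)" using assms by (auto intro: Bochner_Integration.integral_nonneg less_imp_le)
  moreover have "(LINT x|lborel. k x) \<noteq> 0"
  proof
    assume "(LINT x|lborel. k x) = 0"
    then have "AE x in lborel. k x = 0"
      using assms by (subst (asm) integral_nonneg_eq_0_iff_AE) (auto simp: less_imp_le)
    then have "AE x in (lborel :: real measure). False"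
      by (rule AE_mp) (use assms(2) in \<open>auto simp: less_le\<close>)
    then have "ae_filter (lborel :: real measure) = bot" by (simp add: trivial_limit_def)
    then show False by (simp add: ae_filter_eq_bot_iff)
  qed
  ultimately show ?thesis by simp
qed

text \<open>Brunn-Minkowski for the superlevel sets, integrated over the levels. Division by the
  suprema \<open>S\<close> and \<open>T\<close> makes the sets of \<open>f\<close> and
  \<open>g\<close> nonempty for the same levels, those below 1; the result is a bound on the
  arithmetic mean of the normalized integrals, and the geometric mean is smaller.\<close>

theorem prekopa_leindler:
  fixes f g h :: "real \<Rightarrow> real"
  assumes f: "integrable lborel f" "\<And>x. 0 < f x" "bdd_above (range f)" "\<And>s. convex {x. s < f x}"
    and g: "integrable lborel g" "\<And>x. 0 < g x" "bdd_above (range g)" "\<And>s. convex {x. s < g x}"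
    and h: "integrable lborel h" "\<And>x. 0 < h x"
    and t: "0 < t" "t < 1"
    and le: "\<And>x y. f x powr (1 - t) * g y powr t \<le> h ((1 - t) * x + t * y)"
  shows "(LINT x|lborel. f x) powr (1 - t) * (LINT x|lborel. g x) powr t \<le> (LINT x|lborel. h x)"
proof -
  have [measurable]: "f \<in> borel_measurable borel" "g \<in> borel_measurable borel" "h \<in> borel_measurable borel"
    using f(1) g(1) h(1) by auto
  define S T where "S = Sup (range f)" and "T = Sup (range g)"
  have fS: "f x \<le> S" and gT: "g x \<le> T" for x
    unfolding S_def T_def using f(3) g(3) by (auto intro: cSup_upper)
  have ST: "0 < S" "0 < T" using fS[of 0] gT[of 0] f(2)[of 0] g(2)[of 0] by auto
  define U where "U = S powr (1 - t) * T powr t"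
  have U: "0 < U" using ST by (simp add: U_def)
  have pt: "ennreal (1 - t) * (emeasure lborel {x. s < f x / S} * indicator {0..} s)
      + ennreal t * (emeasure lborel {x. s < g x / T} * indicator {0..} s)
      \<le> emeasure lborel {x. s < h x / U} * indicator {0..} s" (is "?l \<le> ?r") if "s \<noteq> 0" for s
  proof (cases "0 < s \<and> s < 1")
    case False
    then consider "s < 0" | "1 \<le> s" using \<open>s \<noteq> 0\<close> by linarith
    then show ?thesis
    proof cases
      case 2
      have "\<not> s < f x / S" "\<not> s < g x / T" for x
        using fS[of x] gT[of x] ST 2 by (auto simp: not_less divide_le_eq intro: order_trans)
      then have "{x. s < f x / S} = {}" "{x. s < g x / T} = {}" by auto
      then show ?thesis by simp
    qed simp
  next
    case True
    have eq: "{x. s < f x / S} = {x. s * S < f x}" "{x. s < g x / T} = {x. s * T < g x}" "{x. s < h x / U} = {x. s * U < h x}"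
      using ST U by (auto simp: field_simps)
    have ne: "{x. s * S < f x} \<noteq> {}" "{x. s * T < g x} \<noteq> {}"
    proof -
      have "s * S < S" "s * T < T" using True ST by auto
      then show "{x. s * S < f x} \<noteq> {}" "{x. s * T < g x} \<noteq> {}"
        using less_cSup_iff[OF _ f(3), of "s * S"] less_cSup_iff[OF _ g(3), of "s * T"] by (auto simp: S_def T_def)
    qed
    have fin: "emeasure lborel {x. s * U < h x} < \<infinity>"
    proof -
      have "emeasure lborel {x. s * U < h x} \<le> emeasure lborel {x\<in>space lborel. norm (h x) \<ge> s * U}"
        by (intro emeasure_mono) (use h(2) in \<open>auto simp: less_imp_le intro: order_trans[OF less_imp_le]\<close>)
      also have "\<dots> < \<infinity>"
      proof -
        have "\<infinity> > (\<integral>\<^sup>+x. ennreal (h x) \<partial>lborel)"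
          using h(1) h(2) by (simp add: integrable_iff_bounded less_imp_le)
        have "emeasure lborel {x\<in>space lborel. 1 \<le> ennreal (1 / (s * U)) * ennreal (h x)} \<le>
          ennreal (1 / (s * U)) * (\<integral>\<^sup>+x. ennreal (h x) * indicator (space lborel) x \<partial>lborel)"
          by (rule nn_integral_Markov_inequality) auto
        also have "\<dots> < \<infinity>" using \<open>\<infinity> > (\<integral>\<^sup>+x. ennreal (h x) \<partial>lborel)\<close> by (simp add: ennreal_mult_less_top)
        also have "{x\<in>space lborel. 1 \<le> ennreal (1 / (s * U)) * ennreal (h x)} = {x\<in>space lborel. norm (h x) \<ge> s * U}"
          using True U h(2) by (auto simp: less_imp_le field_simps simp flip: ennreal_mult ennreal_1)
        finally show ?thesis .
      qed
      finally show ?thesis .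
    qed
    have "ennreal (1 - t) * emeasure lborel {x. s * S < f x} + ennreal t * emeasure lborel {x. s * T < g x}
        \<le> emeasure lborel {x. s * U < h x}"
    proof (rule measure_convex_comb_le[OF _ ne(1) f(4) _ ne(2) g(4) _ fin t])
      fix a b assume "a \<in> {x. s * S < f x}" "b \<in> {x. s * T < g x}"
      then have ab: "s * S < f a" "s * T < g b" by auto
      have "s * U = (s * S) powr (1 - t) * (s * T) powr t"
        using True ST by (simp add: U_def powr_mult powr_add[symmetric] mult_ac flip: mult.assoc)
      also have "\<dots> < f a powr (1 - t) * g b powr t"
        using ab True ST t f(2)[of a] g(2)[of b] by (intro mult_strict_mono powr_less_mono2) auto
      also have "\<dots> \<le> h ((1 - t) * a + t * b)" by (rule le)
      finally show "(1 - t) * a + t * b \<in> {x. s * U < h x}" by simp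
    qed measurable
    then show ?thesis using True unfolding eq by simp
  qed
  have "ennreal (1 - t) * (\<integral>\<^sup>+x. ennreal (f x / S) \<partial>lborel) + ennreal t * (\<integral>\<^sup>+x. ennreal (g x / T) \<partial>lborel)
      \<le> (\<integral>\<^sup>+x. ennreal (h x / U) \<partial>lborel)"
  proof -
    have [measurable]: "(\<lambda>s. emeasure lborel {x. s < k x}) \<in> borel_measurable borel"
      if [measurable]: "k \<in> borel_measurable borel" for k :: "real \<Rightarrow> real"
    proof -
      have "(\<lambda>s. emeasure lborel (Pair s -` {p \<in> space (lborel \<Otimes>\<^sub>M lborel). fst p < k (snd p)})) \<in> borel_measurable lborel"
        by (rule lborel.measurable_emeasure_Pair) measurable
      then show ?thesis by (simp add: space_pair_measure vimage_def)
    qed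
    show ?thesis
      using ST U f(2) g(2) h(2)
      apply (subst (1 2 3) layer_cake)
           apply (auto simp: less_imp_le)[6]
      apply (subst (1 2) nn_integral_cmult[symmetric], (measurable)[2])
      apply (subst nn_integral_add[symmetric], (measurable)[2])
      apply (rule nn_integral_mono_AE)
      using AE_lborel_singleton[of 0] by eventually_elim (rule pt)
  qed
  moreover have nn: "(\<integral>\<^sup>+x. ennreal (k x / c) \<partial>lborel) = ennreal ((LINT x|lborel. k x) / c)"
    if "integrable lborel k" "\<And>x. 0 < k x" "0 < c" for k :: "real \<Rightarrow> real" and c
    using that by (subst nn_integral_eq_integral) (auto simp: less_imp_le)
  moreover note pos = integral_lborel_pos
  ultimately have "ennreal ((1 - t) * ((LINT x|lborel. f x) / S) + t * ((LINT x|lborel. g x) / T)) \<le> ennreal ((LINT x|lborel. h x) / U)"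
    using f g h ST U t pos[OF f(1,2)] pos[OF g(1,2)]
    by (simp add: ennreal_mult[symmetric] ennreal_plus[symmetric] less_imp_le del: ennreal_plus)
  then have "(1 - t) * ((LINT x|lborel. f x) / S) + t * ((LINT x|lborel. g x) / T) \<le> (LINT x|lborel. h x) / U"
    using pos[OF h] U by (simp add: ennreal_le_iff less_imp_le)
  with weighted_am_gm[of "(LINT x|lborel. f x) / S" "(LINT x|lborel. g x) / T" t]
  have "((LINT x|lborel. f x) / S) powr (1 - t) * ((LINT x|lborel. g x) / T) powr t \<le> (LINT x|lborel. h x) / U"
    using pos[OF f(1,2)] pos[OF g(1,2)] ST t by simp
  moreover have "((LINT x|lborel. f x) / S) powr (1 - t) * ((LINT x|lborel. g x) / T) powr t =
      ((LINT x|lborel. f x) powr (1 - t) * (LINT x|lborel. g x) powr t) / U"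
    using pos[OF f(1,2)] pos[OF g(1,2)] ST by (simp add: U_def powr_divide)
  ultimately show ?thesis using U by (simp add: divide_le_cancel)
qed


text \<open>Log-concavity with Gaussian decay. The functions are defined on all families but depend
  on the coordinates in \<open>J\<close> only, so that a coordinate is integrated out through
  \<open>z(i := y)\<close> without regard to extensionality. Strict positivity makes the
  \<open>powr\<close> form of concavity meaningful everywhere.\<close>

definition lcg :: "'i set \<Rightarrow> real \<Rightarrow> real \<Rightarrow> (('i \<Rightarrow> real) \<Rightarrow> real) \<Rightarrow> bool" where
  "lcg J \<tau> C f \<longleftrightarrow> f \<in> borel_measurable (Pi\<^sub>M J (\<lambda>_. lborel)) \<and>
     (\<forall>z z'. (\<forall>l\<in>J. z l = z' l) \<longrightarrow> f z = f z') \<and> (\<forall>z. 0 < f z) \<and>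
     (\<forall>z z' t. 0 < t \<longrightarrow> t < 1 \<longrightarrow> f z powr (1 - t) * f z' powr t \<le> f (\<lambda>l. (1 - t) * z l + t * z' l)) \<and>
     (\<forall>z. f z \<le> C * exp (- \<tau> * (\<Sum>l\<in>J. (z l)\<^sup>2)))"

lemma integrable_gauss:
  assumes "0 < \<tau>" shows "integrable lborel (\<lambda>x::real. exp (- \<tau> * x\<^sup>2))"
proof -
  define \<sigma> where "\<sigma> = sqrt (1 / (2 * \<tau>))"
  have s: "0 < \<sigma>" "2 * \<sigma>\<^sup>2 = 1 / \<tau>" using assms by (auto simp: \<sigma>_def)
  have "integrable lborel (\<lambda>x. sqrt (2 * pi * \<sigma>\<^sup>2) * normal_density 0 \<sigma> x)"
    using s by (intro integrable_mult_right) auto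
  moreover have "sqrt (2 * pi * \<sigma>\<^sup>2) * normal_density 0 \<sigma> x = exp (- \<tau> * x\<^sup>2)" for x
  proof -
    have "- x\<^sup>2 / (2 * \<sigma>\<^sup>2) = - \<tau> * x\<^sup>2" unfolding s(2) using assms by simp
    then show ?thesis using s(1) by (simp add: normal_density_def)
  qed
  ultimately show ?thesis by simp
qed

text \<open>Half of the exponent pays for the quadratic factor.\<close>

lemma abs_gauss_le:
  fixes x :: real
  assumes "0 < \<tau>"
  shows "\<exists>K>0. \<forall>x::real. (1 + x\<^sup>2) * exp (- \<tau> * x\<^sup>2) \<le> K * exp (- (\<tau> / 2) * x\<^sup>2)"
proof (intro exI[of _ "1 + 2 / \<tau>"] conjI allI)
  fix x :: real
  have "1 + \<tau> / 2 * x\<^sup>2 \<le> exp (\<tau> / 2 * x\<^sup>2)" by (rule exp_ge_add_one_self)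
  moreover have "x\<^sup>2 \<le> (2 / \<tau>) * exp (\<tau> / 2 * x\<^sup>2)"
  proof -
    have "\<tau> / 2 * x\<^sup>2 \<le> exp (\<tau> / 2 * x\<^sup>2)" using exp_ge_add_one_self[of "\<tau> / 2 * x\<^sup>2"] by linarith
    then have "(2 / \<tau>) * (\<tau> / 2 * x\<^sup>2) \<le> (2 / \<tau>) * exp (\<tau> / 2 * x\<^sup>2)"
      using assms by (intro mult_left_mono) auto
    then show ?thesis using assms by (simp only: mult.assoc[symmetric]) simp
  qed
  moreover have "1 \<le> exp (\<tau> / 2 * x\<^sup>2)" using assms by simp
  ultimately have "1 + x\<^sup>2 \<le> (1 + 2 / \<tau>) * exp (\<tau> / 2 * x\<^sup>2)"
    unfolding distrib_right by linarith
  then have "(1 + x\<^sup>2) * exp (- \<tau> * x\<^sup>2) \<le> (1 + 2 / \<tau>) * exp (\<tau> / 2 * x\<^sup>2) * exp (- \<tau> * x\<^sup>2)"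
    by (intro mult_right_mono) auto
  also have "\<dots> = (1 + 2 / \<tau>) * exp (- (\<tau> / 2) * x\<^sup>2)"
    by (simp add: mult.assoc flip: exp_add)
  finally show "(1 + x\<^sup>2) * exp (- \<tau> * x\<^sup>2) \<le> (1 + 2 / \<tau>) * exp (- (\<tau> / 2) * x\<^sup>2)" .
qed (use assms in \<open>auto intro: add_pos_pos\<close>)

interpretation lb: product_sigma_finite "\<lambda>_. lborel :: real measure" ..

lemma integrable_gauss_PiM:
  assumes "finite J" "0 < \<tau>"
  shows "integrable (Pi\<^sub>M J (\<lambda>_. lborel)) (\<lambda>z. exp (- \<tau> * (\<Sum>l\<in>J. (z l)\<^sup>2)) :: real)"
proof -
  have "integrable (Pi\<^sub>M J (\<lambda>_. lborel)) (\<lambda>z. \<Prod>l\<in>J. exp (- \<tau> * (z l)\<^sup>2) :: real)"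
    by (intro lb.product_integrable_prod assms integrable_gauss)
  then show ?thesis using assms by (simp add: exp_sum[symmetric] sum_distrib_left)
qed

lemma lcg_integrable:
  assumes J: "finite J" "0 < \<tau>" and f: "lcg J \<tau> C f"
    and [measurable]: "g \<in> borel_measurable (Pi\<^sub>M J (\<lambda>_. lborel))"
    and le: "\<And>z. \<bar>g z\<bar> \<le> D * (1 + (\<Sum>l\<in>J. (z l)\<^sup>2))"
  shows "integrable (Pi\<^sub>M J (\<lambda>_. lborel)) (\<lambda>z. f z * g z)"
proof -
  obtain K where K: "K > 0" "\<And>x::real. (1 + x\<^sup>2) * exp (- \<tau> * x\<^sup>2) \<le> K * exp (- (\<tau> / 2) * x\<^sup>2)"
    using abs_gauss_le[OF J(2)] by blast
  have [measurable]: "f \<in> borel_measurable (Pi\<^sub>M J (\<lambda>_. lborel))" using f by (simp add: lcg_def)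
  have f0: "0 < f z" "f z \<le> C * exp (- \<tau> * (\<Sum>l\<in>J. (z l)\<^sup>2))" for z using f by (auto simp: lcg_def)
  have C: "0 \<le> C" using less_le_trans[OF f0] by (auto simp: zero_less_mult_iff intro: less_imp_le)
  have D: "0 \<le> D * (1 + (\<Sum>l\<in>J. (z l)\<^sup>2))" for z using le[of z] by simp
  show ?thesis
  proof (rule Bochner_Integration.integrable_bound[of _ "\<lambda>z. C * \<bar>D\<bar> * K * exp (- (\<tau> / 2) * (\<Sum>l\<in>J. (z l)\<^sup>2))"])
    show "integrable (Pi\<^sub>M J (\<lambda>_. lborel)) (\<lambda>z. C * \<bar>D\<bar> * K * exp (- (\<tau> / 2) * (\<Sum>l\<in>J. (z l)\<^sup>2)))"
      using integrable_gauss_PiM[of J "\<tau> / 2"] J by simp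
    show "AE z in Pi\<^sub>M J (\<lambda>_. lborel). norm (f z * g z) \<le> norm (C * \<bar>D\<bar> * K * exp (- (\<tau> / 2) * (\<Sum>l\<in>J. (z l)\<^sup>2)))"
    proof (rule AE_I2)
      fix z
      define s where "s = sqrt (\<Sum>l\<in>J. (z l)\<^sup>2)"
      have s: "(\<Sum>l\<in>J. (z l)\<^sup>2) = s\<^sup>2" by (simp add: s_def sum_nonneg)
      have "0 < 1 + s\<^sup>2" by (simp add: add_pos_nonneg)
      then have D0: "0 \<le> D" using D[of z] unfolding s by (simp add: zero_le_mult_iff)
      have "norm (f z * g z) \<le> (C * exp (- \<tau> * s\<^sup>2)) * (D * (1 + s\<^sup>2))"
        unfolding real_norm_def abs_mult using f0[of z] le[of z] C by (intro mult_mono) (auto simp: s)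
      also have "\<dots> = C * D * ((1 + s\<^sup>2) * exp (- \<tau> * s\<^sup>2))" by simp
      also have "\<dots> \<le> C * D * (K * exp (- (\<tau> / 2) * s\<^sup>2))"
        using C D0 K(2)[of s] by (intro mult_left_mono) auto
      finally show "norm (f z * g z) \<le> norm (C * \<bar>D\<bar> * K * exp (- (\<tau> / 2) * (\<Sum>l\<in>J. (z l)\<^sup>2)))"
        using C K(1) D0 by (simp add: s mult_ac abs_mult)
    qed
  qed measurable
qed

lemma lcg_slice:
  assumes f: "lcg (insert i J) \<tau> C f" and i: "i \<notin> J" "finite J" and \<tau>: "0 < \<tau>"
  shows "(\<lambda>y. f (z(i := y))) \<in> borel_measurable borel" and "integrable lborel (\<lambda>y. f (z(i := y)))"
    and "f (z(i := y)) \<le> C * exp (- \<tau> * y\<^sup>2) * exp (- \<tau> * (\<Sum>l\<in>J. (z l)\<^sup>2))"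
proof -
  have "restrict z J \<in> space (Pi\<^sub>M J (\<lambda>_. lborel))" by (simp add: space_PiM)
  moreover have "f \<in> borel_measurable (Pi\<^sub>M (insert i J) (\<lambda>_. lborel))" using f by (simp add: lcg_def)
  ultimately have "f \<circ> (\<lambda>y. (restrict z J)(i := y)) \<in> borel_measurable lborel"
    using measurable_comp[OF measurable_component_update[OF _ i(1)]] by blast
  moreover have "f ((restrict z J)(i := y)) = f (z(i := y))" for y
    using f by (auto simp: lcg_def)
  ultimately show m: "(\<lambda>y. f (z(i := y))) \<in> borel_measurable borel" by (simp add: o_def)
  have "f (z(i := y)) \<le> C * exp (- \<tau> * (\<Sum>l\<in>insert i J. ((z(i := y)) l)\<^sup>2))" for y
    using f by (simp only: lcg_def)
  moreover have "(\<Sum>l\<in>insert i J. ((z(i := y)) l)\<^sup>2) = y\<^sup>2 + (\<Sum>l\<in>J. (z l)\<^sup>2)" for y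
    using i by (simp, intro sum.cong) auto
  ultimately show le: "f (z(i := y)) \<le> C * exp (- \<tau> * y\<^sup>2) * exp (- \<tau> * (\<Sum>l\<in>J. (z l)\<^sup>2))" for y
    by (simp add: distrib_left mult.assoc flip: exp_add)
  show "integrable lborel (\<lambda>y. f (z(i := y)))"
  proof (rule Bochner_Integration.integrable_bound[of _ "\<lambda>y. C * exp (- \<tau> * y\<^sup>2) * exp (- \<tau> * (\<Sum>l\<in>J. (z l)\<^sup>2))"])
    show "AE y in lborel. norm (f (z(i := y))) \<le> norm (C * exp (- \<tau> * y\<^sup>2) * exp (- \<tau> * (\<Sum>l\<in>J. (z l)\<^sup>2)))"
      using f le by (intro AE_I2) (auto simp: lcg_def less_imp_le intro: order_trans[OF _ abs_ge_self])
  qed (use m integrable_gauss[OF \<tau>] in auto)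
qed

text \<open>Prekopa-Leindler for the slices in direction \<open>i\<close>, whose superlevel sets are
  convex by log-concavity.\<close>

lemma lcg_marginal:
  assumes f: "lcg (insert i J) \<tau> C f" and i: "i \<notin> J" "finite J" and \<tau>: "0 < \<tau>"
  shows "\<exists>C'. lcg J \<tau> C' (\<lambda>z. LINT y|lborel. f (z(i := y)))"
proof (intro exI)
  let ?g = "\<lambda>z. LINT y|lborel. f (z(i := y))"
  note sl = lcg_slice[OF f i \<tau>]
  have fpos: "0 < f z" for z using f by (simp add: lcg_def)
  have lc: "f z powr (1 - t) * f z' powr t \<le> f (\<lambda>l. (1 - t) * z l + t * z' l)" if "0 < t" "t < 1" for z z' t
    using f that by (simp add: lcg_def)
  have conv: "convex {y. s < f (z(i := y))}" for s z
  proof (rule convexI)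
    fix x y :: real and u v :: real
    assume a: "x \<in> {y. s < f (z(i := y))}" "y \<in> {y. s < f (z(i := y))}" "0 \<le> u" "0 \<le> v" "u + v = 1"
    show "u *\<^sub>R x + v *\<^sub>R y \<in> {y. s < f (z(i := y))}"
    proof (cases "0 < v \<and> v < 1")
      case False
      then have "v = 0 \<and> u = 1 \<or> v = 1 \<and> u = 0" using a by auto
      then show ?thesis using a by auto
    next
      case True
      define m where "m = min (f (z(i := x))) (f (z(i := y)))"
      have m: "0 < m" "s < m" using fpos a by (auto simp: m_def)
      have "m = m powr (1 - v) * m powr v" using m by (simp flip: powr_add)
      also have "\<dots> \<le> f (z(i := x)) powr (1 - v) * f (z(i := y)) powr v"
        using m True by (intro mult_mono powr_mono2) (auto simp: m_def)
      also have "\<dots> \<le> f (\<lambda>l. (1 - v) * (z(i := x)) l + v * (z(i := y)) l)" using lc True by blast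
      finally have le: "m \<le> f (\<lambda>l. (1 - v) * (z(i := x)) l + v * (z(i := y)) l)" .
      have "u = 1 - v" using a(5) by simp
      have "(\<lambda>l. (1 - v) * (z(i := x)) l + v * (z(i := y)) l) = z(i := u * x + v * y)"
        unfolding \<open>u = 1 - v\<close> by (auto simp: fun_eq_iff algebra_simps)
      then show ?thesis using le m(2) by (simp only: mem_Collect_eq real_scaleR_def)
    qed
  qed
  have bd: "bdd_above (range (\<lambda>y. f (z(i := y))))" for z
  proof (rule bdd_aboveI2)
    fix y
    have "0 \<le> C" using less_le_trans[OF fpos sl(3)[of z y]] by (simp add: zero_less_mult_iff less_imp_le)
    then have "C * exp (- \<tau> * y\<^sup>2) * exp (- \<tau> * (\<Sum>l\<in>J. (z l)\<^sup>2)) \<le> C * 1 * 1"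
      using \<tau> by (intro mult_mono) (auto simp: sum_nonneg)
    then show "f (z(i := y)) \<le> C" using sl(3)[of z y] by simp
  qed
  show "lcg J \<tau> (C * (LINT y|lborel. exp (- \<tau> * y\<^sup>2))) ?g"
    unfolding lcg_def
  proof (intro conjI allI impI)
    have [measurable]: "f \<in> borel_measurable (Pi\<^sub>M (insert i J) (\<lambda>_. lborel))" using f by (simp add: lcg_def)
    have [measurable]: "(\<lambda>(z, y). f (z(i := y))) \<in> borel_measurable (Pi\<^sub>M J (\<lambda>_. lborel) \<Otimes>\<^sub>M lborel)"
      using measurable_comp[OF measurable_add_dim[of i J "\<lambda>_. lborel :: real measure"], of f borel] by (simp add: o_def split_beta')
    show "?g \<in> borel_measurable (Pi\<^sub>M J (\<lambda>_. lborel))"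
      by (rule lborel.borel_measurable_lebesgue_integral) simp
    show "?g z = ?g z'" if "\<forall>l\<in>J. z l = z' l" for z z'
    proof -
      have "f (z(i := y)) = f (z'(i := y))" for y using f that unfolding lcg_def by auto
      then show ?thesis by simp
    qed
    show "0 < ?g z" for z
      by (rule integral_lborel_pos[OF sl(2) fpos])
    show "?g z powr (1 - t) * ?g z' powr t \<le> ?g (\<lambda>l. (1 - t) * z l + t * z' l)" if t: "0 < t" "t < 1" for z z' t
    proof (rule prekopa_leindler[OF sl(2) fpos bd conv sl(2) fpos bd conv sl(2) fpos t])
      fix x y
      have "(\<lambda>l. (1 - t) * (z(i := x)) l + t * (z'(i := y)) l) = (\<lambda>l. (1 - t) * z l + t * z' l)(i := (1 - t) * x + t * y)"
        by (auto simp: fun_eq_iff)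
      then show "f (z(i := x)) powr (1 - t) * f (z'(i := y)) powr t \<le> f ((\<lambda>l. (1 - t) * z l + t * z' l)(i := (1 - t) * x + t * y))"
        using lc[OF t, of "z(i := x)" "z'(i := y)"] by simp
    qed
    show "?g z \<le> C * (LINT y|lborel. exp (- \<tau> * y\<^sup>2)) * exp (- \<tau> * (\<Sum>l\<in>J. (z l)\<^sup>2))" for z
    proof -
      have "?g z \<le> (LINT y|lborel. C * exp (- \<tau> * y\<^sup>2) * exp (- \<tau> * (\<Sum>l\<in>J. (z l)\<^sup>2)))"
        using sl integrable_gauss[OF \<tau>] by (intro integral_mono) auto
      then show ?thesis by simp
    qed
  qed
qed

lemma lcg_measurable: "lcg J \<tau> C f \<Longrightarrow> f \<in> borel_measurable (Pi\<^sub>M J (\<lambda>_. lborel))"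
  and lcg_pos: "lcg J \<tau> C f \<Longrightarrow> 0 < f z"
  and lcg_cong: "lcg J \<tau> C f \<Longrightarrow> (\<And>l. l \<in> J \<Longrightarrow> z l = z' l) \<Longrightarrow> f z = f z'"
  and lcg_concave: "lcg J \<tau> C f \<Longrightarrow> 0 < t \<Longrightarrow> t < 1 \<Longrightarrow>
    f z powr (1 - t) * f z' powr t \<le> f (\<lambda>l. (1 - t) * z l + t * z' l)"
  and lcg_le: "lcg J \<tau> C f \<Longrightarrow> f z \<le> C * exp (- \<tau> * (\<Sum>l\<in>J. (z l)\<^sup>2))"
  unfolding lcg_def by blast+

lemma one_plus_abs_le: "1 + \<bar>x\<bar> \<le> 2 * (1 + (x::real)\<^sup>2)"
proof -
  have "1 + y \<le> 2 * (1 + q)" if "2 * y \<le> q + 1" "0 \<le> q" for y q :: real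
    using that by simp
  from this[OF _ zero_le_power2[of x], of "\<bar>x\<bar>"] sum_squares_bound[of "\<bar>x\<bar>" 1] show ?thesis by simp
qed

text \<open>The other coordinates are integrated out one at a time by \<open>lcg_marginal\<close>.
  Test functions of linear growth are enough for the moments \<open>I\<close> and
  \<open>J\<close>.\<close>

lemma lcg_coordinate_density:
  assumes I: "finite I" "i0 \<notin> I" and \<tau>: "0 < \<tau>" and f: "lcg (insert i0 I) \<tau> C f"
  shows "\<exists>f' C'. lcg {i0} \<tau> C' f' \<and> (\<forall>\<phi>. \<phi> \<in> borel_measurable borel \<longrightarrow> (\<forall>a. \<bar>\<phi> a\<bar> \<le> 1 + \<bar>a\<bar>) \<longrightarrow>
    (LINT z|Pi\<^sub>M (insert i0 I) (\<lambda>_. lborel). f z * \<phi> (z i0)) = (LINT a|lborel. f' (\<lambda>_. a) * \<phi> a))"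
  using I f
proof (induction I arbitrary: f C rule: finite_induct)
  case empty
  show ?case
  proof (intro exI conjI allI impI)
    show "lcg {i0} \<tau> C f" using empty by simp
    fix \<phi> :: "real \<Rightarrow> real"
    assume [measurable]: "\<phi> \<in> borel_measurable borel"
    have "f z = f (\<lambda>_. z i0)" for z by (rule lcg_cong[OF empty(2)]) auto
    then have "(LINT z|Pi\<^sub>M (insert i0 {}) (\<lambda>_. lborel). f z * \<phi> (z i0)) =
        (LINT z|Pi\<^sub>M {i0} (\<lambda>_. lborel). (\<lambda>a. f (\<lambda>_. a) * \<phi> a) (z i0))"
      by (intro Bochner_Integration.integral_cong) auto
    also have "\<dots> = (LINT a|lborel. f (\<lambda>_. a) * \<phi> a)"
    proof (rule lb.product_integral_singleton)
      have "f ((\<lambda>_. 0)(i0 := y)) = f (\<lambda>_. y)" for y by (rule lcg_cong[OF empty(2)]) auto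
      then have "(\<lambda>y. f (\<lambda>_. y)) \<in> borel_measurable borel"
        using lcg_slice(1)[of i0 "{}" \<tau> C f "\<lambda>_. 0"] empty \<tau> by simp
      then show "(\<lambda>a. f (\<lambda>_. a) * \<phi> a) \<in> borel_measurable lborel" by simp
    qed
    finally show "(LINT z|Pi\<^sub>M (insert i0 {}) (\<lambda>_. lborel). f z * \<phi> (z i0)) = (LINT a|lborel. f (\<lambda>_. a) * \<phi> a)" .
  qed
next
  case (insert i I)
  let ?J = "insert i0 I"
  have iJ: "i \<notin> ?J" "finite ?J" using insert by auto
  have f: "lcg (insert i ?J) \<tau> C f" using insert.prems(2) by (simp add: insert_commute)
  obtain C' where g: "lcg ?J \<tau> C' (\<lambda>z. LINT y|lborel. f (z(i := y)))"
    using lcg_marginal[OF f iJ \<tau>] by blast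
  have "i0 \<notin> I" using insert.prems by auto
  from insert.IH[OF this g] obtain f' C'' where f': "lcg {i0} \<tau> C'' f'"
    "\<And>\<phi>. \<phi> \<in> borel_measurable borel \<Longrightarrow> (\<And>a. \<bar>\<phi> a\<bar> \<le> 1 + \<bar>a\<bar>) \<Longrightarrow>
      (LINT z|Pi\<^sub>M ?J (\<lambda>_. lborel). (LINT y|lborel. f (z(i := y))) * \<phi> (z i0)) = (LINT a|lborel. f' (\<lambda>_. a) * \<phi> a)"
    by blast
  show ?case
  proof (intro exI conjI allI impI)
    show "lcg {i0} \<tau> C'' f'" by fact
    fix \<phi> :: "real \<Rightarrow> real"
    assume [measurable]: "\<phi> \<in> borel_measurable borel" and le: "\<forall>a. \<bar>\<phi> a\<bar> \<le> 1 + \<bar>a\<bar>"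
    have m: "(\<lambda>z. z i0) \<in> borel_measurable (Pi\<^sub>M (insert i ?J) (\<lambda>_. lborel :: real measure))"
      using measurable_component_singleton[of i0 "insert i ?J" "\<lambda>_. lborel :: real measure"] by simp
    have int: "integrable (Pi\<^sub>M (insert i ?J) (\<lambda>_. lborel)) (\<lambda>z. f z * \<phi> (z i0))"
    proof (rule lcg_integrable[OF _ \<tau> f, of _ 2])
      show "(\<lambda>z. \<phi> (z i0)) \<in> borel_measurable (Pi\<^sub>M (insert i ?J) (\<lambda>_. lborel))" using m by measurable
      fix z :: "'a \<Rightarrow> real"
      have "\<bar>\<phi> (z i0)\<bar> \<le> 2 * (1 + (z i0)\<^sup>2)" using le one_plus_abs_le order_trans by blast
      also have "\<dots> \<le> 2 * (1 + (\<Sum>l\<in>insert i ?J. (z l)\<^sup>2))"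
        using member_le_sum[of i0 "insert i ?J" "\<lambda>l. (z l)\<^sup>2"] iJ by auto
      finally show "\<bar>\<phi> (z i0)\<bar> \<le> 2 * (1 + (\<Sum>l\<in>insert i ?J. (z l)\<^sup>2))" .
    qed (use iJ in auto)
    have "(LINT z|Pi\<^sub>M (insert i0 (insert i I)) (\<lambda>_. lborel). f z * \<phi> (z i0)) =
        (LINT z|Pi\<^sub>M (insert i ?J) (\<lambda>_. lborel). f z * \<phi> (z i0))" by (simp add: insert_commute)
    also have "\<dots> = (LINT z|Pi\<^sub>M ?J (\<lambda>_. lborel). LINT y|lborel. f (z(i := y)) * \<phi> ((z(i := y)) i0))"
      by (rule lb.product_integral_insert[OF iJ(2,1) int])
    also have "\<dots> = (LINT z|Pi\<^sub>M ?J (\<lambda>_. lborel). (LINT y|lborel. f (z(i := y))) * \<phi> (z i0))"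
      using iJ by (intro Bochner_Integration.integral_cong refl) auto
    also have "\<dots> = (LINT a|lborel. f' (\<lambda>_. a) * \<phi> a)" by (rule f'(2)) (use le in auto)
    finally show "(LINT z|Pi\<^sub>M (insert i0 (insert i I)) (\<lambda>_. lborel). f z * \<phi> (z i0)) = (LINT a|lborel. f' (\<lambda>_. a) * \<phi> a)" .
  qed
qed

lemma lcg_single_midpoint_decreasing:
  assumes f: "lcg {i0} \<tau> C f" and \<tau>: "0 < \<tau>"
  shows "midpoint_decreasing (\<lambda>a. f (\<lambda>_. a))"
proof (rule midpoint_decreasing.intro)
  have f0: "f ((\<lambda>_. 0)(i0 := y)) = f (\<lambda>_. y)" for y by (rule lcg_cong[OF f]) simp
  show m: "(\<lambda>a. f (\<lambda>_. a)) \<in> borel_measurable borel"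
    using lcg_slice(1)[of i0 "{}" \<tau> C f "\<lambda>_. 0"] f \<tau> by (simp add: f0)
  show "0 \<le> f (\<lambda>_. a)" for a using lcg_pos[OF f] by (simp add: less_imp_le)
  show "f (\<lambda>_. x + e') * f (\<lambda>_. x - e') \<le> f (\<lambda>_. x + e) * f (\<lambda>_. x - e)"
    if "0 \<le> e" "e \<le> e'" for x e e'
  proof (cases "e = e'")
    case False
    \<comment> \<open>With this weight \<open>x + e\<close> and \<open>x - e\<close> are the two
      convex combinations of \<open>x + e'\<close> and \<open>x - e'\<close>; in the product of the
      two concavity estimates the weights recombine to exponent 1.\<close>
    define t where "t = (e' - e) / (2 * e')"
    have t: "0 < t" "t < 1" "t * (2 * e') = e' - e" using that False by (auto simp: t_def)
    define p q where "p = f (\<lambda>_. x + e')" and "q = f (\<lambda>_. x - e')"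
    have pq: "0 < p" "0 < q" using lcg_pos[OF f] by (auto simp: p_def q_def)
    have e1: "(1 - t) * (x + e') + t * (x - e') = x + e" "(1 - t) * (x - e') + t * (x + e') = x - e"
      using t(3) by Groebner_Basis.algebra+
    have 1: "p powr (1 - t) * q powr t \<le> f (\<lambda>_. x + e)" "q powr (1 - t) * p powr t \<le> f (\<lambda>_. x - e)"
      using lcg_concave[OF f t(1,2), of "\<lambda>_. x + e'" "\<lambda>_. x - e'"] lcg_concave[OF f t(1,2), of "\<lambda>_. x - e'" "\<lambda>_. x + e'"]
      by (simp_all add: p_def q_def e1)
    have "p * q = (p powr (1 - t) * p powr t) * (q powr (1 - t) * q powr t)"
      using pq by (simp flip: powr_add)
    also have "\<dots> = (p powr (1 - t) * q powr t) * (q powr (1 - t) * p powr t)" by (simp add: mult_ac)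
    also have "\<dots> \<le> f (\<lambda>_. x + e) * f (\<lambda>_. x - e)"
      using 1 lcg_pos[OF f] by (intro mult_mono) (auto simp: less_imp_le)
    finally show ?thesis by (simp add: p_def q_def)
  qed simp
  show "integrable lborel (\<lambda>a. (1 + \<bar>a\<bar>) * f (\<lambda>_. a))"
  proof -
    obtain K where K: "K > 0" "\<And>x::real. (1 + x\<^sup>2) * exp (- \<tau> * x\<^sup>2) \<le> K * exp (- (\<tau> / 2) * x\<^sup>2)"
      using abs_gauss_le[OF \<tau>] by blast
    have C: "0 \<le> C" using less_le_trans[OF lcg_pos[OF f] lcg_le[OF f]] by (auto simp: zero_less_mult_iff intro: less_imp_le)
    show ?thesis
    proof (rule Bochner_Integration.integrable_bound[of _ "\<lambda>a. C * 2 * K * exp (- (\<tau> / 2) * a\<^sup>2)"])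
      show "integrable lborel (\<lambda>a::real. C * 2 * K * exp (- (\<tau> / 2) * a\<^sup>2))"
        using integrable_gauss[of "\<tau> / 2"] \<tau> by simp
      show "AE a in lborel. norm ((1 + \<bar>a\<bar>) * f (\<lambda>_. a)) \<le> norm (C * 2 * K * exp (- (\<tau> / 2) * a\<^sup>2))"
      proof (rule AE_I2)
        fix a :: real
        have "norm ((1 + \<bar>a\<bar>) * f (\<lambda>_. a)) = (1 + \<bar>a\<bar>) * f (\<lambda>_. a)"
          using lcg_pos[OF f, of "\<lambda>_. a"] by simp
        also have "\<dots> \<le> (2 * (1 + a\<^sup>2)) * (C * exp (- \<tau> * a\<^sup>2))"
          using lcg_le[OF f, of "\<lambda>_. a"] lcg_pos[OF f, of "\<lambda>_. a"] one_plus_abs_le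
          by (intro mult_mono) (auto simp: less_imp_le)
        also have "\<dots> = C * 2 * ((1 + a\<^sup>2) * exp (- \<tau> * a\<^sup>2))" by simp
        also have "\<dots> \<le> C * 2 * (K * exp (- (\<tau> / 2) * a\<^sup>2))" using C K(2) by (intro mult_left_mono) auto
        finally show "norm ((1 + \<bar>a\<bar>) * f (\<lambda>_. a)) \<le> norm (C * 2 * K * exp (- (\<tau> / 2) * a\<^sup>2))"
          using C K(1) by simp
      qed
    qed (use m in measurable)
  qed
qed

text \<open>The linear form \<open>\<Sum>l\<in>J. w l * z l\<close> is made a coordinate by eliminating \<open>z i0\<close>.\<close>
lemma lcg_linear_substitution:
  assumes J: "finite I" "i0 \<notin> I" and \<tau>: "0 < \<tau>" and f: "lcg (insert i0 I) \<tau> C f" and w: "w i0 \<noteq> 0"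
  defines "f' \<equiv> \<lambda>z. f (z(i0 := (z i0 - (\<Sum>l\<in>I. w l * z l)) / w i0)) / \<bar>w i0\<bar>"
  shows "\<exists>\<tau>'>0. \<exists>C'. lcg (insert i0 I) \<tau>' C' f'"
    and "\<phi> \<in> borel_measurable borel \<Longrightarrow> (\<And>a. \<bar>\<phi> a\<bar> \<le> 1 + \<bar>a\<bar>) \<Longrightarrow>
      (LINT z|Pi\<^sub>M (insert i0 I) (\<lambda>_. lborel). f z * \<phi> (\<Sum>l\<in>insert i0 I. w l * z l)) =
      (LINT z|Pi\<^sub>M (insert i0 I) (\<lambda>_. lborel). f' z * \<phi> (z i0))"
proof -
  let ?J = "insert i0 I" and ?P = "\<lambda>J. Pi\<^sub>M J (\<lambda>_. lborel :: real measure)"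
  define s where "s z = (\<Sum>l\<in>I. w l * z l)" for z :: "'a \<Rightarrow> real"
  define T where "T z = z(i0 := (z i0 - s z) / w i0)" for z
  have f'T: "f' z = f (T z) / \<bar>w i0\<bar>" for z by (simp add: f'_def T_def s_def)
  \<comment> \<open>\<open>z i0\<close> is the value of the linear form at \<open>T z\<close>, so
    Cauchy-Schwarz bounds the square norm of \<open>z\<close> by \<open>W\<close> times that of
    \<open>T z\<close>; the substitution therefore weakens the decay rate to
    \<open>\<tau> / W\<close>.\<close>
  define W where "W = (\<Sum>l\<in>?J. (w l)\<^sup>2) + 1"
  have W: "0 < W" unfolding W_def by (intro add_nonneg_pos sum_nonneg) auto
  have C: "0 \<le> C" using less_le_trans[OF lcg_pos[OF f] lcg_le[OF f]] by (auto simp: zero_less_mult_iff intro: less_imp_le)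
  have sT: "s (T z) = s z" for z unfolding s_def T_def using J by (intro sum.cong) auto
  have inv: "(\<Sum>l\<in>?J. w l * T z l) = z i0" for z
    using J w sT[of z] by (simp add: s_def[symmetric]) (simp add: T_def)
  have norm: "(\<Sum>l\<in>?J. (z l)\<^sup>2) \<le> W * (\<Sum>l\<in>?J. (T z l)\<^sup>2)" for z
  proof -
    have "(z i0)\<^sup>2 \<le> (\<Sum>l\<in>?J. (w l)\<^sup>2) * (\<Sum>l\<in>?J. (T z l)\<^sup>2)"
      using Cauchy_Schwarz_ineq_sum[of w "T z" ?J] by (simp only: inv)
    moreover have "(\<Sum>l\<in>I. (z l)\<^sup>2) = (\<Sum>l\<in>I. (T z l)\<^sup>2)" unfolding T_def using J by (intro sum.cong) auto
    moreover have "(\<Sum>l\<in>I. (T z l)\<^sup>2) \<le> (\<Sum>l\<in>?J. (T z l)\<^sup>2)" using J by simp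
    moreover have "(\<Sum>l\<in>?J. (z l)\<^sup>2) = (z i0)\<^sup>2 + (\<Sum>l\<in>I. (z l)\<^sup>2)" using J by simp
    ultimately show ?thesis by (simp add: W_def distrib_right del: sum.insert)
  qed
  have lin: "T (\<lambda>l. (1 - t) * z l + t * z' l) = (\<lambda>l. (1 - t) * T z l + t * T z' l)" for t z z'
  proof -
    have "s (\<lambda>l. (1 - t) * z l + t * z' l) = (1 - t) * s z + t * s z'"
      unfolding s_def sum_distrib_left sum.distrib[symmetric] by (intro sum.cong) (auto simp: algebra_simps)
    then have "((1 - t) * z i0 + t * z' i0 - s (\<lambda>l. (1 - t) * z l + t * z' l)) / w i0 =
        (1 - t) * ((z i0 - s z) / w i0) + t * ((z' i0 - s z') / w i0)"
      by (simp add: diff_divide_distrib add_divide_distrib right_diff_distrib)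
    then show ?thesis by (auto simp: T_def fun_eq_iff)
  qed
  have [measurable]: "f \<in> borel_measurable (?P ?J)" by (rule lcg_measurable[OF f])
  have comp: "(\<lambda>z. z l) \<in> borel_measurable (?P ?J)" if "l \<in> ?J" for l
    using measurable_component_singleton[OF that, of "\<lambda>_. lborel :: real measure"] by simp
  have sm: "s \<in> borel_measurable (?P ?J)" unfolding s_def using comp by (intro borel_measurable_sum borel_measurable_times) auto
  have "lcg ?J (\<tau> / W) (C / \<bar>w i0\<bar>) f'"
    unfolding lcg_def
  proof (intro conjI allI impI)
    have "(\<lambda>z. f (restrict (T z) ?J) / \<bar>w i0\<bar>) \<in> borel_measurable (?P ?J)"
    proof -
      have "(\<lambda>z. restrict (T z) ?J) \<in> measurable (?P ?J) (?P ?J)"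
      proof (rule measurable_restrict)
        fix l assume "l \<in> ?J"
        then show "(\<lambda>z. T z l) \<in> measurable (?P ?J) lborel"
          using comp[of l] comp[of i0] sm by (cases "l = i0") (auto simp: T_def)
      qed
      then show ?thesis by measurable
    qed
    moreover have "f (restrict (T z) ?J) = f (T z)" for z by (rule lcg_cong[OF f]) auto
    ultimately show "f' \<in> borel_measurable (?P ?J)" by (simp add: f'T cong: measurable_cong)
    show "f' z = f' z'" if "\<forall>l\<in>?J. z l = z' l" for z z'
    proof -
      have "s z = s z'" unfolding s_def using that by (intro sum.cong) auto
      then have "f (T z) = f (T z')" using that by (intro lcg_cong[OF f]) (auto simp: T_def)
      then show ?thesis by (simp add: f'T)
    qed
    show "0 < f' z" for z using w lcg_pos[OF f] by (simp add: f'T)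
    show "f' z powr (1 - t) * f' z' powr t \<le> f' (\<lambda>l. (1 - t) * z l + t * z' l)" if t: "0 < t" "t < 1" for z z' t
    proof -
      have "f' z powr (1 - t) * f' z' powr t =
          (f (T z) powr (1 - t) * f (T z') powr t) / (\<bar>w i0\<bar> powr (1 - t) * \<bar>w i0\<bar> powr t)"
        using lcg_pos[OF f] by (simp add: f'T powr_divide less_imp_le)
      also have "\<bar>w i0\<bar> powr (1 - t) * \<bar>w i0\<bar> powr t = \<bar>w i0\<bar>" using w by (simp flip: powr_add)
      finally show ?thesis using lcg_concave[OF f t, of "T z" "T z'"] w by (simp add: f'T lin divide_right_mono)
    qed
    show "f' z \<le> C / \<bar>w i0\<bar> * exp (- (\<tau> / W) * (\<Sum>l\<in>?J. (z l)\<^sup>2))" for z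
    proof -
      have "\<tau> / W * (\<Sum>l\<in>?J. (z l)\<^sup>2) \<le> \<tau> / W * (W * (\<Sum>l\<in>?J. (T z l)\<^sup>2))"
        using \<tau> W norm[of z] by (intro mult_left_mono) auto
      also have "\<dots> = \<tau> * (\<Sum>l\<in>?J. (T z l)\<^sup>2)" using W by simp
      finally have "f (T z) \<le> C * exp (- (\<tau> / W) * (\<Sum>l\<in>?J. (z l)\<^sup>2))"
        using C by (intro order_trans[OF lcg_le[OF f, of "T z"]] mult_left_mono) auto
      then show ?thesis by (simp add: f'T divide_right_mono)
    qed
  qed
  then have lf': "lcg ?J (\<tau> / W) (C / \<bar>w i0\<bar>) f'" .
  show "\<exists>\<tau>'>0. \<exists>C'. lcg ?J \<tau>' C' f'" using lf' \<tau> W by (intro exI[of _ "\<tau> / W"] conjI exI) auto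
  have main: "(LINT z|?P ?J. f z * \<phi> (\<Sum>l\<in>?J. w l * z l)) = (LINT z|?P ?J. f' z * \<phi> (z i0))"
    if [measurable]: "\<phi> \<in> borel_measurable borel" and le: "\<And>a. \<bar>\<phi> a\<bar> \<le> 1 + \<bar>a\<bar>" for \<phi> :: "real \<Rightarrow> real"
  proof -
  have i1: "integrable (?P ?J) (\<lambda>z. f z * \<phi> (\<Sum>l\<in>?J. w l * z l))"
  proof (rule lcg_integrable[OF _ \<tau> f, of _ "2 * W"])
    have "(\<lambda>z. \<Sum>l\<in>?J. w l * z l) \<in> borel_measurable (?P ?J)" using comp by (intro borel_measurable_sum borel_measurable_times) auto
    then show "(\<lambda>z. \<phi> (\<Sum>l\<in>?J. w l * z l)) \<in> borel_measurable (?P ?J)" by measurable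
    fix z :: "'a \<Rightarrow> real"
    have "\<bar>\<phi> (\<Sum>l\<in>?J. w l * z l)\<bar> \<le> 2 * (1 + (\<Sum>l\<in>?J. w l * z l)\<^sup>2)" using le one_plus_abs_le order_trans by blast
    also have "\<dots> \<le> 2 * (1 + (\<Sum>l\<in>?J. (w l)\<^sup>2) * (\<Sum>l\<in>?J. (z l)\<^sup>2))"
      using Cauchy_Schwarz_ineq_sum[of w z ?J] by simp
    also have "\<dots> \<le> 2 * W * (1 + (\<Sum>l\<in>?J. (z l)\<^sup>2))"
    proof -
      have "0 \<le> (\<Sum>l\<in>?J. (w l)\<^sup>2)" "0 \<le> (\<Sum>l\<in>?J. (z l)\<^sup>2)" by (intro sum_nonneg; simp)+
      then show ?thesis unfolding W_def by (simp add: algebra_simps del: sum.insert)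
    qed
    finally show "\<bar>\<phi> (\<Sum>l\<in>?J. w l * z l)\<bar> \<le> 2 * W * (1 + (\<Sum>l\<in>?J. (z l)\<^sup>2))" .
  qed (use J in auto)
  have i2: "integrable (?P ?J) (\<lambda>z. f' z * \<phi> (z i0))"
  proof (rule lcg_integrable[OF _ _ lf', of _ 2])
    show "(\<lambda>z. \<phi> (z i0)) \<in> borel_measurable (?P ?J)" using comp[of i0] by measurable
    fix z :: "'a \<Rightarrow> real"
    have "\<bar>\<phi> (z i0)\<bar> \<le> 2 * (1 + (z i0)\<^sup>2)" using le one_plus_abs_le order_trans by blast
    also have "\<dots> \<le> 2 * (1 + (\<Sum>l\<in>?J. (z l)\<^sup>2))" using J by (auto intro: sum_nonneg)
    finally show "\<bar>\<phi> (z i0)\<bar> \<le> 2 * (1 + (\<Sum>l\<in>?J. (z l)\<^sup>2))" .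
  qed (use J \<tau> W in auto)
  have "(LINT z|?P ?J. f z * \<phi> (\<Sum>l\<in>?J. w l * z l)) =
      (LINT z|?P I. LINT y|lborel. f (z(i0 := y)) * \<phi> (\<Sum>l\<in>?J. w l * (z(i0 := y)) l))"
    by (rule lb.product_integral_insert[OF J i1])
  also have "\<dots> = (LINT z|?P I. LINT y|lborel. f' (z(i0 := y)) * \<phi> ((z(i0 := y)) i0))"
  proof (rule Bochner_Integration.integral_cong[OF refl])
    fix z :: "'a \<Rightarrow> real"
    have s': "s (z(i0 := y)) = s z" for y unfolding s_def using J by (intro sum.cong) auto
    have s'': "(\<Sum>l\<in>?J. w l * (z(i0 := y)) l) = w i0 * y + s z" for y using J s'[of y] by (simp add: s_def)
    have T': "T (z(i0 := a)) = z(i0 := - s z / w i0 + (1 / w i0) * a)" for a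
      by (auto simp: T_def s' fun_eq_iff diff_divide_distrib)
    have "(LINT y|lborel. f (z(i0 := y)) * \<phi> (\<Sum>l\<in>?J. w l * (z(i0 := y)) l)) = (LINT y|lborel. f (z(i0 := y)) * \<phi> (w i0 * y + s z))"
      by (simp only: s'')
    also have "\<dots> = \<bar>1 / w i0\<bar> *\<^sub>R (LINT a|lborel. f (z(i0 := - s z / w i0 + (1 / w i0) * a)) * \<phi> (w i0 * (- s z / w i0 + (1 / w i0) * a) + s z))"
      using w by (intro lborel_integral_real_affine) auto
    also have "\<dots> = (LINT a|lborel. f' (z(i0 := a)) * \<phi> ((z(i0 := a)) i0))"
      unfolding f'T T' real_scaleR_def integral_mult_right_zero[symmetric]
      using w by (intro Bochner_Integration.integral_cong refl) (auto simp: field_simps)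
    finally show "(LINT y|lborel. f (z(i0 := y)) * \<phi> (\<Sum>l\<in>?J. w l * (z(i0 := y)) l)) = (LINT y|lborel. f' (z(i0 := y)) * \<phi> ((z(i0 := y)) i0))" .
  qed
  also have "\<dots> = (LINT z|?P ?J. f' z * \<phi> (z i0))"
    by (rule lb.product_integral_insert[OF J i2, symmetric])
  finally show ?thesis .
  qed
  show "\<phi> \<in> borel_measurable borel \<Longrightarrow> (\<And>a. \<bar>\<phi> a\<bar> \<le> 1 + \<bar>a\<bar>) \<Longrightarrow>
      (LINT z|?P ?J. f z * \<phi> (\<Sum>l\<in>?J. w l * z l)) = (LINT z|?P ?J. f' z * \<phi> (z i0))"
    by (rule main)
qed

text \<open>The linear form has a log-concave law on the line: substitution makes it a coordinate,
  marginalization gives its density, and the one-dimensional inequality applies.\<close>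

theorem lcg_logistic_moment_inequality:
  assumes J: "finite J" "i0 \<in> J" and \<tau>: "0 < \<tau>" and f: "lcg J \<tau> C f" and w: "w i0 \<noteq> 0"
  defines "\<theta> \<equiv> \<lambda>z. \<Sum>l\<in>J. w l * z l"
  defines "S n \<equiv> LINT z|Pi\<^sub>M J (\<lambda>_. lborel). f z * sg (\<theta> z) ^ n"
  defines "K n \<equiv> LINT z|Pi\<^sub>M J (\<lambda>_. lborel). f z * (sg (\<theta> z) ^ n * \<theta> z)"
  shows "S 0 * S 1 * S 2 - S 1 ^ 3 \<le> 2 * S 0 * (S 1 * K 2 - S 2 * K 1)"
proof -
  define A where "A = J - {i0}"
  have A: "finite A" "i0 \<notin> A" "J = insert i0 A" using J by (auto simp: A_def)
  note sub = lcg_linear_substitution[of A i0 \<tau> C f w, OF A(1,2) \<tau> f[unfolded A(3)] w]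
  from sub(1) obtain f' \<tau>' C' where f': "0 < \<tau>'" "lcg (insert i0 A) \<tau>' C' f'"
    "f' = (\<lambda>z. f (z(i0 := (z i0 - (\<Sum>l\<in>A. w l * z l)) / w i0)) / \<bar>w i0\<bar>)" by blast
  obtain g C'' where g: "lcg {i0} \<tau>' C'' g"
    "\<And>\<phi>. \<phi> \<in> borel_measurable borel \<Longrightarrow> (\<And>a. \<bar>\<phi> a\<bar> \<le> 1 + \<bar>a\<bar>) \<Longrightarrow>
      (LINT z|Pi\<^sub>M (insert i0 A) (\<lambda>_. lborel). f' z * \<phi> (z i0)) = (LINT a|lborel. g (\<lambda>_. a) * \<phi> a)"
    using lcg_coordinate_density[OF A(1,2) f'(1,2)] by blast
  interpret midpoint_decreasing "\<lambda>a. g (\<lambda>_. a)" by (rule lcg_single_midpoint_decreasing[OF g(1) f'(1)])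
  have red: "(LINT z|Pi\<^sub>M J (\<lambda>_. lborel). f z * \<phi> (\<theta> z)) = (LINT a|lborel. g (\<lambda>_. a) * \<phi> a)"
    if "\<phi> \<in> borel_measurable borel" "\<And>a. \<bar>\<phi> a\<bar> \<le> 1 + \<bar>a\<bar>" for \<phi>
    using sub(2)[OF that] g(2)[OF that] by (simp add: \<theta>_def A(3) f'(3))
  have le: "sg a ^ n \<le> 1" "0 \<le> sg a ^ n" for a n
    using sg_pos[of a] sg_less_1[of a] by (auto intro!: power_le_one)
  have "S n = I n" for n
    unfolding S_def I_def
    by (rule red) (use le[where n = n] in \<open>auto intro: order_trans[of _ 1]\<close>)
  moreover have "K n = midpoint_decreasing.J (\<lambda>a. g (\<lambda>_. a)) n" for n
    unfolding K_def J_def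
    by (rule red) (use le[where n = n] in \<open>auto simp: abs_mult intro: order_trans[OF mult_right_mono[OF le(1)]]\<close>)
  ultimately show ?thesis using logistic_moment_inequality by simp
qed

section \<open>Gibbs posteriors of logistic models\<close>

lemma sg_minus: "sg (- t) = 1 - sg t"
proof -
  have "1 + exp t > 0" by (simp add: add_pos_pos)
  then show ?thesis by (simp add: sg_def exp_minus field_simps)
qed

lemma exp_minus_sg: "exp (- t) * sg t = 1 - sg t"
proof -
  have "1 + exp (- t) > 0" by (simp add: add_pos_pos)
  then show ?thesis by (simp add: sg_def field_simps)
qed

text \<open>Weighted AM-GM for \<open>sg\<close> and for \<open>1 - sg\<close>. The two right-hand
  sides add up to 1, and the second geometric mean is \<open>exp (- m)\<close> times the
  first.\<close>

lemma sg_log_concave: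
  assumes "0 < t" "t < 1"
  shows "sg a powr (1 - t) * sg b powr t \<le> sg ((1 - t) * a + t * b)"
proof -
  define m where "m = (1 - t) * a + t * b"
  have p: "0 < 1 + exp (- m)" by (simp add: add_pos_pos)
  have e: "exp (- m) * (sg a powr (1 - t) * sg b powr t) = (1 - sg a) powr (1 - t) * (1 - sg b) powr t"
    unfolding exp_minus_sg[symmetric] using sg_pos
    by (simp add: powr_mult less_imp_le exp_powr_real m_def algebra_simps flip: exp_add)
  have "sg a powr (1 - t) * sg b powr t * (1 + exp (- m)) =
      sg a powr (1 - t) * sg b powr t + (1 - sg a) powr (1 - t) * (1 - sg b) powr t"
    by (simp add: distrib_left e[symmetric])
  also have "\<dots> \<le> ((1 - t) * sg a + t * sg b) + ((1 - t) * (1 - sg a) + t * (1 - sg b))"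
    using assms sg_pos sg_less_1 by (intro add_mono weighted_am_gm) auto
  also have "\<dots> = 1" by (simp add: algebra_simps)
  finally show ?thesis using p unfolding m_def[symmetric] by (simp add: sg_def[of m] field_simps)
qed

lemma ln_sg_tangent: "ln (sg a) - ln (sg b) \<le> (1 - sg b) * (a - b)"
proof -
  have pb: "0 < sg b" "sg b < 1" "0 < sg a" using sg_pos sg_less_1 by auto
  have "1 / sg a = 1 + exp (- a)" by (simp add: sg_def)
  then have "sg b / sg a = sg b * (1 + exp (- b) * exp (- (a - b)))"
    by (simp flip: exp_add) (metis divide_inverse inverse_eq_divide)
  also have "\<dots> = sg b * exp 0 + (1 - sg b) * exp (- (a - b))"
    using exp_minus_sg[of b] by (simp only: exp_zero) Groebner_Basis.algebra
  also have "\<dots> \<ge> exp (sg b * 0 + (1 - sg b) * (- (a - b)))"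
    using convex_onD[OF exp_convex, of "1 - sg b" 0 "- (a - b)"] pb by simp
  finally have "ln (exp ((1 - sg b) * (- (a - b)))) \<le> ln (sg b / sg a)"
    using pb by (subst ln_le_cancel_iff) auto
  then show ?thesis using pb by (simp add: ln_div algebra_simps)
qed

lemma minus_ln_sg: "0 \<le> - ln (sg a)" "- ln (sg a) \<le> 1 + \<bar>a\<bar>"
proof -
  show "0 \<le> - ln (sg a)" using sg_pos[of a] sg_less_1[of a] by simp
  have "ln (sg 0) - ln (sg a) \<le> (1 - sg a) * (0 - a)" by (rule ln_sg_tangent)
  also have "\<dots> \<le> \<bar>(1 - sg a) * (0 - a)\<bar>" by simp
  also have "\<dots> \<le> \<bar>a\<bar>" using sg_pos[of a] sg_less_1[of a] by (simp add: abs_mult mult_left_le_one_le)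
  finally have "- ln (sg a) \<le> \<bar>a\<bar> + ln 2" by (simp add: sg_def ln_div)
  moreover have "ln 2 \<le> (1::real)" using ln_le_minus_one[of 2] by simp
  ultimately show "- ln (sg a) \<le> 1 + \<bar>a\<bar>" by simp
qed

lemma nn_integral_PiM_scale:
  fixes z0 :: "'i \<Rightarrow> real"
  assumes "finite J" and s: "0 < s" and "f \<in> borel_measurable (Pi\<^sub>M J (\<lambda>_. lborel))"
  shows "(\<integral>\<^sup>+z. f (\<lambda>l\<in>J. z0 l + s * (z l - z0 l)) \<partial>Pi\<^sub>M J (\<lambda>_. lborel)) * ennreal (s ^ card J) =
    (\<integral>\<^sup>+z. f z \<partial>Pi\<^sub>M J (\<lambda>_. lborel))"
  using assms(1,3)
proof (induction J arbitrary: f rule: finite_induct)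
  case empty
  then show ?case by (simp add: PiM_empty nn_integral_count_space_finite)
next
  case (insert i J)
  let ?P = "Pi\<^sub>M J (\<lambda>_. lborel :: real measure)"
  define S where "S J z = (\<lambda>l\<in>J. z0 l + s * (z l - z0 l))" for J and z :: "'i \<Rightarrow> real"
  have SJ: "S J \<in> measurable (Pi\<^sub>M J (\<lambda>_. lborel)) (Pi\<^sub>M J (\<lambda>_. lborel))" for J
    unfolding S_def by (rule measurable_restrict) measurable
  have [measurable]: "f \<in> borel_measurable (Pi\<^sub>M (insert i J) (\<lambda>_. lborel))" by fact
  have fS: "(\<lambda>z. f (S (insert i J) z)) \<in> borel_measurable (Pi\<^sub>M (insert i J) (\<lambda>_. lborel))"
    using measurable_comp[OF SJ insert.prems] by (simp add: o_def)
  define g where "g z = (\<integral>\<^sup>+y. f (z(i := y)) \<partial>lborel)" for z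
  have [measurable]: "(\<lambda>(z, y). f (z(i := y))) \<in> borel_measurable (?P \<Otimes>\<^sub>M lborel)"
    using measurable_comp[OF measurable_add_dim[of i J "\<lambda>_. lborel :: real measure"] insert.prems] by (simp add: o_def split_beta')
  have g: "g \<in> borel_measurable ?P"
    unfolding g_def by (rule lborel.borel_measurable_nn_integral) simp
  have "(\<integral>\<^sup>+z. f (S (insert i J) z) \<partial>Pi\<^sub>M (insert i J) (\<lambda>_. lborel)) =
      (\<integral>\<^sup>+z. \<integral>\<^sup>+y. f (S (insert i J) (z(i := y))) \<partial>lborel \<partial>?P)"
    by (rule lb.product_nn_integral_insert[OF insert.hyps fS])
  also have "\<dots> = (\<integral>\<^sup>+z. \<integral>\<^sup>+y. f ((S J z)(i := (z0 i - s * z0 i) + s * y)) \<partial>lborel \<partial>?P)"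
  proof (intro nn_integral_cong)
    fix z y
    have "S (insert i J) (z(i := y)) = (S J z)(i := (z0 i - s * z0 i) + s * y)"
      using insert.hyps by (auto simp: S_def fun_eq_iff algebra_simps)
    then show "f (S (insert i J) (z(i := y))) = f ((S J z)(i := (z0 i - s * z0 i) + s * y))" by simp
  qed
  also have "\<dots> = (\<integral>\<^sup>+z. g (S J z) * ennreal (1 / s) \<partial>?P)"
  proof (intro nn_integral_cong)
    fix z assume "z \<in> space ?P"
    then have "S J z \<in> space ?P" using SJ by (auto simp: measurable_def)
    then have "(\<lambda>y. f ((S J z)(i := y))) \<in> borel_measurable borel"
      using measurable_compose[OF measurable_component_update[OF _ insert.hyps(2)] insert.prems] by simp
    from nn_integral_real_affine[OF this, of s "z0 i - s * z0 i"] s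
    have gS: "g (S J z) = ennreal s * (\<integral>\<^sup>+y. f ((S J z)(i := (z0 i - s * z0 i) + s * y)) \<partial>lborel)"
      by (simp add: g_def)
    have "ennreal s * ennreal (1 / s) = 1" using s by (simp flip: ennreal_mult)
    then have "X = (ennreal s * X) * ennreal (1 / s)" for X :: ennreal
      by (metis mult.commute mult.left_commute mult_1)
    from this[of "\<integral>\<^sup>+y. f ((S J z)(i := (z0 i - s * z0 i) + s * y)) \<partial>lborel"]
    show "(\<integral>\<^sup>+y. f ((S J z)(i := (z0 i - s * z0 i) + s * y)) \<partial>lborel) = g (S J z) * ennreal (1 / s)"
      unfolding gS .
  qed
  also have "\<dots> = (\<integral>\<^sup>+z. g (S J z) \<partial>?P) * ennreal (1 / s)"
    using measurable_comp[OF SJ g] by (intro nn_integral_multc) (simp add: o_def)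
  finally have "(\<integral>\<^sup>+z. f (S (insert i J) z) \<partial>Pi\<^sub>M (insert i J) (\<lambda>_. lborel)) * ennreal (s ^ card (insert i J)) =
      ((\<integral>\<^sup>+z. g (S J z) \<partial>?P) * ennreal (s ^ card J)) * (ennreal (1 / s) * ennreal s)"
    using insert.hyps s by (simp add: ennreal_mult mult_ac)
  also have "ennreal (1 / s) * ennreal s = 1" using s by (simp flip: ennreal_mult)
  also have "(\<integral>\<^sup>+z. g (S J z) \<partial>?P) * ennreal (s ^ card J) = (\<integral>\<^sup>+z. g z \<partial>?P)"
    using insert.IH[OF g] unfolding S_def .
  also have "\<dots> = (\<integral>\<^sup>+z. f z \<partial>Pi\<^sub>M (insert i J) (\<lambda>_. lborel))"
    unfolding g_def by (rule lb.product_nn_integral_insert[OF insert.hyps insert.prems, symmetric])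
  finally show ?case by (simp add: S_def)
qed

text \<open>The Gaussian prior with parameter \<open>\<tau>\<close> makes the posterior proper even
  for separated labels; in the end \<open>\<tau>\<close> tends to 0. The index \<open>i0\<close>
  marks a coordinate in which the rows are later assumed to be nonzero, so that no linear form
  degenerates.\<close>

locale logistic_family =
  fixes J :: "'i set" and \<tau> :: real and w :: "nat \<Rightarrow> 'i \<Rightarrow> real" and i0 :: 'i
  assumes finJ: "finite J" and i0: "i0 \<in> J" and \<tau>: "0 < \<tau>"
begin

abbreviation "P \<equiv> Pi\<^sub>M J (\<lambda>_. lborel :: real measure)"

definition "\<theta> j z = (\<Sum>l\<in>J. w j l * z l)"
definition "sq z = (\<Sum>l\<in>J. (z l)\<^sup>2)" for z :: "'i \<Rightarrow> real"
definition sign :: "bool \<Rightarrow> real" where "sign b = (if b then 1 else - 1)"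
definition "lik b t = sg (sign b * t)"
text \<open>Unnormalized posterior density given the labels of the rows in \<open>R\<close>:
  Gaussian prior times likelihood.\<close>

definition "wt R y z = exp (- \<tau> * sq z) * (\<Prod>j\<in>R. lik (y j) (\<theta> j z))"
text \<open>Growth at most quadratic: large enough a class for all integrands below, and small
  enough for their posterior means to exist.\<close>

definition tame :: "(('i \<Rightarrow> real) \<Rightarrow> real) \<Rightarrow> bool" where
  "tame g \<longleftrightarrow> g \<in> borel_measurable P \<and> (\<exists>D. \<forall>z. \<bar>g z\<bar> \<le> D * (1 + sq z))"

lemma sign_sq: "sign b * sign b = 1" "sign b \<noteq> 0" by (auto simp: sign_def)

lemma lik_pos: "0 < lik b t" "lik b t < 1" by (simp_all add: lik_def sg_pos sg_less_1)

lemma component [measurable]: "l \<in> J \<Longrightarrow> (\<lambda>z. z l) \<in> borel_measurable P"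
  using measurable_component_singleton[of l J "\<lambda>_. lborel :: real measure"] by simp

lemma \<theta>_measurable [measurable]: "\<theta> j \<in> borel_measurable P"
  unfolding \<theta>_def by (intro borel_measurable_sum borel_measurable_times component) auto

lemma sq_nonneg: "0 \<le> sq z" unfolding sq_def by (rule sum_nonneg) simp

lemma \<theta>_lin: "\<theta> j (\<lambda>l. a * z l + b * z' l) = a * \<theta> j z + b * \<theta> j z'"
  unfolding \<theta>_def sum_distrib_left sum.distrib[symmetric] by (intro sum.cong) (auto simp: algebra_simps)

lemma lcg_wt: "lcg J \<tau> 1 (wt R y)"
  unfolding lcg_def
proof (intro conjI allI impI)
  have "sq \<in> borel_measurable P" unfolding sq_def by (intro borel_measurable_sum borel_measurable_power component) auto
  then show "wt R y \<in> borel_measurable P" unfolding wt_def lik_def by measurable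
  show "wt R y z = wt R y z'" if "\<forall>l\<in>J. z l = z' l" for z z'
  proof -
    have "sq z = sq z'" "\<theta> j z = \<theta> j z'" for j unfolding sq_def \<theta>_def using that by (auto intro: sum.cong)
    then show ?thesis by (simp add: wt_def)
  qed
  show "0 < wt R y z" for z unfolding wt_def by (intro mult_pos_pos prod_pos) (auto simp: lik_pos)
  show "wt R y z \<le> 1 * exp (- \<tau> * (\<Sum>l\<in>J. (z l)\<^sup>2))" for z
    unfolding wt_def sq_def using prod_mono[of R "\<lambda>j. lik (y j) (\<theta> j z)" "\<lambda>_. 1"] lik_pos
    by (auto simp: less_imp_le mult_left_le)
  fix z z' :: "'i \<Rightarrow> real" and t :: real assume t: "0 < t" "t < 1"
  let ?m = "\<lambda>l. (1 - t) * z l + t * z' l"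
  have "sq ?m \<le> (1 - t) * sq z + t * sq z'"
    unfolding sq_def sum_distrib_left sum.distrib[symmetric]
  proof (rule sum_mono)
    fix l
    have "(1 - t) * (z l)\<^sup>2 + t * (z' l)\<^sup>2 - ((1 - t) * z l + t * z' l)\<^sup>2 = t * (1 - t) * (z l - z' l)\<^sup>2" by Groebner_Basis.algebra
    also have "\<dots> \<ge> 0" using t by simp
    finally show "((1 - t) * z l + t * z' l)\<^sup>2 \<le> (1 - t) * (z l)\<^sup>2 + t * (z' l)\<^sup>2" by simp
  qed
  then have "\<tau> * sq ?m \<le> \<tau> * ((1 - t) * sq z + t * sq z')" using \<tau> by (intro mult_left_mono) auto
  then have e: "exp (- \<tau> * sq z) powr (1 - t) * exp (- \<tau> * sq z') powr t \<le> exp (- \<tau> * sq ?m)"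
    by (simp add: exp_powr_real algebra_simps flip: exp_add)
  have "wt R y z powr (1 - t) * wt R y z' powr t = (exp (- \<tau> * sq z) powr (1 - t) * exp (- \<tau> * sq z') powr t) *
      (\<Prod>j\<in>R. lik (y j) (\<theta> j z) powr (1 - t) * lik (y j) (\<theta> j z') powr t)"
    unfolding wt_def prod.distrib
    by (simp add: powr_mult prod_nonneg lik_pos less_imp_le prod_powr_distrib)
  also have "\<dots> \<le> wt R y ?m"
    unfolding wt_def
  proof (intro mult_mono e prod_mono)
    fix j assume "j \<in> R"
    have "lik (y j) (\<theta> j z) powr (1 - t) * lik (y j) (\<theta> j z') powr t \<le> sg ((1 - t) * (sign (y j) * \<theta> j z) + t * (sign (y j) * \<theta> j z'))"
      unfolding lik_def by (rule sg_log_concave[OF t])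
    then show "0 \<le> lik (y j) (\<theta> j z) powr (1 - t) * lik (y j) (\<theta> j z') powr t \<and>
        lik (y j) (\<theta> j z) powr (1 - t) * lik (y j) (\<theta> j z') powr t \<le> lik (y j) (\<theta> j ?m)"
      by (simp add: lik_def \<theta>_lin distrib_left mult.left_commute)
  qed (auto intro!: prod_nonneg mult_nonneg_nonneg)
  finally show "wt R y z powr (1 - t) * wt R y z' powr t \<le> wt R y ?m" .
qed

lemma wt_pos: "0 < wt R y z" by (rule lcg_pos[OF lcg_wt])
lemma wt_measurable [measurable]: "wt R y \<in> borel_measurable P" by (rule lcg_measurable[OF lcg_wt])

lemma tame_integrable: "tame g \<Longrightarrow> integrable P (\<lambda>z. wt R y z * g z)"
  unfolding tame_def sq_def using lcg_integrable[OF finJ \<tau> lcg_wt, of g] by blast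

lemma tameI: "g \<in> borel_measurable P \<Longrightarrow> (\<And>z. \<bar>g z\<bar> \<le> D * (1 + sq z)) \<Longrightarrow> tame g"
  unfolding tame_def by blast

lemma tame_const: "tame (\<lambda>_. c)"
  by (rule tameI[of _ "\<bar>c\<bar>"]) (use sq_nonneg in \<open>auto simp: mult_left_mono[of 1 "1 + sq _" "\<bar>c\<bar>", simplified]\<close>)

lemma tame_add: assumes "tame f" "tame g" shows "tame (\<lambda>z. f z + g z)"
proof -
  from assms obtain D D' where "\<And>z. \<bar>f z\<bar> \<le> D * (1 + sq z)" "\<And>z. \<bar>g z\<bar> \<le> D' * (1 + sq z)"
    unfolding tame_def by blast
  then have "\<bar>f z + g z\<bar> \<le> (D + D') * (1 + sq z)" for z
    unfolding distrib_right[of D D'] by (meson abs_triangle_ineq add_mono order_trans)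
  then show ?thesis using assms by (intro tameI) (auto simp: tame_def)
qed

lemma tame_mult_bounded:
  assumes "tame f" "h \<in> borel_measurable P" "\<And>z. \<bar>h z\<bar> \<le> B" shows "tame (\<lambda>z. h z * f z)"
proof -
  from assms obtain D where D: "\<And>z. \<bar>f z\<bar> \<le> D * (1 + sq z)" unfolding tame_def by blast
  have "\<bar>h z * f z\<bar> \<le> (B * D) * (1 + sq z)" for z
    unfolding abs_mult mult.assoc by (intro mult_mono D assms(3)) (use assms(3)[of z] in auto)
  then show ?thesis using assms by (intro tameI) (auto simp: tame_def)
qed

lemma tame_cmult: "tame f \<Longrightarrow> tame (\<lambda>z. c * f z)"
  by (rule tame_mult_bounded[of f _ "\<bar>c\<bar>"]) auto

lemma tame_diff: "tame f \<Longrightarrow> tame g \<Longrightarrow> tame (\<lambda>z. f z - g z)"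
  using tame_add[of f "\<lambda>z. (- 1) * g z"] tame_cmult[of g "- 1"] by simp

lemma tame_neg: "tame g \<Longrightarrow> tame (\<lambda>z. - g z)"
  using tame_cmult[of g "- 1"] by simp

lemma tame_sum: "(\<And>i. i \<in> A \<Longrightarrow> tame (f i)) \<Longrightarrow> tame (\<lambda>z. \<Sum>i\<in>A. f i z)"
  by (induction A rule: infinite_finite_induct) (auto intro: tame_add tame_const)

lemma tame_prod: assumes "l \<in> J" "m \<in> J" shows "tame (\<lambda>z. z l * z m)"
proof (rule tameI[of _ 1])
  show "(\<lambda>z. z l * z m) \<in> borel_measurable P" using assms by measurable
  fix z :: "'i \<Rightarrow> real"
  have "(z l)\<^sup>2 \<le> sq z" "(z m)\<^sup>2 \<le> sq z" unfolding sq_def by (intro member_le_sum; use assms finJ in auto)+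
  moreover have "2 * \<bar>z l\<bar> * \<bar>z m\<bar> \<le> (z l)\<^sup>2 + (z m)\<^sup>2" using sum_squares_bound[of "\<bar>z l\<bar>" "\<bar>z m\<bar>"] by simp
  ultimately show "\<bar>z l * z m\<bar> \<le> 1 * (1 + sq z)" by (simp add: abs_mult)
qed

lemma tame_abs_bound: "tame f \<Longrightarrow> g \<in> borel_measurable P \<Longrightarrow> (\<And>z. \<bar>g z\<bar> \<le> \<bar>f z\<bar>) \<Longrightarrow> tame g"
  unfolding tame_def by (meson order_trans)

lemma tame_component: assumes "l \<in> J" shows "tame (\<lambda>z. z l)"
proof (rule tame_abs_bound[of "\<lambda>z. 1 + z l * z l"])
  show "tame (\<lambda>z. 1 + z l * z l)" by (intro tame_add tame_const tame_prod assms)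
  show "\<bar>z l\<bar> \<le> \<bar>1 + z l * z l\<bar>" for z :: "'i \<Rightarrow> real"
    using sum_squares_bound[of "\<bar>z l\<bar>" 1] zero_le_square[of "z l"] by (simp add: power2_eq_square)
qed (use assms in measurable)

lemma tame_\<theta>: "tame (\<theta> j)"
  unfolding \<theta>_def by (intro tame_sum tame_cmult tame_component)

lemma tame_abs_\<theta>: "tame (\<lambda>z. \<bar>\<theta> j z\<bar>)"
  by (rule tame_abs_bound[OF tame_\<theta>[of j]]) auto

lemma lik_measurable [measurable]: "(\<lambda>z. lik b (\<theta> j z)) \<in> borel_measurable P" unfolding lik_def by measurable

lemma tame_ln_lik: "tame (\<lambda>z. ln (lik b (\<theta> j z)))"
proof (rule tame_abs_bound[of "\<lambda>z. 1 + \<bar>\<theta> j z\<bar>"])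
  show "\<bar>ln (lik b (\<theta> j z))\<bar> \<le> \<bar>1 + \<bar>\<theta> j z\<bar>\<bar>" for z
    using minus_ln_sg[of "sign b * \<theta> j z"] by (auto simp: lik_def sign_def)
qed (intro tame_add tame_const tame_abs_\<theta>, measurable)

definition "Z R y = (LINT z|P. wt R y z)"
definition "E R y g = (LINT z|P. wt R y z * g z) / Z R y"

lemma wt_integrable: "integrable P (wt R y)"
  using tame_integrable[OF tame_const[of 1]] by simp

lemma Z_pos: "0 < Z R y"
proof -
  have "0 \<le> Z R y" unfolding Z_def by (intro Bochner_Integration.integral_nonneg less_imp_le wt_pos)
  moreover have "Z R y \<noteq> 0"
  proof
    assume "Z R y = 0"
    then have "AE z in P. wt R y z = 0"
      unfolding Z_def using wt_integrable by (subst (asm) integral_nonneg_eq_0_iff_AE) (auto simp: less_imp_le wt_pos)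
    then have "AE z in P. False" by (rule AE_mp) (use wt_pos in \<open>auto simp: less_le\<close>)
    then have "ae_filter P = bot" by (simp add: trivial_limit_def)
    then have "emeasure P (space P) = 0" by (simp add: ae_filter_eq_bot_iff)
    moreover have "emeasure P (space P) = (\<Prod>i\<in>J. emeasure (lborel :: real measure) (space lborel))"
      using lb.emeasure_PiM[OF finJ, of "\<lambda>_. UNIV"] by (simp add: space_PiM)
    ultimately show False using finJ by (simp add: prod_zero_iff)
  qed
  ultimately show ?thesis by simp
qed

lemma E_add: "tame f \<Longrightarrow> tame g \<Longrightarrow> E R y (\<lambda>z. f z + g z) = E R y f + E R y g"
  unfolding E_def using tame_integrable[of f R y] tame_integrable[of g R y] by (simp add: distrib_left add_divide_distrib)
lemma E_diff: "tame f \<Longrightarrow> tame g \<Longrightarrow> E R y (\<lambda>z. f z - g z) = E R y f - E R y g"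
  unfolding E_def using tame_integrable[of f R y] tame_integrable[of g R y] by (simp add: right_diff_distrib diff_divide_distrib)
lemma E_cmult: "E R y (\<lambda>z. c * f z) = c * E R y f"
  unfolding E_def by (simp add: mult.left_commute[of _ c])
lemma E_const: "E R y (\<lambda>_. c) = c"
  using Z_pos[of R y] by (simp add: E_def Z_def[symmetric])
lemma E_sum: "(\<And>i. i \<in> A \<Longrightarrow> tame (f i)) \<Longrightarrow> E R y (\<lambda>z. \<Sum>i\<in>A. f i z) = (\<Sum>i\<in>A. E R y (f i))"
proof (induction A rule: infinite_finite_induct)
  case (insert x F)
  then show ?case by (simp add: E_add tame_sum)
qed (simp_all add: E_const)
lemma E_mono: assumes "tame f" "tame g" "\<And>z. f z \<le> g z" shows "E R y f \<le> E R y g"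
  unfolding E_def
proof (intro divide_right_mono integral_mono tame_integrable assms)
  show "wt R y z * f z \<le> wt R y z * g z" for z using wt_pos[of R y z] assms(3) by simp
qed (use Z_pos[of R y] in simp)

text \<open>Directional derivative of \<open>- ln (wt R y)\<close> at the point
  \<open>z0 + s * (z - z0)\<close> in the direction \<open>z - z0\<close>.\<close>

definition "grad R y z0 s z = (\<Sum>j\<in>R. - (sign (y j) * (1 - lik (y j) (\<theta> j z0 + s * (\<theta> j z - \<theta> j z0)))) * (\<theta> j z - \<theta> j z0))
  + 2 * \<tau> * (\<Sum>l\<in>J. (z0 l + s * (z l - z0 l)) * (z l - z0 l))"

lemma lik_shift_measurable [measurable]:
  "(\<lambda>z. lik b (\<theta> j z0 + s * (\<theta> j z - \<theta> j z0))) \<in> borel_measurable P"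
  unfolding lik_def by measurable

lemma lik_factor_le: "\<bar>- (sign b * (1 - lik b t))\<bar> \<le> 1"
  using lik_pos[of b t] by (auto simp: sign_def)

lemma tame_grad: "tame (grad R y z0 s)"
proof -
  have "tame (\<lambda>z. (z0 l + s * (z l - z0 l)) * (z l - z0 l))" if "l \<in> J" for l
  proof -
    have "(\<lambda>z. (z0 l + s * (z l - z0 l)) * (z l - z0 l)) =
      (\<lambda>z. s * (z l * z l) + ((z0 l - 2 * s * z0 l) * z l + (s * z0 l * z0 l - z0 l * z0 l)))"
      by (auto simp: fun_eq_iff algebra_simps)
    then show ?thesis using that by (simp only:) (intro tame_add tame_cmult tame_prod tame_component tame_const)
  qed
  then show ?thesis
    unfolding grad_def
    by (intro tame_add tame_cmult tame_sum tame_mult_bounded[OF _ _ lik_factor_le] tame_diff tame_const tame_\<theta>) auto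
qed

lemma neg_ln_wt: "finite R \<Longrightarrow> ln (wt R y z) = - \<tau> * sq z + (\<Sum>j\<in>R. ln (lik (y j) (\<theta> j z)))"
  unfolding wt_def using lik_pos by (subst ln_mult_pos) (auto intro!: prod_pos simp: ln_prod less_imp_neq[symmetric])

text \<open>Tangent inequality for the convex function \<open>- ln wt\<close> at the contracted
  point, evaluated at \<open>z\<close>, which lies \<open>(1 - s) * (z - z0)\<close> further
  on.\<close>

lemma ln_wt_diff_le:
  assumes R: "finite R" and s: "0 < s" "s < 1"
  shows "(1 - s) * grad R y z0 s z \<le> ln (wt R y (\<lambda>l\<in>J. z0 l + s * (z l - z0 l))) - ln (wt R y z)"
proof -
  define S where "S = (\<lambda>l\<in>J. z0 l + s * (z l - z0 l))"
  have \<theta>S: "\<theta> j S = \<theta> j z0 + s * (\<theta> j z - \<theta> j z0)" for j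
  proof -
    have 1: "\<theta> j S = \<theta> j (\<lambda>l. (1 - s) * z0 l + s * z l)"
      unfolding \<theta>_def S_def by (intro sum.cong) (auto simp: algebra_simps)
    show ?thesis by (simp only: 1 \<theta>_lin) (simp add: algebra_simps)
  qed
  have 1: "(1 - s) * (- (sign (y j) * (1 - lik (y j) (\<theta> j S))) * (\<theta> j z - \<theta> j z0))
      \<le> ln (lik (y j) (\<theta> j S)) - ln (lik (y j) (\<theta> j z))" for j
  proof -
    have "ln (lik (y j) (\<theta> j z)) - ln (lik (y j) (\<theta> j S)) \<le> (1 - lik (y j) (\<theta> j S)) * (sign (y j) * \<theta> j z - sign (y j) * \<theta> j S)"
      unfolding lik_def by (rule ln_sg_tangent)
    also have "\<dots> = - ((1 - s) * (- (sign (y j) * (1 - lik (y j) (\<theta> j S))) * (\<theta> j z - \<theta> j z0)))"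
      unfolding \<theta>S by (simp add: algebra_simps)
    finally show ?thesis by linarith
  qed
  have 2: "(1 - s) * (2 * ((z0 l + s * (z l - z0 l)) * (z l - z0 l))) \<le> (z l)\<^sup>2 - (S l)\<^sup>2" if "l \<in> J" for l
  proof -
    have "(z l)\<^sup>2 - (S l)\<^sup>2 - (1 - s) * (2 * ((z0 l + s * (z l - z0 l)) * (z l - z0 l))) = ((1 - s) * (z l - z0 l))\<^sup>2"
      using that by (simp add: S_def) Groebner_Basis.algebra
    then show ?thesis by (metis diff_ge_0_iff_ge zero_le_power2)
  qed
  have "(1 - s) * grad R y z0 s z = (\<Sum>j\<in>R. (1 - s) * (- (sign (y j) * (1 - lik (y j) (\<theta> j S))) * (\<theta> j z - \<theta> j z0)))
      + \<tau> * (\<Sum>l\<in>J. (1 - s) * (2 * ((z0 l + s * (z l - z0 l)) * (z l - z0 l))))"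
  proof -
    have "(1 - s) * grad R y z0 s z = (1 - s) * (\<Sum>j\<in>R. - (sign (y j) * (1 - lik (y j) (\<theta> j S))) * (\<theta> j z - \<theta> j z0))
      + \<tau> * ((1 - s) * (2 * (\<Sum>l\<in>J. (z0 l + s * (z l - z0 l)) * (z l - z0 l))))"
      unfolding grad_def \<theta>S by Groebner_Basis.algebra
    then show ?thesis by (simp only: sum_distrib_left)
  qed
  also have "\<dots> \<le> (\<Sum>j\<in>R. ln (lik (y j) (\<theta> j S)) - ln (lik (y j) (\<theta> j z))) + \<tau> * (\<Sum>l\<in>J. (z l)\<^sup>2 - (S l)\<^sup>2)"
    using \<tau> by (intro add_mono sum_mono mult_left_mono 1 2) auto
  also have "\<dots> = ln (wt R y S) - ln (wt R y z)"
    unfolding neg_ln_wt[OF R] by (simp add: sq_def sum_subtractf algebra_simps)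
  finally show ?thesis by (simp add: S_def)
qed

text \<open>Integration by parts in the form of a change of variables. Contraction towards
  \<open>z0\<close> has Jacobian \<open>s ^ card J\<close>, so the posterior mean of
  \<open>s ^ card J\<close> times the ratio of contracted to original density is 1;
  \<open>exp u \<ge> 1 + u\<close> and \<open>ln_wt_diff_le\<close> turn this into a bound for the
  mean of \<open>grad\<close>, without differentiation under the integral.\<close>

lemma E_grad_le:
  assumes R: "finite R" and s: "0 < s" "s < 1"
  shows "E R y (grad R y z0 s) \<le> card J / s"
proof -
  define G where "G z = wt R y (\<lambda>l\<in>J. z0 l + s * (z l - z0 l))" for z
  have "(\<lambda>z. \<lambda>l\<in>J. z0 l + s * (z l - z0 l)) \<in> measurable P P" by (rule measurable_restrict) measurable
  from measurable_compose[OF this wt_measurable] have Gm: "G \<in> borel_measurable P"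
    unfolding G_def[abs_def] .
  define k where "k = s ^ card J"
  have k: "0 < k" using s by (simp add: k_def)
  have "(\<integral>\<^sup>+z. ennreal (G z) \<partial>P) * ennreal k = (\<integral>\<^sup>+z. ennreal (wt R y z) \<partial>P)"
    using nn_integral_PiM_scale[OF finJ s(1), of "\<lambda>z. ennreal (wt R y z)" z0] by (simp add: G_def k_def)
  also have "\<dots> = ennreal (Z R y)"
    unfolding Z_def by (intro nn_integral_eq_integral wt_integrable) (auto simp: less_imp_le wt_pos)
  finally have GZ: "(\<integral>\<^sup>+z. ennreal (k * G z) \<partial>P) = ennreal (Z R y)"
    using k Gm by (simp add: ennreal_mult' nn_integral_cmult mult.commute)
  have G0: "0 \<le> k * G z" for z using k by (simp add: G_def wt_pos less_imp_le)
  have Gint: "integrable P (\<lambda>z. k * G z)"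
    by (rule integrableI_nonneg) (use Gm G0 GZ in auto)
  have "(LINT z|P. k * G z) = Z R y"
    using integral_eq_nn_integral[of "\<lambda>z. k * G z" P] Gm G0 GZ Z_pos[of R y] by simp
  moreover have "(LINT z|P. wt R y z * (1 - card J * ln (1 / s) + (1 - s) * grad R y z0 s z)) \<le> (LINT z|P. k * G z)"
  proof (rule integral_mono[OF tame_integrable Gint])
    show "tame (\<lambda>z. 1 - card J * ln (1 / s) + (1 - s) * grad R y z0 s z)"
      by (intro tame_add tame_cmult tame_const tame_grad)
    fix z
    have "1 - card J * ln (1 / s) + (1 - s) * grad R y z0 s z \<le> exp (- (card J * ln (1 / s)) + (1 - s) * grad R y z0 s z)"
      using exp_ge_add_one_self[of "- (card J * ln (1 / s)) + (1 - s) * grad R y z0 s z"] by linarith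
    also have "\<dots> \<le> exp (- (card J * ln (1 / s)) + (ln (G z) - ln (wt R y z)))"
      using ln_wt_diff_le[OF R s, of y z0 z] by (simp add: G_def)
    also have "\<dots> = k * (G z / wt R y z)"
    proof -
      have "exp (- (card J * ln (1 / s))) = k"
        using s by (simp add: k_def ln_div exp_of_nat_mult)
      moreover have "exp (ln (G z) - ln (wt R y z)) = G z / wt R y z"
        by (simp add: exp_diff G_def wt_pos)
      ultimately show ?thesis unfolding exp_add by simp
    qed
    finally show "wt R y z * (1 - card J * ln (1 / s) + (1 - s) * grad R y z0 s z) \<le> k * G z"
      using wt_pos[of R y z] by (simp add: field_simps)
  qed
  ultimately have "E R y (\<lambda>z. 1 - card J * ln (1 / s) + (1 - s) * grad R y z0 s z) \<le> 1"
    unfolding E_def using Z_pos[of R y] by simp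
  then have "(1 - s) * E R y (grad R y z0 s) \<le> card J * ln (1 / s)"
    by (simp add: E_add E_cmult E_const tame_const tame_cmult tame_grad)
  also have "\<dots> \<le> card J * (1 / s - 1)" using s by (intro mult_left_mono ln_le_minus_one) auto
  also have "\<dots> = (1 - s) * (card J / s)" using s by (simp add: field_simps)
  finally show ?thesis by (rule mult_left_le_imp_le) (use s in simp)
qed

text \<open>Limit \<open>s\<close> to 1 of \<open>E_grad_le\<close>, by dominated convergence; the
  majorant \<open>B\<close> is a quadratic bound uniform in \<open>s\<close>.\<close>

lemma E_grad_le_card:
  assumes R: "finite R"
  shows "E R y (grad R y z0 1) \<le> card J"
proof -
  define s where "s k = 1 - 1 / real (k + 2)" for k :: nat
  have s: "0 < s k" "s k < 1" for k by (auto simp: s_def field_simps)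
  have slim: "s \<longlonglongrightarrow> 1"
  proof -
    have "(\<lambda>k. 1 - 1 / real (k + 2)) \<longlonglongrightarrow> 1 - 0"
      by (intro tendsto_diff tendsto_const) (use LIMSEQ_ignore_initial_segment[OF lim_1_over_n, of 2] in simp)
    then show ?thesis by (simp add: s_def[abs_def])
  qed
  define B where "B z = (\<Sum>j\<in>R. \<bar>\<theta> j z\<bar> + \<bar>\<theta> j z0\<bar>) + 2 * \<tau> * (\<Sum>l\<in>J. 2 * (z l * z l) + 6 * (z0 l)\<^sup>2)" for z
  have B: "tame B" unfolding B_def by (intro tame_add tame_sum tame_cmult tame_const tame_abs_\<theta> tame_prod) auto
  have le: "\<bar>grad R y z0 (s k) z\<bar> \<le> B z" for k z
  proof -
    have "\<bar>- (sign (y j) * (1 - lik (y j) (\<theta> j z0 + s k * (\<theta> j z - \<theta> j z0)))) * (\<theta> j z - \<theta> j z0)\<bar> \<le> 1 * (\<bar>\<theta> j z\<bar> + \<bar>\<theta> j z0\<bar>)" for j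
      unfolding abs_mult[of "- (sign (y j) * _)"] by (intro mult_mono lik_factor_le) auto
    moreover have "\<bar>(z0 l + s k * (z l - z0 l)) * (z l - z0 l)\<bar> \<le> 2 * (z l * z l) + 6 * (z0 l)\<^sup>2" for l
    proof -
      have "\<bar>z0 l + s k * (z l - z0 l)\<bar> \<le> \<bar>z0 l\<bar> + \<bar>s k * (z l - z0 l)\<bar>" by (rule abs_triangle_ineq)
      also have "\<bar>s k * (z l - z0 l)\<bar> \<le> \<bar>z l\<bar> + \<bar>z0 l\<bar>"
        using s[of k] mult_left_le_one_le[of "\<bar>z l - z0 l\<bar>" "s k"] by (auto simp: abs_mult)
      finally have "\<bar>z0 l + s k * (z l - z0 l)\<bar> \<le> \<bar>z l\<bar> + 2 * \<bar>z0 l\<bar>" by simp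
      then have "\<bar>(z0 l + s k * (z l - z0 l)) * (z l - z0 l)\<bar> \<le> (\<bar>z l\<bar> + 2 * \<bar>z0 l\<bar>) * (\<bar>z l\<bar> + \<bar>z0 l\<bar>)"
        unfolding abs_mult by (intro mult_mono) auto
      also have "\<dots> = (z l)\<^sup>2 + 3 * (\<bar>z l\<bar> * \<bar>z0 l\<bar>) + 2 * (z0 l)\<^sup>2"
        by (simp add: algebra_simps power2_eq_square)
      also have "\<dots> \<le> 2 * (z l * z l) + 6 * (z0 l)\<^sup>2"
      proof -
        have "2 * (\<bar>z l\<bar> / 2) * (2 * \<bar>z0 l\<bar>) \<le> (\<bar>z l\<bar> / 2)\<^sup>2 + (2 * \<bar>z0 l\<bar>)\<^sup>2" by (rule sum_squares_bound)
        then have f1: "2 * (\<bar>z l\<bar> * \<bar>z0 l\<bar>) \<le> (z l)\<^sup>2 / 4 + 4 * (z0 l)\<^sup>2" by (simp add: power_divide power_mult_distrib)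
        have f2: "2 * (\<bar>z l\<bar> * \<bar>z0 l\<bar>) \<le> (z l)\<^sup>2 + (z0 l)\<^sup>2"
          using sum_squares_bound[of "\<bar>z l\<bar>" "\<bar>z0 l\<bar>"] by simp
        have "3 * p \<le> q + 4 * r" if "2 * p \<le> q / 4 + 4 * r" "2 * p \<le> q + r" "0 \<le> q" "0 \<le> r" for p q r :: real
          using that by simp
        from this[OF f1 f2 zero_le_power2 zero_le_power2]
        show ?thesis by (simp add: power2_eq_square[of "z l", symmetric])
      qed
      finally show ?thesis .
    qed
    ultimately have "\<bar>grad R y z0 (s k) z\<bar> \<le> (\<Sum>j\<in>R. 1 * (\<bar>\<theta> j z\<bar> + \<bar>\<theta> j z0\<bar>)) + \<bar>2 * \<tau>\<bar> * (\<Sum>l\<in>J. 2 * (z l * z l) + 6 * (z0 l)\<^sup>2)"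
      unfolding grad_def
      by (intro order_trans[OF abs_triangle_ineq] add_mono order_trans[OF sum_abs] sum_mono)
        (auto simp: abs_mult intro!: mult_left_mono order_trans[OF sum_abs] sum_mono,
         unfold sum.distrib[symmetric], rule sum_mono, blast)
    then show ?thesis using \<tau> by (simp add: B_def)
  qed
  have lik_lim: "(\<lambda>k. lik b (c + s k * d)) \<longlonglongrightarrow> lik b (c + 1 * d)" for b c d
  proof -
    have "isCont sg u" for u using continuous_on_sg[OF continuous_on_id, of UNIV] by (simp add: continuous_on_eq_continuous_at)
    then show ?thesis unfolding lik_def by (intro isCont_tendsto_compose[of _ sg] tendsto_intros slim)
  qed
  have "(\<lambda>k. LINT z|P. wt R y z * grad R y z0 (s k) z) \<longlonglongrightarrow> (LINT z|P. wt R y z * grad R y z0 1 z)"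
  proof (rule integral_dominated_convergence[of _ _ _ "\<lambda>z. wt R y z * B z"])
    show "integrable P (\<lambda>z. wt R y z * B z)" by (rule tame_integrable[OF B])
    show "AE z in P. (\<lambda>k. wt R y z * grad R y z0 (s k) z) \<longlonglongrightarrow> wt R y z * grad R y z0 1 z"
      unfolding grad_def by (intro AE_I2 tendsto_intros slim lik_lim)
    show "AE z in P. norm (wt R y z * grad R y z0 (s k) z) \<le> wt R y z * B z" for k
      using le wt_pos by (intro AE_I2) (simp add: abs_mult less_imp_le)
  qed (auto intro!: borel_measurable_times tame_grad[unfolded tame_def, THEN conjunct1])
  then have "(\<lambda>k. E R y (grad R y z0 (s k))) \<longlonglongrightarrow> E R y (grad R y z0 1)"
    unfolding E_def by (intro tendsto_divide tendsto_const) (use Z_pos[of R y] in auto)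
  moreover have "(\<lambda>k. card J / s k) \<longlonglongrightarrow> card J / 1" by (intro tendsto_intros slim) auto
  ultimately show ?thesis
    using E_grad_le[OF R s] by (intro LIMSEQ_le[of _ _ "\<lambda>k. card J / s k"]) auto
qed

text \<open>Convexity bounds the excess of the regularized loss at \<open>z\<close> over that at
  \<open>z0\<close> by \<open>grad\<close> at \<open>s = 1\<close>, and the mean of the latter is at
  most the dimension. As \<open>z0\<close> is arbitrary, it may later depend on the labels.\<close>

lemma E_loss_le:
  assumes R: "finite R"
  shows "E R y (\<lambda>z. \<Sum>j\<in>R. - ln (lik (y j) (\<theta> j z))) \<le> (\<Sum>j\<in>R. - ln (lik (y j) (\<theta> j z0))) + \<tau> * sq z0 + card J"
proof -
  let ?c = "(\<Sum>j\<in>R. - ln (lik (y j) (\<theta> j z0))) + \<tau> * sq z0"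
  have tame_loss: "tame (\<lambda>z. \<Sum>j\<in>R. - ln (lik (y j) (\<theta> j z)))"
    by (intro tame_sum tame_neg tame_ln_lik)
  have "(\<Sum>j\<in>R. - ln (lik (y j) (\<theta> j z))) - ?c \<le> grad R y z0 1 z" for z
  proof -
    have "- ln (lik (y j) (\<theta> j z)) - - ln (lik (y j) (\<theta> j z0)) \<le> - (sign (y j) * (1 - lik (y j) (\<theta> j z))) * (\<theta> j z - \<theta> j z0)" for j
      using ln_sg_tangent[of "sign (y j) * \<theta> j z0" "sign (y j) * \<theta> j z"] by (simp add: lik_def algebra_simps)
    then have "(\<Sum>j\<in>R. - ln (lik (y j) (\<theta> j z))) - (\<Sum>j\<in>R. - ln (lik (y j) (\<theta> j z0))) \<le> (\<Sum>j\<in>R. - (sign (y j) * (1 - lik (y j) (\<theta> j z))) * (\<theta> j z - \<theta> j z0))"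
      unfolding sum_subtractf[symmetric] by (rule sum_mono)
    moreover have "grad R y z0 1 z = (\<Sum>j\<in>R. - (sign (y j) * (1 - lik (y j) (\<theta> j z))) * (\<theta> j z - \<theta> j z0)) + 2 * \<tau> * (\<Sum>l\<in>J. z l * (z l - z0 l))"
      by (simp add: grad_def)
    moreover have "- (\<tau> * sq z0) \<le> 2 * \<tau> * (\<Sum>l\<in>J. z l * (z l - z0 l))"
    proof -
      have "- (z0 l)\<^sup>2 \<le> 2 * (z l * (z l - z0 l))" for l
      proof -
        have "2 * (z l * (z l - z0 l)) + (z0 l)\<^sup>2 = (z l)\<^sup>2 + (z l - z0 l)\<^sup>2" by Groebner_Basis.algebra
        then show ?thesis by (smt (verit) zero_le_power2)
      qed
      then have "(\<Sum>l\<in>J. - (z0 l)\<^sup>2) \<le> (\<Sum>l\<in>J. 2 * (z l * (z l - z0 l)))" by (rule sum_mono)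
      then have "\<tau> * (\<Sum>l\<in>J. - (z0 l)\<^sup>2) \<le> \<tau> * (\<Sum>l\<in>J. 2 * (z l * (z l - z0 l)))" using \<tau> by (intro mult_left_mono) auto
      then show ?thesis by (simp add: sq_def sum_negf sum_distrib_left mult_ac)
    qed
    ultimately show ?thesis by linarith
  qed
  then have "E R y (\<lambda>z. (\<Sum>j\<in>R. - ln (lik (y j) (\<theta> j z))) - ?c) \<le> E R y (grad R y z0 1)"
    by (intro E_mono tame_diff tame_const tame_grad tame_loss)
  also have "\<dots> \<le> card J" by (rule E_grad_le_card[OF R])
  also have "E R y (\<lambda>z. (\<Sum>j\<in>R. - ln (lik (y j) (\<theta> j z))) - ?c) = E R y (\<lambda>z. \<Sum>j\<in>R. - ln (lik (y j) (\<theta> j z))) - ?c"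
    using E_diff[OF tame_loss tame_const] by (simp add: E_const)
  finally show ?thesis by simp
qed

definition "cov R y j = E R y (\<lambda>z. sg (\<theta> j z) * \<theta> j z) - E R y (\<lambda>z. sg (\<theta> j z)) * E R y (\<theta> j)"

lemma tame_sg: "tame (\<lambda>z. sg (\<theta> j z))" "tame (\<lambda>z. sg (\<theta> j z) * \<theta> j z)"
proof -
  have b: "\<bar>sg (\<theta> j z)\<bar> \<le> 1" for z using sg_pos[of "\<theta> j z"] sg_less_1[of "\<theta> j z"] by simp
  show "tame (\<lambda>z. sg (\<theta> j z) * \<theta> j z)" by (rule tame_mult_bounded[OF tame_\<theta> _ b]) measurable
  show "tame (\<lambda>z. sg (\<theta> j z))" using tame_mult_bounded[OF tame_const[of 1] _ b] by simp
qed

lemma cov_centered: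
  "E R y (\<lambda>z. (sg (\<theta> j z) - c) * (\<theta> j z - E R y (\<theta> j))) = cov R y j"
proof -
  define m where "m = E R y (\<theta> j)"
  have 0: "E R y (\<lambda>z. \<theta> j z - m) = 0" by (simp add: E_diff tame_\<theta> tame_const E_const m_def)
  have "(\<lambda>z. (sg (\<theta> j z) - c) * (\<theta> j z - m)) = (\<lambda>z. (sg (\<theta> j z) * \<theta> j z - m * sg (\<theta> j z)) - c * (\<theta> j z - m))"
    by (auto simp: fun_eq_iff algebra_simps)
  then have "E R y (\<lambda>z. (sg (\<theta> j z) - c) * (\<theta> j z - m)) = E R y (\<lambda>z. sg (\<theta> j z) * \<theta> j z) - m * E R y (\<lambda>z. sg (\<theta> j z))"
    by (simp only: E_diff E_cmult 0 tame_sg tame_cmult tame_diff tame_\<theta> tame_const mult_zero_right diff_zero)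
  then show ?thesis by (simp add: cov_def m_def mult.commute)
qed

lemma E_nonneg: "(\<And>z. 0 \<le> f z) \<Longrightarrow> 0 \<le> E R y f"
  unfolding E_def using wt_pos Z_pos[of R y]
  by (intro divide_nonneg_pos Bochner_Integration.integral_nonneg mult_nonneg_nonneg) (auto simp: less_imp_le)

lemma cov_nonneg: "0 \<le> cov R y j"
proof -
  let ?m = "E R y (\<theta> j)"
  have "0 \<le> (sg (\<theta> j z) - sg ?m) * (\<theta> j z - ?m)" for z
    using sg_mono[of "\<theta> j z" ?m] sg_mono[of ?m "\<theta> j z"]
    by (cases "\<theta> j z \<le> ?m") (auto intro: mult_nonneg_nonneg mult_nonpos_nonpos)
  then have "0 \<le> E R y (\<lambda>z. (sg (\<theta> j z) - sg ?m) * (\<theta> j z - ?m))" by (rule E_nonneg)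
  then show ?thesis by (simp add: cov_centered)
qed

text \<open>\<open>E_grad_le_card\<close> centered at the posterior mean \<open>m\<close>: the
  labels are constants and drop out of the centered products, and the prior contributes variances,
  which are nonnegative.\<close>

lemma sum_cov_le:
  assumes R: "finite R"
  shows "(\<Sum>j\<in>R. cov R y j) \<le> card J"
proof -
  define m where "m l = E R y (\<lambda>z. z l)" for l
  have \<theta>m: "\<theta> j m = E R y (\<theta> j)" for j
    unfolding \<theta>_def[abs_def] m_def by (simp add: E_sum E_cmult tame_cmult tame_component)
  have "- (sign (y j) * (1 - lik (y j) t)) = sg t - of_bool (y j)" for j t
    by (auto simp: sign_def lik_def sg_minus)
  then have g: "grad R y m 1 z = (\<Sum>j\<in>R. (sg (\<theta> j z) - of_bool (y j)) * (\<theta> j z - E R y (\<theta> j))) + 2 * \<tau> * (\<Sum>l\<in>J. z l * z l - m l * z l)" for z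
    unfolding grad_def \<theta>m by (simp add: right_diff_distrib mult.commute)
  have t1: "tame (\<lambda>z. (sg (\<theta> j z) - of_bool (y j)) * (\<theta> j z - E R y (\<theta> j)))" for j
  proof (rule tame_mult_bounded[of _ _ 1])
    show "\<bar>sg (\<theta> j z) - of_bool (y j)\<bar> \<le> 1" for z using sg_pos[of "\<theta> j z"] sg_less_1[of "\<theta> j z"] by (auto simp: of_bool_def)
  qed (intro tame_diff tame_\<theta> tame_const, measurable)
  have t2: "tame (\<lambda>z. z l * z l - m l * z l)" if "l \<in> J" for l
    using that by (intro tame_diff tame_cmult tame_prod tame_component)
  have "E R y (grad R y m 1) = (\<Sum>j\<in>R. cov R y j) + 2 * \<tau> * (\<Sum>l\<in>J. E R y (\<lambda>z. z l * z l - m l * z l))"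
    unfolding g[abs_def] using t1 t2 by (simp add: E_add E_cmult E_sum tame_sum tame_cmult cov_centered)
  moreover have "0 \<le> E R y (\<lambda>z. z l * z l - m l * z l)" if l: "l \<in> J" for l
  proof -
    have "0 \<le> E R y (\<lambda>z. (z l - m l)\<^sup>2)" by (rule E_nonneg) simp
    also have "(\<lambda>z. (z l - m l)\<^sup>2) = (\<lambda>z. (z l * z l - m l * z l) - m l * (z l - m l))"
      by (auto simp: fun_eq_iff power2_eq_square algebra_simps)
    also have "E R y \<dots> = E R y (\<lambda>z. z l * z l - m l * z l) - m l * (E R y (\<lambda>z. z l) - m l)"
      using l t2 by (simp add: E_diff E_cmult tame_cmult tame_diff tame_component tame_const E_const)
    finally show ?thesis by (simp add: m_def)
  qed
  then have "0 \<le> 2 * \<tau> * (\<Sum>l\<in>J. E R y (\<lambda>z. z l * z l - m l * z l))" using \<tau> by (intro mult_nonneg_nonneg sum_nonneg) auto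
  ultimately show ?thesis using E_grad_le_card[OF R, of y m] by linarith
qed

text \<open>Predictive probability of the label \<open>y j\<close> under the posterior given the
  remaining rows.\<close>

definition "pred R y j = Z R y / Z (R - {j}) y"

text \<open>The moment inequality for the posterior without row \<open>j\<close>. Tilting it by the
  likelihood of that row gives the posterior with it, so \<open>S 1 / S 0\<close> is
  \<open>pred\<close> and \<open>S 2 / S 1\<close> is the mean likelihood.\<close>

lemma E_lik_le:
  assumes R: "finite R" "j \<in> R" and w: "w j i0 \<noteq> 0"
  shows "E R y (\<lambda>z. lik (y j) (\<theta> j z)) - pred R y j \<le> 2 * cov R y j"
proof -
  define R' where "R' = R - {j}"
  define a where "a z = sign (y j) * \<theta> j z" for z
  have wtR: "wt R y z = wt R' y z * sg (a z)" for z
    unfolding wt_def a_def R'_def using R prod.remove[of R j "\<lambda>j. lik (y j) (\<theta> j z)"] by (simp add: lik_def)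
  have a: "(\<Sum>l\<in>J. sign (y j) * w j l * z l) = a z" for z
    by (simp add: a_def \<theta>_def sum_distrib_left mult.assoc)
  have L: "lik (y j) (\<theta> j z) = sg (a z)" for z by (simp add: lik_def a_def)
  define u where "u = E R y (\<lambda>z. sg (a z))"
  have I: "(LINT z|P. wt R' y z * sg (a z) ^ 0) = Z R' y" "(LINT z|P. wt R' y z * sg (a z) ^ 1) = Z R y"
    "(LINT z|P. wt R' y z * sg (a z) ^ 2) = Z R y * u"
    using Z_pos[of R y] by (simp_all add: Z_def[symmetric] wtR[symmetric] u_def E_def power2_eq_square mult.assoc[symmetric])
  have K: "(LINT z|P. wt R' y z * (sg (a z) ^ 1 * a z)) = Z R y * E R y a"
    "(LINT z|P. wt R' y z * (sg (a z) ^ 2 * a z)) = Z R y * E R y (\<lambda>z. sg (a z) * a z)"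
    using Z_pos[of R y] by (simp_all add: E_def wtR power2_eq_square mult.assoc)
  have "Z R' y * Z R y * (Z R y * u) - Z R y ^ 3 \<le> 2 * Z R' y * (Z R y * (Z R y * E R y (\<lambda>z. sg (a z) * a z)) - Z R y * u * (Z R y * E R y a))"
    using lcg_logistic_moment_inequality[OF finJ i0 \<tau> lcg_wt[of R' y], of "\<lambda>l. sign (y j) * w j l"] w sign_sq(2)
    unfolding a I K by simp
  then have "u - Z R y / Z R' y \<le> 2 * (E R y (\<lambda>z. sg (a z) * a z) - u * E R y a)"
  proof -
    have "u - p / q \<le> 2 * (x - u * e)"
      if "0 < p" "0 < q" "q * p * (p * u) - p ^ 3 \<le> 2 * q * (p * (p * x) - p * u * (p * e))" for p q x e :: real
    proof -
      have "(q * p\<^sup>2) * (u - p / q) = q * p * (p * u) - p ^ 3"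
        using that by (simp add: right_diff_distrib power2_eq_square power3_eq_cube)
      also have "\<dots> \<le> 2 * q * (p * (p * x) - p * u * (p * e))" by fact
      also have "\<dots> = (q * p\<^sup>2) * (2 * (x - u * e))" by Groebner_Basis.algebra
      finally show ?thesis using that by (simp only: mult_le_cancel_left_pos mult_pos_pos zero_less_power)
    qed
    from this[OF Z_pos Z_pos] show ?thesis
      using \<open>Z R' y * Z R y * (Z R y * u) - Z R y ^ 3 \<le> _\<close> by blast
  qed
  \<comment> \<open>For the label 0 both \<open>\<theta>\<close> and \<open>sg - 1/2\<close> change
    sign, which leaves the covariance unchanged.\<close>
  also have "E R y (\<lambda>z. sg (a z) * a z) - u * E R y a = cov R y j"
  proof (cases "y j")
    case True
    then show ?thesis by (simp add: a_def[abs_def] u_def cov_def sign_def)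
  next
    case False
    have e1: "E R y (\<lambda>z. sg (a z) * a z) = E R y (\<lambda>z. sg (\<theta> j z) * \<theta> j z - \<theta> j z)"
      using False by (simp add: a_def sign_def sg_minus algebra_simps)
    have e2: "u = 1 - E R y (\<lambda>z. sg (\<theta> j z))"
      using False by (simp add: u_def a_def sign_def sg_minus E_diff tame_const tame_sg E_const)
    have e3: "E R y a = - E R y (\<theta> j)"
      using False E_cmult[of R y "- 1" "\<theta> j"] by (simp add: a_def[abs_def] sign_def)
    have e4: "E R y (\<lambda>z. sg (\<theta> j z) * \<theta> j z - \<theta> j z) = E R y (\<lambda>z. sg (\<theta> j z) * \<theta> j z) - E R y (\<theta> j)"
      by (rule E_diff[OF tame_sg(2) tame_\<theta>])
    show ?thesis unfolding cov_def e1 e2 e3 e4 by (simp add: left_diff_distrib)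
  qed
  finally show ?thesis by (simp add: u_def L pred_def R'_def)
qed

text \<open>AM-GM and Jensen work for \<open>L\<close>, the mean likelihood under the posterior that
  has already seen the row, whereas the code uses \<open>pred\<close>. Passing from one to the other
  costs \<open>2 * cov\<close> divided by \<open>\<kappa> * f\<close>, the floor which the admixture
  of \<open>f\<close> guarantees.\<close>

lemma row_code_length:
  assumes R: "finite R" "j \<in> R" and w: "w j i0 \<noteq> 0" and \<kappa>: "0 < \<kappa>" "\<kappa> < 1" and f: "0 < f"
  shows "- ln ((1 - \<kappa>) * pred R y j + \<kappa> * f) \<le> (1 - \<kappa>) * E R y (\<lambda>z. - ln (lik (y j) (\<theta> j z))) - \<kappa> * ln f
    + (1 - \<kappa>) / (\<kappa> * f) * (2 * cov R y j)"
proof -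
  define L where "L = E R y (\<lambda>z. lik (y j) (\<theta> j z))"
  define q where "q = pred R y j"
  define A where "A = (1 - \<kappa>) * L + \<kappa> * f"
  define B where "B = (1 - \<kappa>) * q + \<kappa> * f"
  have tl: "tame (\<lambda>z. lik (y j) (\<theta> j z))"
  proof -
    have "\<bar>lik (y j) (\<theta> j z)\<bar> \<le> 1" for z using lik_pos[of "y j" "\<theta> j z"] by simp
    from tame_mult_bounded[OF tame_const[of 1] _ this] show ?thesis by simp
  qed
  have q: "0 < q" using Z_pos by (simp add: q_def pred_def)
  have "0 < L"
  proof -
    have "0 \<le> L" unfolding L_def by (rule E_nonneg) (simp add: lik_pos less_imp_le)
    moreover have "L \<noteq> 0"
    proof
      assume "L = 0"
      then have "(LINT z|P. wt R y z * lik (y j) (\<theta> j z)) = 0" using Z_pos[of R y] by (simp add: L_def E_def)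
      then have "AE z in P. wt R y z * lik (y j) (\<theta> j z) = 0"
        using tame_integrable[OF tl] wt_pos lik_pos
        by (subst (asm) integral_nonneg_eq_0_iff_AE) (auto simp: less_imp_le)
      then have "AE z in P. wt R y z = 0"
        by (rule AE_mp) (use lik_pos in \<open>auto simp: less_le\<close>)
      then have "Z R y = 0" unfolding Z_def by (rule integral_eq_zero_AE)
      then show False using Z_pos[of R y] by simp
    qed
    ultimately show ?thesis by simp
  qed
  note L = this
  have A: "0 < A" and B: "0 < B" "\<kappa> * f \<le> B"
    using \<kappa> f L q by (auto simp: A_def B_def intro!: add_pos_pos)
  have "ln (L powr (1 - \<kappa>) * f powr \<kappa>) \<le> ln A"
    unfolding A_def using weighted_am_gm[OF L f \<kappa>] L f A by (subst ln_le_cancel_iff) (auto simp: A_def)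
  then have lnA: "- ln A \<le> (1 - \<kappa>) * (- ln L) - \<kappa> * ln f"
    using L f by (simp add: ln_mult_pos ln_powr)
  have jensen: "- ln L \<le> E R y (\<lambda>z. - ln (lik (y j) (\<theta> j z)))"
  proof -
    have "E R y (\<lambda>z. ln (lik (y j) (\<theta> j z))) \<le> E R y (\<lambda>z. (1 / L) * lik (y j) (\<theta> j z) + (ln L - 1))"
    proof (rule E_mono)
      fix z
      have "ln (lik (y j) (\<theta> j z) / L) \<le> lik (y j) (\<theta> j z) / L - 1"
        using lik_pos L by (intro ln_le_minus_one) auto
      then show "ln (lik (y j) (\<theta> j z)) \<le> (1 / L) * lik (y j) (\<theta> j z) + (ln L - 1)"
        using lik_pos[of "y j" "\<theta> j z"] L by (simp add: ln_div)
    qed (intro tame_ln_lik tame_add tame_cmult tl tame_const)+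
    also have "\<dots> = (1 / L) * L + (ln L - 1)"
      by (simp only: E_add[OF tame_cmult[OF tl] tame_const] E_cmult E_const L_def[symmetric])
    also have "\<dots> = ln L" using L by simp
    finally show ?thesis using E_cmult[of R y "- 1" "\<lambda>z. ln (lik (y j) (\<theta> j z))"] by simp
  qed
  have "ln (A / B) \<le> A / B - 1" using A B by (intro ln_le_minus_one) auto
  also have "A / B - 1 = (1 - \<kappa>) * (L - q) / B" using B by (simp add: A_def B_def field_simps)
  also have "\<dots> \<le> (1 - \<kappa>) * (2 * cov R y j) / B"
    using E_lik_le[OF R w, of y] \<kappa> B by (intro divide_right_mono mult_left_mono) (auto simp: L_def q_def)
  also have "\<dots> \<le> (1 - \<kappa>) * (2 * cov R y j) / (\<kappa> * f)"
    using \<kappa> f B cov_nonneg[of R y j] by (intro divide_left_mono mult_nonneg_nonneg mult_pos_pos) auto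
  finally have "ln A - ln B \<le> (1 - \<kappa>) / (\<kappa> * f) * (2 * cov R y j)" using A B by (simp add: ln_div)
  moreover have "(1 - \<kappa>) * (- ln L) \<le> (1 - \<kappa>) * E R y (\<lambda>z. - ln (lik (y j) (\<theta> j z)))"
    using \<kappa> jensen by (intro mult_left_mono) auto
  ultimately show ?thesis using lnA by (simp add: B_def[symmetric] q_def[symmetric])
qed

theorem sum_row_code_length:
  assumes R: "finite R" and w: "\<And>j. j \<in> R \<Longrightarrow> w j i0 \<noteq> 0" and \<kappa>: "0 < \<kappa>" "\<kappa> < 1"
    and \<delta>: "0 < \<delta>" and f: "\<And>j. j \<in> R \<Longrightarrow> \<delta> \<le> f j"
  shows "(\<Sum>j\<in>R. - ln ((1 - \<kappa>) * pred R y j + \<kappa> * f j)) \<le>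
    (1 - \<kappa>) * ((\<Sum>j\<in>R. - ln (lik (y j) (\<theta> j z0))) + \<tau> * sq z0 + card J) + \<kappa> * (\<Sum>j\<in>R. - ln (f j))
    + 2 * (1 - \<kappa>) / (\<kappa> * \<delta>) * card J"
proof -
  have "(\<Sum>j\<in>R. - ln ((1 - \<kappa>) * pred R y j + \<kappa> * f j)) \<le>
      (\<Sum>j\<in>R. (1 - \<kappa>) * E R y (\<lambda>z. - ln (lik (y j) (\<theta> j z))) + \<kappa> * (- ln (f j)) + 2 * (1 - \<kappa>) / (\<kappa> * \<delta>) * cov R y j)"
  proof (rule sum_mono)
    fix j assume j: "j \<in> R"
    have f0: "0 < f j" using f[OF j] \<delta> by simp
    have "- ln ((1 - \<kappa>) * pred R y j + \<kappa> * f j) \<le> (1 - \<kappa>) * E R y (\<lambda>z. - ln (lik (y j) (\<theta> j z))) - \<kappa> * ln (f j)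
        + (1 - \<kappa>) / (\<kappa> * f j) * (2 * cov R y j)"
      by (rule row_code_length[OF R j w[OF j] \<kappa> f0])
    also have "(1 - \<kappa>) / (\<kappa> * f j) * (2 * cov R y j) \<le> (1 - \<kappa>) / (\<kappa> * \<delta>) * (2 * cov R y j)"
      using \<kappa> \<delta> f[OF j] cov_nonneg[of R y j] f0 by (intro mult_right_mono divide_left_mono mult_left_mono mult_pos_pos) auto
    also have "(1 - \<kappa>) / (\<kappa> * \<delta>) * (2 * cov R y j) = 2 * (1 - \<kappa>) / (\<kappa> * \<delta>) * cov R y j" by simp
    finally show "- ln ((1 - \<kappa>) * pred R y j + \<kappa> * f j) \<le> (1 - \<kappa>) * E R y (\<lambda>z. - ln (lik (y j) (\<theta> j z))) + \<kappa> * (- ln (f j)) + 2 * (1 - \<kappa>) / (\<kappa> * \<delta>) * cov R y j"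
      by simp
  qed
  also have "\<dots> = (1 - \<kappa>) * E R y (\<lambda>z. \<Sum>j\<in>R. - ln (lik (y j) (\<theta> j z))) + \<kappa> * (\<Sum>j\<in>R. - ln (f j))
      + 2 * (1 - \<kappa>) / (\<kappa> * \<delta>) * (\<Sum>j\<in>R. cov R y j)"
  proof -
    have "tame (\<lambda>z. - ln (lik (y j) (\<theta> j z)))" for j using tame_cmult[OF tame_ln_lik, of "- 1"] by simp
    then have "E R y (\<lambda>z. \<Sum>j\<in>R. - ln (lik (y j) (\<theta> j z))) = (\<Sum>j\<in>R. E R y (\<lambda>z. - ln (lik (y j) (\<theta> j z))))"
      by (rule E_sum)
    then show ?thesis by (simp only: sum.distrib sum_distrib_left)
  qed
  also have "\<dots> \<le> (1 - \<kappa>) * ((\<Sum>j\<in>R. - ln (lik (y j) (\<theta> j z0))) + \<tau> * sq z0 + card J) + \<kappa> * (\<Sum>j\<in>R. - ln (f j))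
      + 2 * (1 - \<kappa>) / (\<kappa> * \<delta>) * card J"
    using \<kappa> \<delta> E_loss_le[OF R, of y z0] sum_cov_le[OF R, of y]
    by (intro add_mono mult_left_mono order_refl) auto
  finally show ?thesis .
qed

end

section \<open>Random-order prediction codes\<close>

lemma neg_ln_mean_le:
  fixes t :: "'a \<Rightarrow> real"
  assumes R: "finite R" "R \<noteq> {}" and t: "\<And>j. j \<in> R \<Longrightarrow> 0 < t j"
  shows "- ln ((\<Sum>j\<in>R. t j) / card R) \<le> (\<Sum>j\<in>R. - ln (t j)) / card R"
proof -
  define A where "A = (\<Sum>j\<in>R. t j) / card R"
  have N: "0 < real (card R)" using R by (simp add: card_gt_0_iff)
  have A: "0 < A" unfolding A_def using N R t by (intro divide_pos_pos sum_pos) auto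
  have "(\<Sum>j\<in>R. ln (t j) - ln A) \<le> (\<Sum>j\<in>R. t j / A - 1)"
  proof (rule sum_mono)
    fix j assume "j \<in> R"
    then have "0 < t j" by (rule t)
    then show "ln (t j) - ln A \<le> t j / A - 1"
      using ln_le_minus_one[of "t j / A"] A by (simp add: ln_div)
  qed
  also have "\<dots> = 0" using A N by (simp add: sum_subtractf sum_divide_distrib[symmetric]) (auto simp: A_def)
  finally have "(\<Sum>j\<in>R. ln (t j)) \<le> card R * ln A" by (simp add: sum_subtractf)
  then show ?thesis using N unfolding A_def[symmetric] by (simp add: sum_negf field_simps)
qed

lemma sum_Pow_insert:
  assumes "finite R" "j \<notin> R"
  shows "(\<Sum>S\<in>Pow (insert j R). g S) = (\<Sum>S\<in>Pow R. g S + g (insert j S))"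
proof -
  have "Pow R \<inter> insert j ` Pow R = {}" using assms by auto
  moreover have "inj_on (insert j) (Pow R)" using assms by (auto simp: inj_on_def)
  ultimately show ?thesis
    using assms by (simp add: Pow_insert sum.union_disjoint sum.reindex sum.distrib)
qed

definition coin :: "(nat \<Rightarrow> real) \<Rightarrow> nat \<Rightarrow> bool \<Rightarrow> real" where
  "coin p j b = (if b then p j else 1 - p j)"

context logistic_family
begin

text \<open>
  The code: a random ordering of the rows, the first \<open>m\<close> of them coded by the truth \<open>p\<close> and every
  later one by a mixture of the truth with the prediction of the posterior given the rows before it.
\<close>
primrec Q :: "real \<Rightarrow> (nat \<Rightarrow> real) \<Rightarrow> nat \<Rightarrow> nat \<Rightarrow> nat set \<Rightarrow> (nat \<Rightarrow> bool) \<Rightarrow> real" where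
  "Q \<kappa> p m 0 R y = 1"
| "Q \<kappa> p m (Suc k) R y = (if Suc k \<le> m then \<Prod>j\<in>R. coin p j (y j)
     else (\<Sum>j\<in>R. Q \<kappa> p m k (R - {j}) y * ((1 - \<kappa>) * pred R y j + \<kappa> * coin p j (y j))) / Suc k)"

lemma Z_cong: "(\<And>j. j \<in> R \<Longrightarrow> y j = y' j) \<Longrightarrow> Z R y = Z R y'"
  unfolding Z_def wt_def by (intro Bochner_Integration.integral_cong refl) (auto intro!: prod.cong)

lemma Q_cong: "(\<And>j. j \<in> R \<Longrightarrow> y j = y' j) \<Longrightarrow> Q \<kappa> p m k R y = Q \<kappa> p m k R y'"
proof (induction k arbitrary: R)
  case (Suc k)
  have "Q \<kappa> p m k (R - {j}) y = Q \<kappa> p m k (R - {j}) y'" for j using Suc.prems by (intro Suc.IH) auto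
  moreover have "pred R y j = pred R y' j" for j
    unfolding pred_def using Z_cong[of R y y'] Z_cong[of "R - {j}" y y'] Suc.prems by simp
  ultimately show ?case using Suc.prems by (auto intro!: prod.cong sum.cong)
qed simp

lemma sum_Z:
  assumes R: "finite R" "j \<in> R"
  shows "Z R (y(j := True)) + Z R (y(j := False)) = Z (R - {j}) y"
proof -
  have "wt R (y(j := b)) z = wt (R - {j}) y z * lik b (\<theta> j z)" for b z
  proof -
    have "(\<Prod>i\<in>R - {j}. lik ((y(j := b)) i) (\<theta> i z)) = (\<Prod>i\<in>R - {j}. lik (y i) (\<theta> i z))"
      by (intro prod.cong) auto
    then show ?thesis unfolding wt_def using R prod.remove[of R j "\<lambda>i. lik ((y(j := b)) i) (\<theta> i z)"] by simp
  qed
  moreover have "lik True t + lik False t = 1" for t by (simp add: lik_def sign_def sg_minus)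
  ultimately have "wt R (y(j := True)) z + wt R (y(j := False)) z = wt (R - {j}) y z" for z
    by (metis distrib_left mult.right_neutral)
  then show ?thesis
    unfolding Z_def using Bochner_Integration.integral_add[OF wt_integrable wt_integrable, of R "y(j := True)" R "y(j := False)"]
    by simp
qed

lemma sum_pred:
  assumes R: "finite R" "j \<in> R"
  shows "pred R (y(j := True)) j + pred R (y(j := False)) j = 1"
proof -
  have "Z (R - {j}) (y(j := b)) = Z (R - {j}) y" for b by (rule Z_cong) auto
  then show ?thesis using sum_Z[OF R, of y] Z_pos[of "R - {j}" y]
    by (simp add: pred_def add_divide_distrib[symmetric])
qed

text \<open>The predictions of the two labels of the last row add up to 1, so summing over its label
  leaves the code of \<open>R - {j}\<close>.\<close>

lemma sum_Q:
  assumes "finite R" "card R = k"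
  shows "(\<Sum>S\<in>Pow R. Q \<kappa> p m k R (\<lambda>i. i \<in> S)) = 1"
  using assms
proof (induction k arbitrary: R)
  case (Suc k)
  show ?case
  proof (cases "Suc k \<le> m")
    case True
    have "(\<Sum>S\<in>Pow R. \<Prod>j\<in>R. coin p j (j \<in> S)) = 1"
      using Suc.prems(1)
    proof (induction R rule: finite_induct)
      case (insert j R)
      have "(\<Prod>i\<in>R. coin p i (i \<in> insert j S)) = (\<Prod>i\<in>R. coin p i (i \<in> S))" for S
      proof (rule prod.cong[OF refl])
        fix i assume "i \<in> R"
        then have "i \<noteq> j" using insert.hyps by auto
        then show "coin p i (i \<in> insert j S) = coin p i (i \<in> S)" by simp
      qed
      then have "(\<Prod>i\<in>insert j R. coin p i (i \<in> S)) + (\<Prod>i\<in>insert j R. coin p i (i \<in> insert j S)) = (\<Prod>i\<in>R. coin p i (i \<in> S))"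
        if "S \<in> Pow R" for S
      proof -
        have "j \<notin> S" using that insert.hyps by auto
        then show ?thesis using insert.hyps \<open>(\<Prod>i\<in>R. coin p i (i \<in> insert j S)) = _\<close>
          by (simp add: distrib_right[symmetric]) (simp add: coin_def)
      qed
      then show ?case using insert by (simp only: sum_Pow_insert[OF insert.hyps] cong: sum.cong)
    qed simp
    then show ?thesis using True by simp
  next
    case False
    have "(\<Sum>S\<in>Pow R. Q \<kappa> p m k (R - {j}) (\<lambda>i. i \<in> S) * ((1 - \<kappa>) * pred R (\<lambda>i. i \<in> S) j + \<kappa> * coin p j (j \<in> S))) = 1"
      if j: "j \<in> R" for j
    proof -
      define R' where "R' = R - {j}"
      have R': "finite R'" "j \<notin> R'" "R = insert j R'" "card R' = k" using Suc.prems j by (auto simp: R'_def)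
      let ?g = "\<lambda>S. Q \<kappa> p m k R' (\<lambda>i. i \<in> S) * ((1 - \<kappa>) * pred R (\<lambda>i. i \<in> S) j + \<kappa> * coin p j (j \<in> S))"
      have "?g S + ?g (insert j S) = Q \<kappa> p m k R' (\<lambda>i. i \<in> S)" if S: "S \<in> Pow R'" for S
      proof -
        define y where "y = (\<lambda>i. i \<in> S)"
        have jS: "j \<notin> S" using S R' by auto
        have y: "y = y(j := False)" "(\<lambda>i. i \<in> insert j S) = y(j := True)" using jS by (auto simp: fun_eq_iff y_def)
        have q: "Q \<kappa> p m k R' (\<lambda>i. i \<in> insert j S) = Q \<kappa> p m k R' y" using R' by (intro Q_cong) (auto simp: y_def)
        have pr: "pred R (\<lambda>i. i \<in> insert j S) j = 1 - pred R y j"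
          using sum_pred[OF Suc.prems(1) j, of y] unfolding y(1)[symmetric] y(2)[symmetric] by simp
        show ?thesis unfolding q pr y_def[symmetric] using jS by (simp add: coin_def algebra_simps)
      qed
      then have "(\<Sum>S\<in>Pow R. ?g S) = (\<Sum>S\<in>Pow R'. Q \<kappa> p m k R' (\<lambda>i. i \<in> S))"
        unfolding R'(3) using R'(1,2) by (subst sum_Pow_insert) (auto intro!: sum.cong)
      also have "\<dots> = 1" by (rule Suc.IH) (use R' in auto)
      finally show ?thesis by (simp add: R'_def)
    qed
    then have "(\<Sum>j\<in>R. \<Sum>S\<in>Pow R. Q \<kappa> p m k (R - {j}) (\<lambda>i. i \<in> S) * ((1 - \<kappa>) * pred R (\<lambda>i. i \<in> S) j + \<kappa> * coin p j (j \<in> S))) = card R"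
      by simp
    then show ?thesis using False Suc.prems by (subst (asm) sum.swap) (simp add: sum_divide_distrib[symmetric])
  qed
qed simp

text \<open>Share of the model in the code: \<open>k - m\<close> of the \<open>k\<close> rows are
  coded by a mixture that gives weight \<open>1 - \<kappa>\<close> to the posterior
  prediction.\<close>

definition "alpha \<kappa> m k = (if k \<le> m then 0 else (1 - \<kappa>) * (1 - real m / real k))"

text \<open>Jensen over the choice of the last row: its mean cost is \<open>1/k\<close> of the total
  in \<open>sum_row_code_length\<close>, whence the harmonic sum. The first \<open>m\<close> rows
  are coded by the truth at no excess.\<close>

lemma code_length_le:
  assumes "finite R" "card R = k" and w: "\<And>j. j \<in> R \<Longrightarrow> w j i0 \<noteq> 0" and \<kappa>: "0 < \<kappa>" "\<kappa> < 1"
    and \<delta>: "0 < \<delta>" and p: "\<And>j. j \<in> R \<Longrightarrow> \<delta> \<le> p j \<and> p j \<le> 1 - \<delta>"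
  shows "0 < Q \<kappa> p m k R y \<and> - ln (Q \<kappa> p m k R y) \<le>
    alpha \<kappa> m k * (\<Sum>j\<in>R. - ln (lik (y j) (\<theta> j z0))) + (1 - alpha \<kappa> m k) * (\<Sum>j\<in>R. - ln (coin p j (y j)))
    + ((1 - \<kappa>) * (\<tau> * sq z0 + card J) + 2 * (1 - \<kappa>) / (\<kappa> * \<delta>) * card J) * (\<Sum>l\<in>{m<..k}. 1 / real l)"
  using assms(1,2) w p
proof (induction k arbitrary: R)
  case 0
  then show ?case by (simp add: alpha_def)
next
  case (Suc k)
  define x where "x j = - ln (lik (y j) (\<theta> j z0))" for j
  define xs where "xs j = - ln (coin p j (y j))" for j
  define c0 where "c0 = (1 - \<kappa>) * (\<tau> * sq z0 + card J) + 2 * (1 - \<kappa>) / (\<kappa> * \<delta>) * card J"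
  define r where "r j = (1 - \<kappa>) * pred R y j + \<kappa> * coin p j (y j)" for j
  have coin: "\<delta> \<le> coin p j (y j)" if "j \<in> R" for j using Suc.prems(4)[OF that] by (auto simp: coin_def)
  have R: "finite R" "R \<noteq> {}" using Suc.prems by auto
  show ?case
  proof (cases "Suc k \<le> m")
    case True
    have pos: "0 < coin p j (y j)" if "j \<in> R" for j using coin[OF that] \<delta> by simp
    then have "ln (\<Prod>j\<in>R. coin p j (y j)) = (\<Sum>j\<in>R. ln (coin p j (y j)))"
      using R by (intro ln_prod) (auto simp: less_imp_neq[symmetric])
    moreover have "{m<..Suc k} = {}" using True by auto
    ultimately show ?thesis using True pos by (auto simp: alpha_def sum_negf intro!: prod_pos)
  next
    case False
    define A where "A = (\<Sum>j\<in>R. x j)"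
    define B where "B = (\<Sum>j\<in>R. xs j)"
    define h where "h = (\<Sum>l\<in>{m<..k}. 1 / real l)"
    define a where "a = alpha \<kappa> m k"
    have r: "0 < r j" if "j \<in> R" for j
      unfolding r_def pred_def using coin[OF that] \<delta> \<kappa> Z_pos by (intro add_pos_pos mult_pos_pos divide_pos_pos) auto
    have rm: "(\<Sum>i\<in>R - {j}. g i) = (\<Sum>i\<in>R. g i) - g j" if "j \<in> R" for j and g :: "nat \<Rightarrow> real"
      using R that by (simp add: sum_diff1)
    have IH: "0 < Q \<kappa> p m k (R - {j}) y" "- ln (Q \<kappa> p m k (R - {j}) y) \<le> a * (A - x j) + (1 - a) * (B - xs j) + c0 * h" if j: "j \<in> R" for j
    proof -
      have "card (R - {j}) = k" using Suc.prems j by simp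
      from Suc.IH[OF _ this] Suc.prems
      have "0 < Q \<kappa> p m k (R - {j}) y \<and> - ln (Q \<kappa> p m k (R - {j}) y) \<le> a * (\<Sum>i\<in>R - {j}. x i) + (1 - a) * (\<Sum>i\<in>R - {j}. xs i) + c0 * h"
        by (simp add: x_def xs_def c0_def a_def h_def)
      then show "0 < Q \<kappa> p m k (R - {j}) y" "- ln (Q \<kappa> p m k (R - {j}) y) \<le> a * (A - x j) + (1 - a) * (B - xs j) + c0 * h"
        unfolding rm[OF j] A_def B_def by auto
    qed
    have Qs: "Q \<kappa> p m (Suc k) R y = (\<Sum>j\<in>R. Q \<kappa> p m k (R - {j}) y * r j) / card R"
      using False Suc.prems by (simp add: r_def)
    have N: "real (card R) = real k + 1" "0 < real k + 1" using Suc.prems by auto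
    have "- ln (Q \<kappa> p m (Suc k) R y) \<le> (\<Sum>j\<in>R. - ln (Q \<kappa> p m k (R - {j}) y * r j)) / card R"
      unfolding Qs using R IH(1) r by (intro neg_ln_mean_le) auto
    also have "(\<Sum>j\<in>R. - ln (Q \<kappa> p m k (R - {j}) y * r j)) \<le> (\<Sum>j\<in>R. (a * (A - x j) + (1 - a) * (B - xs j) + c0 * h) + - ln (r j))"
    proof (rule sum_mono)
      fix j assume j: "j \<in> R"
      show "- ln (Q \<kappa> p m k (R - {j}) y * r j) \<le> (a * (A - x j) + (1 - a) * (B - xs j) + c0 * h) + - ln (r j)"
        using IH[OF j] r[OF j] by (simp add: ln_mult_pos)
    qed
    also have "\<dots> = a * (k * A) + (1 - a) * (k * B) + (real k + 1) * (c0 * h) + (\<Sum>j\<in>R. - ln (r j))"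
    proof -
      have "(\<Sum>j\<in>R. A - x j) = k * A" "(\<Sum>j\<in>R. B - xs j) = k * B"
        unfolding sum_subtractf A_def[symmetric] B_def[symmetric] using N by (simp_all add: algebra_simps)
      then show ?thesis unfolding sum.distrib sum_distrib_left[symmetric] by (simp add: N(1))
    qed
    also have "(\<Sum>j\<in>R. - ln (r j)) \<le> (1 - \<kappa>) * A + \<kappa> * B + c0"
      using sum_row_code_length[OF R(1) Suc.prems(3) \<kappa> \<delta>, where y = y and ?z0.0 = z0 and f = "\<lambda>j. coin p j (y j)", OF _ coin]
      by (simp add: r_def A_def B_def x_def xs_def c0_def algebra_simps)
    finally have le: "- ln (Q \<kappa> p m (Suc k) R y) \<le>
        (a * (k * A) + (1 - a) * (k * B) + (real k + 1) * (c0 * h) + ((1 - \<kappa>) * A + \<kappa> * B + c0)) / (real k + 1)"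
      using N by (simp add: divide_right_mono)
    \<comment> \<open>\<open>k * alpha\<close> is linear in \<open>k\<close> from \<open>m\<close>
      on: each additional mixture-coded row adds \<open>1 - \<kappa>\<close>. This makes the
      recursion close.\<close>
    have ka: "real k * a = (1 - \<kappa>) * (real k - real m)"
    proof (cases "k = m")
      case True then show ?thesis by (simp add: a_def alpha_def)
    next
      case F: False
      then have "m < k" using False by simp
      then have "real k * (1 - real m / real k) = real k - real m" by (simp add: right_diff_distrib)
      then show ?thesis using \<open>m < k\<close> by (simp add: a_def alpha_def mult.left_commute[of "real k"])
    qed
    have a': "alpha \<kappa> m (Suc k) * (real k + 1) = (1 - \<kappa>) * (real k + 1 - real m)"
      using False by (simp add: alpha_def) (simp add: field_simps)
    have h': "(\<Sum>l\<in>{m<..Suc k}. 1 / real l) = h + 1 / (real k + 1)"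
    proof -
      have "{m<..Suc k} = insert (Suc k) {m<..k}" using False by auto
      then show ?thesis by (simp add: h_def add.commute)
    qed
    have "(a * (k * A) + (1 - a) * (k * B) + (real k + 1) * (c0 * h) + ((1 - \<kappa>) * A + \<kappa> * B + c0)) / (real k + 1)
        = alpha \<kappa> m (Suc k) * A + (1 - alpha \<kappa> m (Suc k)) * B + c0 * (h + 1 / (real k + 1))"
    proof -
      have eq: "a * (k * A) + (1 - a) * (k * B) + (real k + 1) * (c0 * h) + ((1 - \<kappa>) * A + \<kappa> * B + c0)
          = (alpha \<kappa> m (Suc k) * A + (1 - alpha \<kappa> m (Suc k)) * B + c0 * h) * (real k + 1) + c0"
        using ka a' by Groebner_Basis.algebra
      have "(P * (real k + 1) + c0) / (real k + 1) = P + c0 * (1 / (real k + 1))" for P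
        by (simp add: add_divide_distrib)
      then show ?thesis unfolding eq distrib_left by (simp only: add.assoc)
    qed
    moreover have "0 < Q \<kappa> p m (Suc k) R y"
      unfolding Qs using R IH(1) r N by (intro divide_pos_pos sum_pos mult_pos_pos) auto
    ultimately show ?thesis using le by (simp only: h' x_def[symmetric] xs_def[symmetric] A_def[symmetric] B_def[symmetric] c0_def[symmetric])
  qed
qed

text \<open>Exponentiated, the code length bound dominates each summand by
  \<open>exp ?C * Q\<close>. It holds for each label set separately, so \<open>z S\<close> may
  depend on \<open>S\<close>, and the sum is controlled because \<open>Q\<close> sums to 1, as in
  Kraft's inequality.\<close>

lemma likelihood_ratio_moment_tau:
  assumes R: "finite R" and w: "\<And>j. j \<in> R \<Longrightarrow> w j i0 \<noteq> 0" and \<kappa>: "0 < \<kappa>" "\<kappa> < 1"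
    and \<delta>: "0 < \<delta>" and p: "\<And>j. j \<in> R \<Longrightarrow> \<delta> \<le> p j \<and> p j \<le> 1 - \<delta>"
    and M: "\<And>S. S \<subseteq> R \<Longrightarrow> sq (z S) \<le> M"
  shows "(\<Sum>S\<in>Pow R. (\<Prod>j\<in>R. coin p j (j \<in> S)) *
      exp (alpha \<kappa> m (card R) * (\<Sum>j\<in>R. ln (lik (j \<in> S) (\<theta> j (z S))) - ln (coin p j (j \<in> S)))))
    \<le> exp (((1 - \<kappa>) * (\<tau> * M + card J) + 2 * (1 - \<kappa>) / (\<kappa> * \<delta>) * card J) * (\<Sum>l\<in>{m<..card R}. 1 / real l))"
    (is "?L \<le> exp ?C")
proof -
  define h where "h = (\<Sum>l\<in>{m<..card R}. 1 / real l)"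
  have h: "0 \<le> h" unfolding h_def by (intro sum_nonneg) auto
  let ?a = "alpha \<kappa> m (card R)"
  have "(\<Prod>j\<in>R. coin p j (j \<in> S)) * exp (?a * (\<Sum>j\<in>R. ln (lik (j \<in> S) (\<theta> j (z S))) - ln (coin p j (j \<in> S))))
      \<le> exp ?C * Q \<kappa> p m (card R) R (\<lambda>i. i \<in> S)" if S: "S \<in> Pow R" for S
  proof -
    define A where "A = (\<Sum>j\<in>R. - ln (lik (j \<in> S) (\<theta> j (z S))))"
    define B where "B = (\<Sum>j\<in>R. - ln (coin p j (j \<in> S)))"
    have coin: "0 < coin p j (j \<in> S)" if "j \<in> R" for j using p[OF that] \<delta> by (auto simp: coin_def)
    have P: "(\<Prod>j\<in>R. coin p j (j \<in> S)) = exp (- B)"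
      using coin R by (simp add: B_def sum_negf exp_sum)
    have Q: "0 < Q \<kappa> p m (card R) R (\<lambda>i. i \<in> S)"
      and le: "- ln (Q \<kappa> p m (card R) R (\<lambda>i. i \<in> S)) \<le> ?a * A + (1 - ?a) * B
        + ((1 - \<kappa>) * (\<tau> * sq (z S) + card J) + 2 * (1 - \<kappa>) / (\<kappa> * \<delta>) * card J) * h"
      using code_length_le[OF R refl w \<kappa> \<delta> p, where m = m and y = "\<lambda>i. i \<in> S" and ?z0.0 = "z S"] by (auto simp: A_def B_def h_def)
    have "((1 - \<kappa>) * (\<tau> * sq (z S) + card J) + 2 * (1 - \<kappa>) / (\<kappa> * \<delta>) * card J) * h \<le> ?C"
      unfolding h_def[symmetric] using h \<kappa> \<tau> M[of S] S by (intro mult_right_mono add_right_mono mult_left_mono) auto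
    then have "- B + ?a * (B - A) \<le> ?C + ln (Q \<kappa> p m (card R) R (\<lambda>i. i \<in> S))"
      using le by (simp add: algebra_simps)
    then have "exp (- B + ?a * (B - A)) \<le> exp (?C + ln (Q \<kappa> p m (card R) R (\<lambda>i. i \<in> S)))" by (simp only: exp_le_cancel_iff)
    then have le': "exp (- B) * exp (?a * (B - A)) \<le> exp ?C * Q \<kappa> p m (card R) R (\<lambda>i. i \<in> S)"
      using Q by (simp only: exp_add exp_ln)
    have "(\<Sum>j\<in>R. ln (lik (j \<in> S) (\<theta> j (z S))) - ln (coin p j (j \<in> S))) = B - A"
      by (simp add: A_def B_def sum_subtractf sum_negf)
    then show ?thesis unfolding P using le' by (simp only:)
  qed
  then have "?L \<le> (\<Sum>S\<in>Pow R. exp ?C * Q \<kappa> p m (card R) R (\<lambda>i. i \<in> S))" by (rule sum_mono)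
  also have "\<dots> = exp ?C" using sum_Q[OF R refl, of \<kappa> p m] by (simp add: sum_distrib_left[symmetric])
  finally show ?thesis .
qed

end

text \<open>The prior is removed by letting \<open>\<tau>\<close> tend to 0. There are only finitely
  many label sets, so the square norms of all \<open>z S\<close> have a common bound
  \<open>M\<close>.\<close>

theorem sup_likelihood_ratio_moment:
  fixes w :: "nat \<Rightarrow> 'i \<Rightarrow> real" and z :: "nat set \<Rightarrow> 'i \<Rightarrow> real"
  assumes J: "finite J" "i0 \<in> J" and R: "finite R" and w: "\<And>j. j \<in> R \<Longrightarrow> w j i0 \<noteq> 0"
    and \<kappa>: "0 < \<kappa>" "\<kappa> < 1" and \<delta>: "0 < \<delta>" and p: "\<And>j. j \<in> R \<Longrightarrow> \<delta> \<le> p j \<and> p j \<le> 1 - \<delta>" and m: "m < card R"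
  defines "\<theta> \<equiv> \<lambda>j z. \<Sum>l\<in>J. w j l * z l"
  shows "(\<Sum>S\<in>Pow R. (\<Prod>j\<in>R. coin p j (j \<in> S)) *
      exp ((1 - \<kappa>) * (1 - real m / card R) *
        (\<Sum>j\<in>R. ln (sg ((if j \<in> S then 1 else - 1) * \<theta> j (z S))) - ln (coin p j (j \<in> S)))))
    \<le> exp (((1 - \<kappa>) + 2 * (1 - \<kappa>) / (\<kappa> * \<delta>)) * card J * (\<Sum>l\<in>{m<..card R}. 1 / real l))"
    (is "?L \<le> exp (_ * _ * ?h)")
proof -
  define M where "M = Max ((\<lambda>S. \<Sum>l\<in>J. (z S l)\<^sup>2) ` Pow R)"
  have M: "(\<Sum>l\<in>J. (z S l)\<^sup>2) \<le> M" if "S \<subseteq> R" for S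
    unfolding M_def using R that by (intro Max_ge) auto
  have le: "?L \<le> exp (((1 - \<kappa>) * (\<tau> * M + card J) + 2 * (1 - \<kappa>) / (\<kappa> * \<delta>) * card J) * ?h)" if \<tau>: "0 < \<tau>" for \<tau>
  proof -
    interpret logistic_family J \<tau> w i0 by unfold_locales (use J \<tau> in auto)
    have "\<And>S. S \<subseteq> R \<Longrightarrow> sq (z S) \<le> M" using M by (simp add: sq_def)
    from likelihood_ratio_moment_tau[OF R w \<kappa> \<delta> p this, where m = m]
    show ?thesis using m by (simp add: lik_def sign_def \<theta>_def assms(10) alpha_def)
  qed
  have "((\<lambda>\<tau>. exp (((1 - \<kappa>) * (\<tau> * M + card J) + 2 * (1 - \<kappa>) / (\<kappa> * \<delta>) * card J) * ?h)) \<longlongrightarrow>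
      exp (((1 - \<kappa>) * (0 * M + card J) + 2 * (1 - \<kappa>) / (\<kappa> * \<delta>) * card J) * ?h)) (at_right 0)"
    by (intro tendsto_intros)
  moreover have "\<forall>\<^sub>F \<tau> in at_right 0. ?L \<le> exp (((1 - \<kappa>) * (\<tau> * M + card J) + 2 * (1 - \<kappa>) / (\<kappa> * \<delta>) * card J) * ?h)"
    using le by (auto simp: eventually_at_right_less intro: eventually_at_rightI[of 0 1])
  ultimately have "?L \<le> exp (((1 - \<kappa>) * (0 * M + card J) + 2 * (1 - \<kappa>) / (\<kappa> * \<delta>) * card J) * ?h)"
    by (intro tendsto_lowerbound) auto
  then show ?thesis by (simp add: distrib_right)
qed

section \<open>The likelihood of a sparse logistic model\<close>

lemma sg_exp: "sg t = exp t / (1 + exp t)"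
proof -
  have "1 + exp t > 0" by (simp add: add_pos_pos)
  then show ?thesis by (simp add: sg_def exp_minus field_simps)
qed

lemma success_prob_eq_sg: "success_prob X \<beta> i = sg (\<beta> \<bullet> row X i)"
  by (simp add: success_prob_def sg_exp)

lemma loglik_term_eq_ln_sg: "t * of_bool u - ln (1 + exp t) = ln (sg ((if u then 1 else - 1) * t))"
proof -
  have "1 + exp t > 0" by (simp add: add_pos_pos)
  then have "ln (sg t) = t - ln (1 + exp t)" "ln (sg (- t)) = - ln (1 + exp t)"
    unfolding sg_exp[of t] sg_def[of "- t"] by (simp_all add: ln_div)
  then show ?thesis by simp
qed

text \<open>The gap is \<open>ln (1 + G)\<close>, and
  \<open>1 - 1 / (1 + G) \<le> ln (1 + G)\<close>. The squared difference is the left-hand quantity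
  times \<open>(u + v)\<^sup>2 / P\<close>, a factor at most 1.\<close>

lemma sg_diff_square_le_midpoint_gap:
  "(sg b - sg a)\<^sup>2 \<le> ln (1 + exp a) + ln (1 + exp b) - 2 * ln (1 + exp ((a + b) / 2))"
proof -
  define u v where "u = exp (a / 2)" and "v = exp (b / 2)"
  define G where "G = ((v - u) / (1 + u * v))\<^sup>2"
  have e: "exp a = u\<^sup>2" "exp b = v\<^sup>2"
    by (auto simp: u_def v_def power2_eq_square simp flip: exp_add)
  have q: "1 + u\<^sup>2 > 0" "1 + v\<^sup>2 > 0" "1 + u * v > 0"
    by (auto simp: u_def v_def intro!: add_pos_nonneg)
  define P where "P = (1 + u\<^sup>2) * (1 + v\<^sup>2)"
  have P: "0 < P" "P = (1 + u * v)\<^sup>2 + (v - u)\<^sup>2" "(u + v)\<^sup>2 \<le> P"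
  proof -
    show "0 < P" using q by (simp add: P_def)
    show "P = (1 + u * v)\<^sup>2 + (v - u)\<^sup>2" by (simp add: P_def power2_eq_square algebra_simps)
    have "P - (u + v)\<^sup>2 = (1 - u * v)\<^sup>2" by (simp add: P_def power2_eq_square algebra_simps)
    then show "(u + v)\<^sup>2 \<le> P" using zero_le_power2[of "1 - u * v"] by linarith
  qed
  have "sg b - sg a = (v - u) * (u + v) / P"
    unfolding sg_exp e P_def using q by (simp add: divide_simps) (simp add: power2_eq_square algebra_simps)
  then have "(sg b - sg a)\<^sup>2 = (v - u)\<^sup>2 / P * ((u + v)\<^sup>2 / P)"
    by (simp add: power_mult_distrib power_divide power2_eq_square)
  also have "\<dots> \<le> (v - u)\<^sup>2 / P * 1"
    using P by (intro mult_left_mono) auto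
  also have "\<dots> = 1 - 1 / (1 + G)"
  proof -
    have "1 + G = P / (1 + u * v)\<^sup>2" using q(3) by (simp add: G_def P(2) power_divide add_divide_distrib)
    then have "1 / (1 + G) = (1 + u * v)\<^sup>2 / P" by simp
    moreover have "(v - u)\<^sup>2 = P - (1 + u * v)\<^sup>2" using P(2) by simp
    ultimately show ?thesis using P(1) by (simp add: diff_divide_distrib)
  qed
  also have "\<dots> \<le> ln (1 + G)"
  proof -
    have G: "0 \<le> G" by (simp add: G_def)
    have "ln (1 / (1 + G)) \<le> 1 / (1 + G) - 1" using G by (intro ln_le_minus_one) auto
    then show ?thesis using G by (simp add: ln_div)
  qed
  finally show ?thesis unfolding midpoint_gap u_def v_def G_def .
qed

lemma convex_ln_1_exp: "convex_on UNIV (\<lambda>t :: real. ln (1 + exp t))"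
proof (rule f''_ge0_imp_convex)
  show "convex (UNIV :: real set)" by simp
  show "((\<lambda>t. ln (1 + exp t)) has_real_derivative sg t) (at t)" for t
    unfolding sg_exp by (rule derivative_eq_intros refl | simp add: add_pos_pos)+
  show "(sg has_real_derivative exp (- t) / (1 + exp (- t))\<^sup>2) (at t)" for t
  proof -
    have "1 + exp (- t) \<noteq> 0" using exp_gt_zero[of "- t"] by linarith
    then show ?thesis unfolding sg_def[abs_def] power2_eq_square
      by (auto intro!: derivative_eq_intros)
  qed
  show "0 \<le> exp (- t) / (1 + exp (- t))\<^sup>2" for t :: real by simp
qed

text \<open>The point is a convex combination, with weight \<open>s\<close>, of \<open>u\<close> and
  the midpoint of \<open>t\<close> and \<open>u\<close>; the midpoint supplies the gain.\<close>

lemma logistic_loss_gap: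
  assumes "0 \<le> s" "s \<le> 1"
  shows "ln (1 + exp (s / 2 * t + (1 - s / 2) * u)) + s / 2 * (sg u - sg t)\<^sup>2
       \<le> s / 2 * ln (1 + exp t) + (1 - s / 2) * ln (1 + exp u)"
proof -
  have "s / 2 * t + (1 - s / 2) * u = s *\<^sub>R ((t + u) / 2) + (1 - s) *\<^sub>R u" by (simp add: field_simps)
  then have "ln (1 + exp (s / 2 * t + (1 - s / 2) * u))
      \<le> s * ln (1 + exp ((t + u) / 2)) + (1 - s) * ln (1 + exp u)"
    using convex_onD[OF convex_ln_1_exp, of "1 - s" "(t + u) / 2" u] assms by simp
  moreover have "s / 2 * (sg u - sg t)\<^sup>2
      \<le> s / 2 * (ln (1 + exp t) + ln (1 + exp u) - 2 * ln (1 + exp ((t + u) / 2)))"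
    using assms by (intro mult_left_mono sg_diff_square_le_midpoint_gap) auto
  ultimately show ?thesis by (simp add: algebra_simps)
qed

lemma loglik_interpolation:
  assumes b: "b \<in> carrier_vec (dim_col X)" "\<beta> \<in> carrier_vec (dim_col X)" and s: "0 \<le> s" "s \<le> 1"
  shows "(1 - s / 2) * (loglik X y b - loglik X y \<beta>)
      + s / 2 * (\<Sum>i<dim_row X. (sg (b \<bullet> row X i) - success_prob X \<beta> i)\<^sup>2)
    \<le> loglik X y ((s / 2) \<cdot>\<^sub>v \<beta> + (1 - s / 2) \<cdot>\<^sub>v b) - loglik X y \<beta>"
  unfolding loglik_def sum_subtractf[symmetric] sum_distrib_left sum.distrib[symmetric]
proof (rule sum_mono)
  fix i assume "i \<in> {..<dim_row X}"
  have "((s / 2) \<cdot>\<^sub>v \<beta> + (1 - s / 2) \<cdot>\<^sub>v b) \<bullet> row X i = s / 2 * (\<beta> \<bullet> row X i) + (1 - s / 2) * (b \<bullet> row X i)"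
    using b by (simp add: add_scalar_prod_distrib[of _ "dim_col X"])
  then show "(1 - s / 2) * (b \<bullet> row X i * of_bool (y i) - ln (1 + exp (b \<bullet> row X i))
        - (\<beta> \<bullet> row X i * of_bool (y i) - ln (1 + exp (\<beta> \<bullet> row X i))))
      + s / 2 * (sg (b \<bullet> row X i) - success_prob X \<beta> i)\<^sup>2
    \<le> ((s / 2) \<cdot>\<^sub>v \<beta> + (1 - s / 2) \<cdot>\<^sub>v b) \<bullet> row X i * of_bool (y i)
      - ln (1 + exp (((s / 2) \<cdot>\<^sub>v \<beta> + (1 - s / 2) \<cdot>\<^sub>v b) \<bullet> row X i))
      - (\<beta> \<bullet> row X i * of_bool (y i) - ln (1 + exp (\<beta> \<bullet> row X i)))"
    using logistic_loss_gap[OF s, of "\<beta> \<bullet> row X i" "b \<bullet> row X i"]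
    by (simp only: success_prob_eq_sg) (simp add: algebra_simps)
qed

text \<open>\<open>r\<close> independent columns span a column space of dimension \<open>r\<close>.
  Hence every model of size \<open>r\<close> produces all linear predictors, in particular the true
  one.\<close>

lemma spanning_columns:
  assumes X: "X \<in> carrier_mat n d" and r: "vec_space.rank n X = r" and ind: "any_cols_indep X r"
    and J: "J \<subseteq> {..<d}" "card J = r" and b: "b \<in> carrier_vec d"
  obtains b' where "b' \<in> model_space d J" "\<And>i. i < n \<Longrightarrow> b' \<bullet> row X i = b \<bullet> row X i"
proof -
  interpret vec_space "TYPE(real)" n .
  have fJ: "finite J" using J(1) finite_subset by blast
  define A where "A = col X ` J"
  have inj: "inj_on (col X) J" and li: "lin_indpt A"
    using ind J X unfolding any_cols_indep_def A_def by auto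
  have cA: "card A = r" using inj J(2) by (simp add: A_def card_image)
  have fA: "finite A" using fJ by (simp add: A_def)
  have Ac: "A \<subseteq> carrier_vec n" using X by (auto simp: A_def)
  have cols: "set (cols X) = col X ` {..<d}" using X by (auto simp: cols_def)
  have "\<exists>g. \<forall>i<n. X $$ (i, l) = (\<Sum>j\<in>J. g j * X $$ (i, j))" if l: "l < d" for l
  proof -
    have vc: "col X l \<in> carrier_vec n" using X by auto
    have "col X l \<in> span A"
    proof (cases "col X l \<in> A")
      case True then show ?thesis using Ac span_mem by blast
    next
      case False
      show ?thesis
      proof (rule ccontr)
        assume "col X l \<notin> span A"
        then have "lin_indpt (A \<union> {col X l})" using lin_dep_iff_in_span[OF Ac li vc False] by simp
        moreover have "A \<union> {col X l} \<subseteq> set (cols X)" using J(1) l by (auto simp: A_def cols)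
        ultimately have "card (A \<union> {col X l}) \<le> rank X" using rank_ge_card_indpt[OF X] by blast
        then show False using False fA cA r by simp
      qed
    qed
    from finite_in_span[OF fA Ac this] obtain f where f: "col X l = lincomb f A" by (elim exE conjE) (rule that, erule sym)
    have "X $$ (i, l) = (\<Sum>j\<in>J. f (col X j) * X $$ (i, j))" if i: "i < n" for i
    proof -
      have "X $$ (i, l) = col X l $ i" using X i l by simp
      also have "\<dots> = (\<Sum>a\<in>A. f a * a $ i)" unfolding f using lincomb_index[OF i Ac] by simp
      also have "\<dots> = (\<Sum>j\<in>J. f (col X j) * col X j $ i)"
        unfolding A_def by (simp add: sum.reindex[OF inj])
      also have "\<dots> = (\<Sum>j\<in>J. f (col X j) * X $$ (i, j))" using X i J(1) by (intro sum.cong) auto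
      finally show ?thesis .
    qed
    then show ?thesis by (intro exI[of _ "\<lambda>j. f (col X j)"]) auto
  qed
  then obtain g where g: "\<And>l i. l < d \<Longrightarrow> i < n \<Longrightarrow> X $$ (i, l) = (\<Sum>j\<in>J. g l j * X $$ (i, j))" by metis
  define b' where "b' = vec d (\<lambda>j. if j \<in> J then \<Sum>l<d. b $ l * g l j else 0)"
  show ?thesis
  proof
    show "b' \<in> model_space d J" by (auto simp: b'_def model_space_def)
    fix i assume i: "i < n"
    have "b' \<bullet> row X i = (\<Sum>j<d. b' $ j * X $$ (i, j))"
      using X i by (auto simp: scalar_prod_def atLeast0LessThan intro!: sum.cong)
    also have "\<dots> = (\<Sum>j<d. if j \<in> J then (\<Sum>l<d. b $ l * g l j) * X $$ (i, j) else 0)"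
      by (auto simp: b'_def intro!: sum.cong)
    also have "\<dots> = (\<Sum>j\<in>J. (\<Sum>l<d. b $ l * g l j) * X $$ (i, j))"
      using J(1) by (simp add: sum.If_cases Int_absorb1)
    also have "\<dots> = (\<Sum>l<d. b $ l * (\<Sum>j\<in>J. g l j * X $$ (i, j)))"
      unfolding sum_distrib_right sum_distrib_left
      by (subst sum.swap) (simp add: mult.assoc)
    also have "\<dots> = (\<Sum>l<d. b $ l * X $$ (i, l))" using g[OF _ i] by (intro sum.cong) auto
    also have "\<dots> = b \<bullet> row X i"
      using X i by (auto simp: scalar_prod_def atLeast0LessThan intro!: sum.cong)
    finally show "b' \<bullet> row X i = b \<bullet> row X i" .
  qed
qed

lemma ln_le_half_diff_inverse:
  assumes "1 \<le> (s :: real)"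
  shows "ln s \<le> (s - 1 / s) / 2"
proof -
  have "(1 - 1 / 1) / 2 - ln 1 \<le> (s - 1 / s) / 2 - ln s"
  proof (rule DERIV_nonneg_imp_nondecreasing[OF assms], intro exI conjI)
    fix x :: real assume "1 \<le> x" "x \<le> s"
    then show "((\<lambda>s. (s - 1 / s) / 2 - ln s) has_real_derivative (1 + 1 / x\<^sup>2) / 2 - 1 / x) (at x)"
      by (auto intro!: derivative_eq_intros simp: power2_eq_square field_simps)
    have "(1 + 1 / x\<^sup>2) / 2 - 1 / x = (1 - 1 / x)\<^sup>2 / 2" by (simp add: power2_eq_square algebra_simps)
    then show "0 \<le> (1 + 1 / x\<^sup>2) / 2 - 1 / x" by (simp only: zero_le_power2 zero_le_divide_iff) simp
  qed
  then show ?thesis by simp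
qed

text \<open>
  The usual bound \<open>k * ln (d * e / k)\<close> would exceed the admissible penalty when \<open>k\<close> is close to \<open>d\<close>.
\<close>
lemma ln_binomial_le:
  assumes k: "1 \<le> k" "k \<le> d"
  shows "ln (d choose k) \<le> real k * (3 / 2 * ln (real d * exp 1 / real k) - 1)"
proof -
  have L: "ln (real d * exp 1 / real k) = 1 + ln (real d / real k)"
    using k by (simp add: ln_mult ln_div)
  show ?thesis
  proof (cases "k = d")
    case True then show ?thesis using k by (simp add: L)
  next
    case False
    define a b c where "a = real k" and "b = real (d - k)" and "c = real d"
    have p: "0 < a" "0 < b" "c = a + b" using False k by (auto simp: a_def b_def c_def)
    \<comment> \<open>Entropy bound for the binomial coefficient, from a single term of the
      expansion of \<open>(a + b) ^ d\<close> with \<open>a = k\<close> and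
      \<open>b = d - k\<close>. The part \<open>b * ln (c / b)\<close> is then estimated more
      sharply than by \<open>a\<close>.\<close>
    have "real (d choose k) * a ^ k * b ^ (d - k) \<le> (\<Sum>j\<le>d. real (d choose j) * a ^ j * b ^ (d - j))"
      using k p by (intro member_le_sum[of k "{..d}" "\<lambda>j. real (d choose j) * a ^ j * b ^ (d - j)"]) auto
    also have "\<dots> = c ^ d" unfolding p(3) binomial_ring ..
    finally have "ln (real (d choose k) * a ^ k * b ^ (d - k)) \<le> ln (c ^ d)"
      using k p by (subst ln_le_cancel_iff) (auto simp: zero_less_binomial)
    then have "ln (d choose k) + a * ln a + b * ln b \<le> c * ln c"
      using k p by (simp add: ln_mult ln_realpow zero_less_binomial a_def[symmetric] b_def[symmetric] c_def[symmetric])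
    then have 1: "ln (d choose k) \<le> a * ln (c / a) + b * ln (c / b)"
      using p by (simp add: ln_div algebra_simps)
    have "b * ln (c / b) \<le> b * ((c / b - 1 / (c / b)) / 2)"
      using p by (intro mult_left_mono ln_le_half_diff_inverse) (auto simp: field_simps)
    also have "\<dots> = a * (1 - a / c / 2)"
    proof -
      have "b * (c / b) = c" "b * (1 / (c / b)) = b * b / c" using p by simp_all
      moreover have "b * b / c = c - 2 * a + a * a / c"
        using p by (simp add: divide_simps) (simp add: algebra_simps)
      ultimately have eq: "b * (c / b - 1 / (c / b)) = a * (2 - a / c)"
        by (simp only: right_diff_distrib) (simp add: algebra_simps)
      have "b * (x / 2) = a * (1 - y / 2)" if "b * x = a * (2 - y)" for x y :: real
        using that by (simp add: algebra_simps)
      from this[OF eq] show ?thesis .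
    qed
    also have "\<dots> \<le> a * (1 / 2 * ln (c / a) + 1 / 2)"
    proof (rule mult_left_mono)
      have "ln (a / c) \<le> a / c - 1" using p by (intro ln_le_minus_one) auto
      moreover have "ln (c / a) = - ln (a / c)" using p by (simp add: ln_div)
      moreover have "1 - x / 2 \<le> 1 / 2 * v + 1 / 2" if "u \<le> x - 1" "v = - u" for x u v :: real
        using that by simp
      ultimately show "1 - a / c / 2 \<le> 1 / 2 * ln (c / a) + 1 / 2" by blast
    qed (use p in auto)
    finally show ?thesis using 1 L unfolding a_def[symmetric] c_def[symmetric] by (simp add: algebra_simps)
  qed
qed

lemma coin_success_prob: "coin (success_prob X \<beta>) i u = sg ((if u then 1 else - 1) * (\<beta> \<bullet> row X i))"
  by (simp add: coin_def success_prob_eq_sg sg_minus)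

lemma loglik_eq_sum_ln_sg:
  "loglik X y b = (\<Sum>i<dim_row X. ln (sg ((if y i then 1 else - 1) * (b \<bullet> row X i))))"
  unfolding loglik_def loglik_term_eq_ln_sg ..

text \<open>The truth joins the model as coordinate 0. The point \<open>v S\<close>, 1/100 of the
  way from \<open>b S\<close> to \<open>\<beta>\<close>, then belongs to a family of dimension
  \<open>card M + 1\<close>, and the new entry of row \<open>i\<close> is
  \<open>\<beta> \<bullet> row X i\<close>, nonzero as the coordinate \<open>i0\<close> requires.
  The constants are those of \<open>\<kappa> = 3/4\<close> and of
  \<open>loglik_interpolation\<close> with \<open>s = 1/50\<close>.\<close>

lemma model_likelihood_moment:
  assumes X: "X \<in> carrier_mat n d" and \<beta>: "\<beta> \<in> carrier_vec d" and M: "M \<subseteq> {..<d}"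
    and nz: "\<And>i. i < n \<Longrightarrow> \<beta> \<bullet> row X i \<noteq> 0"
    and \<delta>: "0 < \<delta>" "\<And>i. i < n \<Longrightarrow> \<delta> \<le> success_prob X \<beta> i \<and> success_prob X \<beta> i \<le> 1 - \<delta>"
    and m: "m < n" and b: "\<And>S. b S \<in> model_space d M"
  shows "(\<Sum>S\<in>Pow {..<n}. (\<Prod>i<n. coin (success_prob X \<beta>) i (i \<in> S)) *
      exp (1 / 4 * (1 - real m / real n) *
        (99 / 100 * (loglik X (\<lambda>i. i \<in> S) (b S) - loglik X (\<lambda>i. i \<in> S) \<beta>)
          + 1 / 100 * (\<Sum>i<n. (sg (b S \<bullet> row X i) - success_prob X \<beta> i)\<^sup>2))))
    \<le> exp ((1 / 4 + 2 / (3 * \<delta>)) * (real (card M) + 1) * (\<Sum>l\<in>{m<..n}. 1 / real l))"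
proof -
  have fM: "finite M" using M finite_subset by blast
  define J where "J = insert 0 (Suc ` M)"
  have J: "finite J" "0 \<in> J" "card J = card M + 1" using fM by (auto simp: J_def card_image)
  define w where "w i l = (case l of 0 \<Rightarrow> \<beta> \<bullet> row X i | Suc j \<Rightarrow> X $$ (i, j))" for i l
  define z where "z S l = (case l of 0 \<Rightarrow> 1 / 100 | Suc j \<Rightarrow> 99 / 100 * b S $ j)" for S l
  define v where "v S = (1 / 100) \<cdot>\<^sub>v \<beta> + (99 / 100) \<cdot>\<^sub>v b S" for S
  have bc: "b S \<in> carrier_vec d" and b0: "j < d \<Longrightarrow> j \<notin> M \<Longrightarrow> b S $ j = 0" for S j
    using b[of S] by (auto simp: model_space_def)
  have lin: "(\<Sum>l\<in>J. w i l * z S l) = v S \<bullet> row X i" if i: "i < n" for i S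
  proof -
    have "(\<Sum>l\<in>J. w i l * z S l) = 1 / 100 * (\<beta> \<bullet> row X i) + (\<Sum>j\<in>M. X $$ (i, j) * (99 / 100 * b S $ j))"
      unfolding J_def using fM by (simp add: sum.reindex w_def z_def)
    also have "(\<Sum>j\<in>M. X $$ (i, j) * (99 / 100 * b S $ j)) = (\<Sum>j<d. 99 / 100 * (b S $ j * X $$ (i, j)))"
      using M b0 by (intro sum.mono_neutral_cong_left) auto
    also have "\<dots> = 99 / 100 * (b S \<bullet> row X i)"
      unfolding sum_distrib_left[symmetric] using X i by (simp add: scalar_prod_def atLeast0LessThan)
    also have "1 / 100 * (\<beta> \<bullet> row X i) + 99 / 100 * (b S \<bullet> row X i) = v S \<bullet> row X i"
    proof -
      have "row X i \<in> carrier_vec d" using X i by auto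
      then show ?thesis using \<beta> bc[of S] by (simp add: v_def add_scalar_prod_distrib[of _ d])
    qed
    finally show ?thesis .
  qed
  have ll: "(\<Sum>i<n. ln (sg ((if i \<in> S then 1 else - 1) * (\<Sum>l\<in>J. w i l * z S l))) - ln (coin (success_prob X \<beta>) i (i \<in> S)))
      = loglik X (\<lambda>i. i \<in> S) (v S) - loglik X (\<lambda>i. i \<in> S) \<beta>" for S
    unfolding loglik_eq_sum_ln_sg sum_subtractf[symmetric] coin_success_prob
    using X by (intro sum.cong) (auto simp: lin)
  have interp: "99 / 100 * (loglik X y (b S) - loglik X y \<beta>) + 1 / 100 * (\<Sum>i<n. (sg (b S \<bullet> row X i) - success_prob X \<beta> i)\<^sup>2)
      \<le> loglik X y (v S) - loglik X y \<beta>" for y S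
    using loglik_interpolation[of "b S" X \<beta> "1 / 50" y] X \<beta> bc[of S] by (simp add: v_def)
  have "(\<Sum>S\<in>Pow {..<n}. (\<Prod>i<n. coin (success_prob X \<beta>) i (i \<in> S)) *
      exp (1 / 4 * (1 - real m / real n) *
        (99 / 100 * (loglik X (\<lambda>i. i \<in> S) (b S) - loglik X (\<lambda>i. i \<in> S) \<beta>)
          + 1 / 100 * (\<Sum>i<n. (sg (b S \<bullet> row X i) - success_prob X \<beta> i)\<^sup>2))))
    \<le> (\<Sum>S\<in>Pow {..<n}. (\<Prod>i<n. coin (success_prob X \<beta>) i (i \<in> S)) *
      exp ((1 - 3 / 4) * (1 - real m / real (card {..<n})) *
        (\<Sum>i<n. ln (sg ((if i \<in> S then 1 else - 1) * (\<Sum>l\<in>J. w i l * z S l))) - ln (coin (success_prob X \<beta>) i (i \<in> S)))))"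
  proof (rule sum_mono)
    fix S
    have "0 \<le> (\<Prod>i<n. coin (success_prob X \<beta>) i (i \<in> S))"
      unfolding coin_success_prob by (intro prod_nonneg) (auto simp: sg_pos less_imp_le)
    moreover have "0 \<le> 1 / 4 * (1 - real m / real n)" using m by simp
    ultimately show "(\<Prod>i<n. coin (success_prob X \<beta>) i (i \<in> S)) * exp (1 / 4 * (1 - real m / real n) *
        (99 / 100 * (loglik X (\<lambda>i. i \<in> S) (b S) - loglik X (\<lambda>i. i \<in> S) \<beta>)
          + 1 / 100 * (\<Sum>i<n. (sg (b S \<bullet> row X i) - success_prob X \<beta> i)\<^sup>2)))
      \<le> (\<Prod>i<n. coin (success_prob X \<beta>) i (i \<in> S)) *
      exp ((1 - 3 / 4) * (1 - real m / real (card {..<n})) *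
        (\<Sum>i<n. ln (sg ((if i \<in> S then 1 else - 1) * (\<Sum>l\<in>J. w i l * z S l))) - ln (coin (success_prob X \<beta>) i (i \<in> S))))"
      unfolding ll using mult_left_mono[OF interp, of "1 / 4 * (1 - real m / real n)" "\<lambda>i. i \<in> S" S]
      by (intro mult_left_mono) (simp_all del: power2_diff)
  qed
  also have "\<dots> \<le> exp (((1 - 3 / 4) + 2 * (1 - 3 / 4) / (3 / 4 * \<delta>)) * card J * (\<Sum>l\<in>{m<..card {..<n}}. 1 / real l))"
    using J nz \<delta> m by (intro sup_likelihood_ratio_moment[where ?i0.0 = 0]) (auto simp: w_def)
  also have "((1 - 3 / 4) + 2 * (1 - 3 / 4) / (3 / 4 * \<delta>)) = 1 / 4 + 2 / (3 * \<delta>)"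
    using \<delta>(1) by (simp add: field_simps)
  finally show ?thesis by (simp add: J(3) add.commute)
qed

section \<open>Comparison of the selected model with the truth\<close>

lemma k_ln_mono:
  assumes "1 \<le> d0" "k \<le> d0" "d0 \<le> d"
  shows "real k * ln (real d * exp 1 / real k) \<le> real d0 * ln (real d * exp 1 / real d0)"
proof -
  have L: "ln (real d * exp 1 / real j) = 1 + ln (real d / real j)" if "0 < j" for j
    using that assms by (simp add: ln_mult ln_div)
  show ?thesis
  proof (cases "k = 0")
  case True then show ?thesis using assms by (simp add: L)
next
  case False
  have "ln (real d0 / real k) \<le> real d0 / real k - 1" using False assms by (intro ln_le_minus_one) auto
  then have "real k * ln (real d0 / real k) \<le> real k * (real d0 / real k - 1)" by (intro mult_left_mono) auto
  also have "\<dots> = real d0 - real k" using False by (simp add: algebra_simps)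
  finally have 1: "real k * ln (real d0 / real k) \<le> real d0 - real k" .
  have "ln (real d / real k) = ln (real d / real d0) + ln (real d0 / real k)" using False assms by (simp add: ln_div)
  then have "real k * ln (real d * exp 1 / real k)
      = real k * (1 + ln (real d / real d0)) + real k * ln (real d0 / real k)"
    using False by (simp add: L distrib_left)
  also have "\<dots> \<le> real k * (1 + ln (real d / real d0)) + (real d0 - real k) * (1 + ln (real d / real d0))"
  proof -
    have "(real d0 - real k) * 1 \<le> (real d0 - real k) * (1 + ln (real d / real d0))"
      using assms by (intro mult_left_mono) auto
    then show ?thesis using 1 by simp
  qed
  also have "\<dots> = real d0 * ln (real d * exp 1 / real d0)" using assms by (simp add: L) (simp add: algebra_simps)
  finally show ?thesis .
qed
qed

lemma rank_le_dim_col: "X \<in> carrier_mat n d \<Longrightarrow> vec_space.rank n (X :: real mat) \<le> d"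
  by (rule vec_space.rank_le_nc)

text \<open>Two competitors of the selected model: any \<open>r\<close> columns, which reproduce the
  predictor of \<open>\<beta>\<close> by \<open>spanning_columns\<close> at penalty
  \<open>c * r\<close>, and, for \<open>d0 < r\<close>, the support of \<open>\<beta>\<close>. For
  \<open>d0 = r\<close> the minimum is \<open>r\<close>.\<close>

lemma selected_model_loglik:
  assumes X: "X \<in> carrier_mat n d" and r: "vec_space.rank n X = r" and ind: "any_cols_indep X r"
    and \<beta>: "\<beta> \<in> carrier_vec d" "l0_norm \<beta> \<le> d0" and d0: "1 \<le> d0" "d0 \<le> r" and c: "0 \<le> c"
    and sel: "is_selected_model c r X y Mh"
  shows "loglik X y \<beta> + complexity_pen c d r (card Mh)
    \<le> max_loglik X y Mh + c * min (real d0 * ln (real d * exp 1 / real d0)) (real r)"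
proof -
  have rd: "r \<le> d" using rank_le_dim_col[OF X] r by simp
  have dX: "dim_col X = d" "dim_row X = n" using X by auto
  have comp: "complexity_pen c d r (card Mh) - max_loglik X y Mh \<le> complexity_pen c d r (card M) - max_loglik X y M"
    if "M \<subseteq> {..<d}" "card M \<le> r" for M
    using sel that unfolding is_selected_model_def is_arg_min_linorder dX by force
  have 1: "loglik X y \<beta> + complexity_pen c d r (card Mh) \<le> max_loglik X y Mh + c * real r"
  proof -
    obtain J where J: "J \<subseteq> {..<d}" "card J = r" using obtain_subset_with_card_n[of r "{..<d}"] rd by auto
    obtain b' where b': "b' \<in> model_space d J" "\<And>i. i < n \<Longrightarrow> b' \<bullet> row X i = \<beta> \<bullet> row X i"
      using spanning_columns[OF X r ind J \<beta>(1)] by blast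
    have "loglik X y \<beta> = loglik X y b'" unfolding loglik_def dX using b'(2) by simp
    also have "\<dots> \<le> max_loglik X y J" using loglik_le_max[of b' X J y] b'(1) dX by simp
    finally show ?thesis using comp[of J] J d0 by (simp add: complexity_pen_def)
  qed
  have 2: "loglik X y \<beta> + complexity_pen c d r (card Mh) \<le> max_loglik X y Mh + c * (real d0 * ln (real d * exp 1 / real d0))"
    if "d0 < r"
  proof -
    define M where "M = {j. j < dim_vec \<beta> \<and> \<beta> $ j \<noteq> 0}"
    have M: "M \<subseteq> {..<d}" "card M \<le> d0" "\<beta> \<in> model_space d M"
      using \<beta> by (auto simp: M_def l0_norm_def model_space_def)
    have "complexity_pen c d r (card M) = c * (real (card M) * ln (real d * exp 1 / real (card M)))"
      using M(2) that by (simp add: complexity_pen_def)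
    also have "\<dots> \<le> c * (real d0 * ln (real d * exp 1 / real d0))"
      using M(2) d0 rd c by (intro mult_left_mono k_ln_mono) auto
    finally show ?thesis using comp[of M] M d0 loglik_le_max[of \<beta> X M y] dX by simp
  qed
  show ?thesis
  proof (cases "d0 < r")
    case True then show ?thesis using 1 2 by (simp add: min_def)
  next
    case False
    then have "d0 = r" using d0 by simp
    moreover have "1 \<le> ln (real d * exp 1 / real d0)"
      using rd d0 by (simp add: ln_mult ln_div)
    then have "real d0 * 1 \<le> real d0 * ln (real d * exp 1 / real d0)" by (intro mult_left_mono) auto
    ultimately show ?thesis using 1 d0 by (simp add: min_def)
  qed
qed

text \<open>The fit may be infinite or a mere limit. A late member of the maximizing sequence
  replaces it, losing at most 1 in likelihood and a constant factor in the error at misclassified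
  points.\<close>

lemma ex_near_maximizer:
  assumes mle: "is_mle_predictor X y M \<theta>" and h: "0 < h"
    and p: "\<And>i. i < dim_row X \<Longrightarrow> h \<le> \<bar>success_prob X \<beta> i - 1 / 2\<bar>"
  obtains b where "b \<in> model_space (dim_col X) M" "max_loglik X y M - 1 \<le> loglik X y b"
    "\<And>i. i < dim_row X \<Longrightarrow> (0 \<le> \<theta> i) \<noteq> bayes_classifier \<beta> (row X i) \<Longrightarrow>
      (success_prob X \<beta> i - 1 / 2)\<^sup>2 \<le> 2 * (sg (b \<bullet> row X i) - success_prob X \<beta> i)\<^sup>2"
proof -
  obtain bs where bs: "\<And>k. bs k \<in> model_space (dim_col X) M"
      "(\<lambda>k. loglik X y (bs k)) \<longlonglongrightarrow> max_loglik X y M"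
      "\<And>i. i < dim_row X \<Longrightarrow> (\<lambda>k. ereal (bs k \<bullet> row X i)) \<longlonglongrightarrow> \<theta> i"
    using is_mle_predictor_imp_seq[OF mle] unfolding maximizing_seq_def by blast
  have sg0: "sg 0 = 1 / 2" by (simp add: sg_def)
  have "\<forall>\<^sub>F k in sequentially. (0 \<le> \<theta> i) \<noteq> bayes_classifier \<beta> (row X i) \<longrightarrow>
      (success_prob X \<beta> i - 1 / 2)\<^sup>2 \<le> 2 * (sg (bs k \<bullet> row X i) - success_prob X \<beta> i)\<^sup>2"
    if i: "i < dim_row X" for i
  proof (cases "0 \<le> \<theta> i")
    case True
    show ?thesis
    proof (cases "bayes_classifier \<beta> (row X i)")
      case False
      \<comment> \<open>A limit 0 may be approached from below. Beyond \<open>- ln (1 + h)\<close>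
        one has \<open>sg \<ge> 1 / (2 + h) \<ge> 1/2 - h/4\<close>, so at least 3/4 of the distance
        to \<open>1/2\<close> survives; the factor 2 in the claim is due to
        \<open>(3/4)\<^sup>2 \<ge> 1/2\<close>.\<close>
      define \<tau> where "\<tau> = ln (1 + h)"
      have "0 < \<tau>" using h by (simp add: \<tau>_def)
      then have "ereal (- \<tau>) < 0" by simp
      then have "ereal (- \<tau>) < \<theta> i" using True by (rule less_le_trans)
      from order_tendstoD(1)[OF bs(3)[OF i] this] show ?thesis
      proof eventually_elim
        case (elim k)
        have "1 / 2 - h / 4 \<le> sg (- \<tau>)"
          using h by (simp add: sg_def \<tau>_def field_simps)
        also have "\<dots> \<le> sg (bs k \<bullet> row X i)" using elim by (intro sg_mono) auto
        finally have sgk: "1 / 2 - h / 4 \<le> sg (bs k \<bullet> row X i)" .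
        have "success_prob X \<beta> i \<le> sg 0"
          using False unfolding success_prob_eq_sg bayes_classifier_def by (intro sg_mono) auto
        then have q: "h \<le> 1 / 2 - success_prob X \<beta> i" using p[OF i] sg0 by simp
        then have "3 / 4 * (1 / 2 - success_prob X \<beta> i) \<le> sg (bs k \<bullet> row X i) - success_prob X \<beta> i"
          using sgk by simp
        then have "(3 / 4 * (1 / 2 - success_prob X \<beta> i))\<^sup>2 \<le> (sg (bs k \<bullet> row X i) - success_prob X \<beta> i)\<^sup>2"
          using q h by (intro power_mono) auto
        moreover have "(3 / 4 * (1 / 2 - success_prob X \<beta> i))\<^sup>2 = 9 / 16 * (success_prob X \<beta> i - 1 / 2)\<^sup>2"
          by (simp add: power2_eq_square field_simps)
        moreover have "0 \<le> (success_prob X \<beta> i - 1 / 2)\<^sup>2" by simp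
        ultimately show ?case by linarith
      qed
    qed (simp add: True)
  next
    case neg: False
    show ?thesis
    proof (cases "bayes_classifier \<beta> (row X i)")
      case True
      have "\<theta> i < ereal 0" using neg unfolding zero_ereal_def by (rule not_le_imp_less)
      from order_tendstoD(2)[OF bs(3)[OF i] this] show ?thesis
      proof eventually_elim
        case (elim k)
        then have sgk: "sg (bs k \<bullet> row X i) \<le> 1 / 2" using sg_mono[of _ 0] sg0 by simp
        have "sg 0 \<le> success_prob X \<beta> i"
          using True unfolding success_prob_eq_sg bayes_classifier_def by (intro sg_mono) auto
        then have "(success_prob X \<beta> i - 1 / 2)\<^sup>2 \<le> (success_prob X \<beta> i - sg (bs k \<bullet> row X i))\<^sup>2"
          using sgk sg0 by (intro power_mono) auto
        moreover have "(success_prob X \<beta> i - sg (bs k \<bullet> row X i))\<^sup>2 = (sg (bs k \<bullet> row X i) - success_prob X \<beta> i)\<^sup>2"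
          by (rule power2_commute)
        moreover have "0 \<le> (sg (bs k \<bullet> row X i) - success_prob X \<beta> i)\<^sup>2" by simp
        ultimately show ?case by linarith
      qed
    qed (simp add: neg)
  qed
  then have "\<forall>\<^sub>F k in sequentially. \<forall>i\<in>{..<dim_row X}. (0 \<le> \<theta> i) \<noteq> bayes_classifier \<beta> (row X i) \<longrightarrow>
      (success_prob X \<beta> i - 1 / 2)\<^sup>2 \<le> 2 * (sg (bs k \<bullet> row X i) - success_prob X \<beta> i)\<^sup>2"
    by (intro eventually_ball_finite) auto
  moreover have "\<forall>\<^sub>F k in sequentially. max_loglik X y M - 1 < loglik X y (bs k)"
    by (rule order_tendstoD(1)[OF bs(2)]) simp
  ultimately have "\<forall>\<^sub>F k in sequentially. (\<forall>i\<in>{..<dim_row X}. (0 \<le> \<theta> i) \<noteq> bayes_classifier \<beta> (row X i) \<longrightarrow>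
      (success_prob X \<beta> i - 1 / 2)\<^sup>2 \<le> 2 * (sg (bs k \<bullet> row X i) - success_prob X \<beta> i)\<^sup>2) \<and>
      max_loglik X y M - 1 < loglik X y (bs k)" by (rule eventually_conj)
  from eventually_happens'[OF sequentially_bot this] obtain k where
    k: "\<forall>i\<in>{..<dim_row X}. (0 \<le> \<theta> i) \<noteq> bayes_classifier \<beta> (row X i) \<longrightarrow>
      (success_prob X \<beta> i - 1 / 2)\<^sup>2 \<le> 2 * (sg (bs k \<bullet> row X i) - success_prob X \<beta> i)\<^sup>2"
      "max_loglik X y M - 1 < loglik X y (bs k)" by blast
  show ?thesis using k by (intro that[of "bs k"] bs(1)) auto
qed

text \<open>Data sets are identified with their sets of ones. The default value \<open>False\<close>
  of \<open>Pi_pmf\<close> outside the index range confines the support to these finitely many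
  functions.\<close>

lemma expectation_data_pmf:
  "measure_pmf.expectation (data_pmf X \<beta>) f =
    (\<Sum>S\<in>Pow {..<dim_row X}. (\<Prod>i<dim_row X. coin (success_prob X \<beta>) i (i \<in> S)) * f (\<lambda>i. i \<in> S))"
proof -
  let ?n = "dim_row X" and ?A = "(\<lambda>S i. i \<in> S) ` Pow {..<dim_row X}"
  have pmf: "pmf (data_pmf X \<beta>) (\<lambda>i. i \<in> S) = (\<Prod>i<?n. coin (success_prob X \<beta>) i (i \<in> S))"
    if "S \<in> Pow {..<?n}" for S
  proof -
    have "0 \<le> success_prob X \<beta> i" "success_prob X \<beta> i \<le> 1" for i
      using sg_pos sg_less_1 by (simp_all add: success_prob_eq_sg less_imp_le)
    then have "pmf (bernoulli_pmf (success_prob X \<beta> i)) u = coin (success_prob X \<beta>) i u" for i u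
      by (cases u) (simp_all add: coin_def)
    then show ?thesis unfolding data_pmf_def using that by (subst pmf_Pi') auto
  qed
  have "set_pmf (data_pmf X \<beta>) \<subseteq> ?A"
  proof
    fix y assume "y \<in> set_pmf (data_pmf X \<beta>)"
    then have "\<And>i. i \<notin> {..<?n} \<Longrightarrow> y i = False"
      unfolding data_pmf_def using set_Pi_pmf_subset[of "{..<?n}" False] by fastforce
    then show "y \<in> ?A" by (intro image_eqI[of _ _ "{i. y i}"]) (auto intro: ccontr)
  qed
  then have "measure_pmf.expectation (data_pmf X \<beta>) f = (\<Sum>y\<in>?A. pmf (data_pmf X \<beta>) y *\<^sub>R f y)"
    by (intro integral_measure_pmf) (auto simp: set_pmf_iff)
  also have "\<dots> = (\<Sum>S\<in>Pow {..<?n}. pmf (data_pmf X \<beta>) (\<lambda>i. i \<in> S) * f (\<lambda>i. i \<in> S))"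
  proof -
    have "inj_on (\<lambda>S i. i \<in> S) (Pow {..<?n})" by (auto simp: inj_on_def fun_eq_iff)
    then show ?thesis by (simp add: sum.reindex)
  qed
  also have "\<dots> = (\<Sum>S\<in>Pow {..<?n}. (\<Prod>i<?n. coin (success_prob X \<beta>) i (i \<in> S)) * f (\<lambda>i. i \<in> S))"
    by (intro sum.cong refl arg_cong2[where f = times] pmf)
  finally show ?thesis .
qed

section \<open>Penalized model selection\<close>

lemma sum_inverse_le_ln:
  assumes "1 \<le> m" "m \<le> n"
  shows "(\<Sum>l\<in>{m<..n}. 1 / real l) \<le> ln (real n / real m)"
  using assms(2)
proof (induction n rule: dec_induct)
  case base
  then show ?case using assms(1) by simp
next
  case (step k)
  have k: "0 < real k" using step.hyps assms(1) by simp
  have "ln (real k / real (Suc k)) \<le> real k / real (Suc k) - 1" using k by (intro ln_le_minus_one) auto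
  also have "\<dots> = - (1 / real (Suc k))" by (simp add: field_simps)
  finally have "1 / real (Suc k) \<le> ln (real (Suc k)) - ln (real k)" using k by (simp add: ln_div)
  moreover have "{m<..Suc k} = insert (Suc k) {m<..k}" using step.hyps by auto
  moreover have "ln (real k / real m) = ln (real k) - ln (real m)"
    "ln (real (Suc k) / real m) = ln (real (Suc k)) - ln (real m)"
    using k assms(1) by (simp_all add: ln_div)
  ultimately show ?case using step.IH by (simp del: of_nat_Suc)
qed

text \<open>The sum is close to \<open>ln 2\<close>, which is at most \<open>25/36\<close>;
  \<open>200 \<le> n\<close> makes the rounding in \<open>n div 2\<close> small enough to stay below
  \<open>7/10\<close>.\<close>

lemma half_harmonic_le:
  assumes "200 \<le> n"
  shows "(\<Sum>l\<in>{n div 2<..n}. 1 / real l) \<le> 7 / 10"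
proof -
  have m: "1 \<le> n div 2" "real n - 1 \<le> 2 * real (n div 2)" using assms by linarith+
  have "(\<Sum>l\<in>{n div 2<..n}. 1 / real l) \<le> ln (real n / real (n div 2))"
    using m by (intro sum_inverse_le_ln) auto
  also have "\<dots> \<le> ln (2 * (200 / 199))"
  proof -
    have "real n * 199 \<le> 400 * real (n div 2)" using m(2) assms by linarith
    then have "real n / real (n div 2) \<le> 2 * (200 / 199)" using m(1) by (simp add: divide_simps)
    then show ?thesis using m(1) assms by (subst ln_le_cancel_iff) auto
  qed
  also have "ln (2 * (200 / 199 :: real)) = ln 2 + ln (200 / 199)" by (rule ln_mult_pos) auto
  also have "\<dots> \<le> 25 / 36 + (200 / 199 - 1)"
    by (intro add_mono ln2_le_25_over_36 ln_le_minus_one) auto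
  finally show ?thesis by simp
qed

text \<open>Here the constant 4 of the threshold matters: with \<open>lam \<ge> 1/8\<close> the
  right side is at least \<open>99/200 * L / D\<close>. In \<open>L\<close> it grows at a rate of at
  least \<open>99/50\<close>, the left side at the rate \<open>3/2\<close>, so \<open>L = 1\<close>
  is the critical case.\<close>

lemma penalty_dominates:
  fixes \<delta> c lam H L :: real
  assumes \<delta>: "0 < \<delta>" "\<delta> < 1 / 2" and c: "4 / (\<delta> * (1 - \<delta>)) < c" and lam: "1 / 8 \<le> lam"
    and H: "0 \<le> H" "H \<le> 7 / 10" and L: "1 \<le> L"
  shows "3 / 2 * L - 1 + (1 / 4 + 2 / (3 * \<delta>)) * H + 7 / 100 \<le> 99 / 100 * lam * (c * L)"
proof -
  define D where "D = \<delta> * (1 - \<delta>)"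
  have D: "0 < D" using \<delta> by (simp add: D_def)
  have "D = 1 / 4 - (\<delta> - 1 / 2)\<^sup>2" by (simp add: D_def power2_eq_square algebra_simps)
  then have D4: "D \<le> 1 / 4" using zero_le_power2[of "\<delta> - 1 / 2"] by linarith
  have Dinv: "4 \<le> 1 / D" using D D4 by (simp add: field_simps)
  have "(1 / 4 + 2 / (3 * \<delta>)) * H \<le> (1 / 4 + 2 / (3 * \<delta>)) * (7 / 10)"
    using H \<delta> by (intro mult_left_mono add_nonneg_nonneg) auto
  also have "\<dots> = 7 / 40 + 7 / 15 * (1 - \<delta>) * (1 / D)"
    using \<delta> by (simp add: D_def field_simps)
  finally have 1: "(1 / 4 + 2 / (3 * \<delta>)) * H \<le> 7 / 40 + 7 / 15 * (1 - \<delta>) * (1 / D)" .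
  \<comment> \<open>\<open>745/1000 = 3/2 - 1 + 7/40 + 7/100\<close> collects the constants at
    \<open>L = 1\<close>, and \<open>187/1000\<close> is near the minimizer of the quadratic to be
    shown nonnegative, whose minimum is only about 0.002.\<close>
  have "0 \<le> 745 / 1000 * (\<delta> - 187 / 1000)\<^sup>2" by simp
  also have "\<dots> = 745 / 1000 * \<delta>\<^sup>2 - 27863 / 100000 * \<delta> + 26051905 / 1000000000"
    by (simp add: power2_eq_square algebra_simps)
  finally have sq: "0 \<le> 745 / 1000 * \<delta>\<^sup>2 - 27863 / 100000 * \<delta> + 26051905 / 1000000000" .
  have "745 / 1000 * (\<delta> - q) + 7 / 15 * (1 - \<delta>) \<le> 99 / 200"
    if "0 \<le> 745 / 1000 * q - 27863 / 100000 * \<delta> + 26051905 / 1000000000" for q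
    using that \<delta> by (linarith | argo | (simp add: field_simps))
  from this[OF sq] have "745 / 1000 * (\<delta> - \<delta>\<^sup>2) + 7 / 15 * (1 - \<delta>) \<le> 99 / 200" .
  then have "745 / 1000 * D + 7 / 15 * (1 - \<delta>) \<le> 99 / 200"
    by (simp add: D_def power2_eq_square algebra_simps)
  then have "(745 / 1000 * D + 7 / 15 * (1 - \<delta>)) * (1 / D) \<le> 99 / 200 * (1 / D)"
    using D by (intro mult_right_mono) auto
  moreover have "(745 / 1000 * D + y) * (1 / D) = 745 / 1000 + y * (1 / D)" for y
    using D by (simp add: add_divide_distrib)
  ultimately have 2: "745 / 1000 + 7 / 15 * (1 - \<delta>) * (1 / D) \<le> 99 / 200 * (1 / D)"
    by (simp only:)
  have "4 * (L - 1) \<le> 1 / D * (L - 1)" using Dinv L by (intro mult_right_mono) auto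
  then have 3: "99 / 200 * (1 / D) + 99 / 50 * (L - 1) \<le> 99 / 200 * (1 / D * L)"
    by (simp add: right_diff_distrib)
  have "4 * (1 / D) * L \<le> c * L" using c L by (intro mult_right_mono) (auto simp: D_def)
  moreover have "0 < 4 / D" using D by simp
  then have "0 < c" using c unfolding D_def[symmetric] by linarith
  then have "0 \<le> c * L" using L by simp
  then have c8: "1 / 8 * (c * L) \<le> lam * (c * L)" using lam by (intro mult_right_mono) auto
  ultimately have 4: "99 / 200 * (1 / D * L) \<le> 99 / 100 * lam * (c * L)" using c8 by simp
  have "3 / 2 * L - 1 + (7 / 40 + y) + 7 / 100 \<le> z"
    if "745 / 1000 + y \<le> 99 / 200 * x" "99 / 200 * x + 99 / 50 * (L - 1) \<le> z" for x y z :: real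
    using that L by (linarith | argo | (simp add: field_simps))
  from this[OF 2 order_trans[OF 3 4]] show ?thesis using 1 by linarith
qed

lemma sum_subsets_by_card:
  assumes "finite A"
  shows "(\<Sum>M\<in>{M. M \<subseteq> A \<and> card M < r}. f (card M)) = (\<Sum>k<r. real (card A choose k) * f k)"
proof -
  have fin: "finite {M. M \<subseteq> A \<and> card M < r}" by (rule finite_subset[of _ "Pow A"]) (use assms in auto)
  have "(\<Sum>M\<in>{M. M \<subseteq> A \<and> card M < r}. f (card M))
      = (\<Sum>k\<in>{..<r}. \<Sum>M\<in>{M \<in> {M. M \<subseteq> A \<and> card M < r}. card M = k}. f (card M))"
    by (rule sum.group[symmetric]) (use fin in auto)
  also have "\<dots> = (\<Sum>k<r. real (card A choose k) * f k)"
  proof (rule sum.cong[OF refl])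
    fix k assume "k \<in> {..<r}"
    then have "{M \<in> {M. M \<subseteq> A \<and> card M < r}. card M = k} = {M. M \<subseteq> A \<and> card M = k}" by auto
    then show "(\<Sum>M\<in>{M \<in> {M. M \<subseteq> A \<and> card M < r}. card M = k}. f (card M)) = real (card A choose k) * f k"
      using n_subsets[OF assms, of k] by simp
  qed
  finally show ?thesis .
qed

text \<open>For each size \<open>k\<close> the number of models and the moment bound are paid for by
  the penalty up to \<open>exp (- 7 * k / 100) \<le> (15/16) ^ k\<close>, and the geometric series
  sums to at most 16. \<open>Mr\<close> stands for all models of size \<open>r\<close>, whose
  penalty has no logarithm to pay for their number.\<close>

lemma penalized_union_bound:
  assumes \<delta>: "0 < \<delta>" "\<delta> < 1 / 2" and c: "4 / (\<delta> * (1 - \<delta>)) < c" and lam: "1 / 8 \<le> lam"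
    and H: "0 \<le> H" "H \<le> 7 / 10" and r: "1 \<le> r" "r \<le> d" and Mr: "card Mr = r"
  defines "C \<equiv> (1 / 4 + 2 / (3 * \<delta>)) * H"
  shows "(\<Sum>M\<in>insert Mr {M. M \<subseteq> {..<d} \<and> card M < r}.
      exp (C * (real (card M) + 1) - 99 / 100 * lam * complexity_pen c d r (card M))) \<le> 16 * exp C"
proof -
  let ?F = "{M. M \<subseteq> {..<d} \<and> card M < r}"
  define f where "f k = exp (C * (real k + 1) - 99 / 100 * lam * complexity_pen c d r k)" for k
  have fin: "finite ?F" by (rule finite_subset[of _ "Pow {..<d}"]) auto
  have q: "exp (- (real k * (7 / 100))) \<le> (15 / 16) ^ k" for k
  proof -
    have "ln (16 / 15 :: real) \<le> 16 / 15 - 1" by (intro ln_le_minus_one) auto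
    then have "- (7 / 100) \<le> ln (15 / 16 :: real)" by (simp add: ln_div)
    then have "exp (- (7 / 100)) \<le> exp (ln (15 / 16 :: real))" by (simp only: exp_le_cancel_iff)
    then have "exp (- (7 / 100)) \<le> (15 / 16 :: real)" by simp
    then have "exp (- (7 / 100)) ^ k \<le> (15 / 16 :: real) ^ k" by (intro power_mono) auto
    then show ?thesis by (simp add: exp_of_nat_mult[symmetric])
  qed
  have low: "real (d choose k) * f k \<le> exp C * (15 / 16) ^ k" if k: "k < r" for k
  proof (cases "k = 0")
    case False
    have kd: "1 \<le> k" "k \<le> d" using False k r by auto
    define L where "L = ln (real d * exp 1 / real k)"
    have L1: "1 \<le> L" using kd by (simp add: L_def ln_mult ln_div)
    have "real k * (3 / 2 * L - 1 + C + 7 / 100) \<le> real k * (99 / 100 * lam * (c * L))"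
      unfolding C_def by (intro mult_left_mono penalty_dominates[OF \<delta> c lam H L1]) auto
    moreover have "ln (d choose k) \<le> real k * (3 / 2 * L - 1)"
      unfolding L_def using kd by (rule ln_binomial_le)
    moreover have "complexity_pen c d r k = c * real k * L" using False k by (simp add: complexity_pen_def L_def)
    ultimately have "ln (d choose k) + (C * (real k + 1) - 99 / 100 * lam * complexity_pen c d r k) \<le> C + - (real k * (7 / 100))"
      by (simp add: algebra_simps)
    then have "exp (ln (d choose k) + (C * (real k + 1) - 99 / 100 * lam * complexity_pen c d r k)) \<le> exp (C + - (real k * (7 / 100)))"
      by (simp only: exp_le_cancel_iff)
    also have "exp (ln (d choose k) + (C * (real k + 1) - 99 / 100 * lam * complexity_pen c d r k)) = real (d choose k) * f k"
      using kd by (simp only: exp_add f_def) (simp add: zero_less_binomial)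
    also have "exp (C + - (real k * (7 / 100))) \<le> exp C * (15 / 16) ^ k"
      unfolding exp_add by (intro mult_left_mono q) auto
    finally show ?thesis .
  qed (simp add: f_def complexity_pen_def)
  have top: "f r \<le> exp C * (15 / 16) ^ r"
  proof -
    have "3 / 2 * 1 - 1 + C + 7 / 100 \<le> 99 / 100 * lam * (c * 1)"
      unfolding C_def by (rule penalty_dominates[OF \<delta> c lam H]) simp
    then have "real r * (C + 7 / 100) \<le> real r * (99 / 100 * lam * c)" by (intro mult_left_mono) auto
    moreover have "complexity_pen c d r r = c * real r" using r by (simp add: complexity_pen_def)
    ultimately have "C * (real r + 1) - 99 / 100 * lam * complexity_pen c d r r \<le> C + - (real r * (7 / 100))"
      by (simp add: algebra_simps)
    then have "f r \<le> exp (C + - (real r * (7 / 100)))" unfolding f_def by (simp only: exp_le_cancel_iff)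
    also have "\<dots> \<le> exp C * (15 / 16) ^ r" unfolding exp_add by (intro mult_left_mono q) auto
    finally show ?thesis .
  qed
  have "(\<Sum>M\<in>insert Mr ?F. f (card M)) = f r + (\<Sum>M\<in>?F. f (card M))" using fin Mr by simp
  also have "(\<Sum>M\<in>?F. f (card M)) = (\<Sum>k<r. real (d choose k) * f k)"
    using sum_subsets_by_card[of "{..<d}" f r] by simp
  also have "f r + \<dots> \<le> exp C * (15 / 16) ^ r + (\<Sum>k<r. exp C * (15 / 16) ^ k)"
    by (intro add_mono top sum_mono low) auto
  also have "\<dots> = exp C * (\<Sum>k<Suc r. (15 / 16) ^ k)" by (simp add: sum_distrib_left distrib_left)
  also have "(\<Sum>k<Suc r. (15 / 16 :: real) ^ k) \<le> 16"
    unfolding sum_gp_strict by simp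
  finally show ?thesis by (simp add: f_def mult.commute)
qed

text \<open>A choice in a model of size \<open>r\<close> is moved into the representative
  \<open>Mr\<close> without changing its predictor. The union bound over \<open>F\<close> then
  controls an exponential moment of \<open>U\<close>, with comparison terms
  \<open>c * V + 1\<close>, and a tangent of \<open>exp\<close> turns it into a bound on the
  mean.\<close>

lemma prediction_error_bound:
  assumes X: "X \<in> carrier_mat n d" and r: "vec_space.rank n X = r" and ind: "any_cols_indep X r"
    and n: "200 \<le> n" and h: "0 < h" and \<Delta>: "\<Delta> < 1 / 2" and \<delta>: "\<delta> = 1 / 2 - \<Delta>" "0 < \<Delta>"
    and c: "4 / (\<delta> * (1 - \<delta>)) < c" and d0: "1 \<le> d0" "d0 \<le> r"
    and \<beta>: "\<beta> \<in> carrier_vec d" "l0_norm \<beta> \<le> d0"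
    and p: "\<And>i. i < n \<Longrightarrow> h \<le> \<bar>success_prob X \<beta> i - 1 / 2\<bar> \<and> \<bar>success_prob X \<beta> i - 1 / 2\<bar> \<le> \<Delta>"
    and sel: "\<And>y. is_selected_model c r X y (Mhat y)"
    and b: "\<And>y. b y \<in> model_space d (Mhat y)" "\<And>y. max_loglik X y (Mhat y) - 1 \<le> loglik X y (b y)"
  defines "V \<equiv> min (real d0 * ln (real d * exp 1 / real d0)) (real r)"
  assumes V: "1 \<le> V"
  shows "measure_pmf.expectation (data_pmf X \<beta>) (\<lambda>y. \<Sum>i<n. (sg (b y \<bullet> row X i) - success_prob X \<beta> i)\<^sup>2)
    \<le> (200 * c + 13000) * V"
proof -
  have dX: "dim_col X = d" "dim_row X = n" using X by auto
  have rd: "r \<le> d" using rank_le_dim_col[OF X] r by simp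
  have r1: "1 \<le> r" using d0 by simp
  have \<delta>': "0 < \<delta>" "\<delta> < 1 / 2" using \<Delta> \<delta> by auto
  have "1 / \<delta> \<le> 1 / (\<delta> * (1 - \<delta>))" using \<delta>' by (intro divide_left_mono) (auto simp: mult_le_cancel_left1)
  then have c\<delta>: "4 * (1 / \<delta>) < c" using c by simp
  moreover have "0 < 1 / \<delta>" using \<delta>' by simp
  ultimately have c0: "0 < c" by linarith
  define lam where "lam = 1 / 4 * (1 - real (n div 2) / real n)"
  define H where "H = (\<Sum>l\<in>{n div 2<..n}. 1 / real l)"
  define C where "C = (1 / 4 + 2 / (3 * \<delta>)) * H"
  have H: "0 \<le> H" "H \<le> 7 / 10" using half_harmonic_le[OF n] by (auto simp: H_def intro: sum_nonneg)
  have lam: "1 / 8 \<le> lam"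
  proof -
    have "real (n div 2) \<le> real n / 2" by linarith
    then have "real (n div 2) / real n \<le> 1 / 2" using n by (simp add: divide_simps)
    then show ?thesis by (simp add: lam_def)
  qed
  obtain Mr where Mr: "Mr \<subseteq> {..<d}" "card Mr = r" using obtain_subset_with_card_n[of r "{..<d}"] rd by auto
  define F where "F = insert Mr {M. M \<subseteq> {..<d} \<and> card M < r}"
  have fF: "finite F" unfolding F_def by (rule finite.insertI, rule finite_subset[of _ "Pow {..<d}"]) auto
  have FM: "M \<subseteq> {..<d}" if "M \<in> F" for M using that Mr by (auto simp: F_def)
  define Y where "Y S = (\<lambda>i :: nat. i \<in> S)" for S
  have Mh: "Mhat y \<subseteq> {..<d}" "card (Mhat y) \<le> r" for y
    using sel[of y] unfolding is_selected_model_def is_arg_min_def dX by auto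
  have "\<exists>M b'. M \<in> F \<and> card M = card (Mhat y) \<and> b' \<in> model_space d M \<and> (\<forall>i<n. b' \<bullet> row X i = b y \<bullet> row X i)" for y
  proof (cases "card (Mhat y) < r")
    case True
    then show ?thesis using Mh[of y] b(1)[of y] unfolding F_def by blast
  next
    case False
    then have cr: "card (Mhat y) = r" using Mh(2)[of y] by simp
    have bc: "b y \<in> carrier_vec d" using b(1)[of y] by (simp add: model_space_def)
    obtain b' where "b' \<in> model_space d Mr" "\<And>i. i < n \<Longrightarrow> b' \<bullet> row X i = b y \<bullet> row X i"
      using spanning_columns[OF X r ind Mr bc] by blast
    then show ?thesis using cr Mr unfolding F_def by blast
  qed
  then obtain N b' where N: "\<And>y. N y \<in> F" "\<And>y. card (N y) = card (Mhat y)"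
      and b': "\<And>y. b' y \<in> model_space d (N y)" "\<And>y i. i < n \<Longrightarrow> b' y \<bullet> row X i = b y \<bullet> row X i"
    by metis
  define W where "W S = (\<Prod>i<n. coin (success_prob X \<beta>) i (i \<in> S))" for S
  have W0: "0 \<le> W S" for S
    unfolding W_def coin_success_prob by (intro prod_nonneg) (auto simp: sg_pos less_imp_le)
  have W1: "(\<Sum>S\<in>Pow {..<n}. W S) = 1"
    using expectation_data_pmf[of X \<beta> "\<lambda>_. 1"] by (simp add: dX W_def)
  define U where "U S = (\<Sum>i<n. (sg (b (Y S) \<bullet> row X i) - success_prob X \<beta> i)\<^sup>2)" for S
  define G where "G S v = lam * (99 / 100 * (loglik X (Y S) v - loglik X (Y S) \<beta>)
      + 1 / 100 * (\<Sum>i<n. (sg (v \<bullet> row X i) - success_prob X \<beta> i)\<^sup>2))" for S v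
  have Gb': "G S (b' (Y S)) = G S (b (Y S))" for S
    unfolding G_def loglik_def dX using b'(2) by simp
  have moment: "(\<Sum>S\<in>Pow {..<n}. W S * (of_bool (N (Y S) = M) * exp (G S (b (Y S))))) \<le> exp (C * (real (card M) + 1))"
    if M: "M \<in> F" for M
  proof -
    \<comment> \<open>Where another model is selected the value is the zero vector, so that
      \<open>v S\<close> lies in the model for every \<open>S\<close> and the moment bound applies
      to the restricted sum.\<close>
    define v where "v S = (if N (Y S) = M then b' (Y S) else 0\<^sub>v d)" for S
    have "(\<Sum>S\<in>Pow {..<n}. W S * (of_bool (N (Y S) = M) * exp (G S (b (Y S))))) \<le> (\<Sum>S\<in>Pow {..<n}. W S * exp (G S (v S)))"
    proof (intro sum_mono mult_left_mono W0)
      fix S show "of_bool (N (Y S) = M) * exp (G S (b (Y S))) \<le> exp (G S (v S))"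
        by (cases "N (Y S) = M") (simp_all add: v_def Gb')
    qed
    also have "\<dots> \<le> exp ((1 / 4 + 2 / (3 * \<delta>)) * (real (card M) + 1) * H)"
      unfolding W_def G_def Y_def lam_def H_def
    proof (rule model_likelihood_moment[OF X \<beta>(1) FM[OF M] _ \<delta>'(1)])
      show "\<beta> \<bullet> row X i \<noteq> 0" if "i < n" for i
        using p[OF that] h by (auto simp: success_prob_eq_sg sg_def)
      show "\<delta> \<le> success_prob X \<beta> i \<and> success_prob X \<beta> i \<le> 1 - \<delta>" if "i < n" for i
        using p[OF that] \<delta>(1) by (auto simp: abs_le_iff)
      show "n div 2 < n" using n by simp
      show "v S \<in> model_space d M" for S
        using b'(1)[of "Y S"] zero_in_model_space[of d M] by (auto simp: v_def)
    qed
    finally show ?thesis by (simp add: C_def mult_ac)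
  qed
  \<comment> \<open>\<open>c * V\<close> comes from the comparison with the truth, the summand 1
    from \<open>b y\<close> being only a near-maximizer.\<close>
  define a0 where "a0 = 99 / 100 * lam * (c * V + 1)"
  have key: "1 / 100 * lam * U S - a0 \<le> G S (b (Y S)) - 99 / 100 * lam * complexity_pen c d r (card (N (Y S)))" for S
  proof -
    have "loglik X (Y S) \<beta> + complexity_pen c d r (card (Mhat (Y S))) \<le> max_loglik X (Y S) (Mhat (Y S)) + c * V"
      unfolding V_def using c0 by (intro selected_model_loglik[OF X r ind \<beta> d0 _ sel]) simp
    then have "complexity_pen c d r (card (N (Y S))) - c * V - 1 \<le> loglik X (Y S) (b (Y S)) - loglik X (Y S) \<beta>"
      using b(2)[of "Y S"] by (simp add: N(2))
    then have "99 / 100 * lam * (complexity_pen c d r (card (N (Y S))) - c * V - 1)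
        \<le> 99 / 100 * lam * (loglik X (Y S) (b (Y S)) - loglik X (Y S) \<beta>)"
      using lam by (intro mult_left_mono) auto
    moreover have "1 / 100 * lam * u - 99 / 100 * lam * (v + 1) \<le> lam * (99 / 100 * l + 1 / 100 * u) - 99 / 100 * lam * q"
      if "99 / 100 * lam * (q - v - 1) \<le> 99 / 100 * lam * l" for u v l q :: real
    proof -
      have "lam * (99 / 100 * l + 1 / 100 * u) - 99 / 100 * lam * q - (1 / 100 * lam * u - 99 / 100 * lam * (v + 1))
          = 99 / 100 * lam * l - 99 / 100 * lam * (q - v - 1)"
        by (Groebner_Basis.algebra | (simp add: algebra_simps) | (simp add: field_simps))
      with that show ?thesis by linarith
    qed
    ultimately show ?thesis unfolding G_def a0_def U_def by blast
  qed
  have exp_split: "exp (u - v) = exp u * exp (- v)" for u v :: real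
    using exp_add[of u "- v"] by simp
  have "(\<Sum>S\<in>Pow {..<n}. W S * exp (1 / 100 * lam * U S - a0))
    \<le> (\<Sum>S\<in>Pow {..<n}. W S * (\<Sum>M\<in>F. of_bool (N (Y S) = M) * exp (G S (b (Y S))) * exp (- (99 / 100 * lam * complexity_pen c d r (card M)))))"
  proof (intro sum_mono mult_left_mono W0)
    fix S
    have "exp (1 / 100 * lam * U S - a0) \<le> exp (G S (b (Y S)) - 99 / 100 * lam * complexity_pen c d r (card (N (Y S))))"
      using key[of S] by (simp only: exp_le_cancel_iff)
    also have "\<dots> = of_bool (N (Y S) = N (Y S)) * exp (G S (b (Y S))) * exp (- (99 / 100 * lam * complexity_pen c d r (card (N (Y S)))))"
      by (simp add: exp_split)
    also have "\<dots> \<le> (\<Sum>M\<in>F. of_bool (N (Y S) = M) * exp (G S (b (Y S))) * exp (- (99 / 100 * lam * complexity_pen c d r (card M))))"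
      using N(1)[of "Y S"] fF
      by (intro member_le_sum[of "N (Y S)" F "\<lambda>M. of_bool (N (Y S) = M) * exp (G S (b (Y S))) * exp (- (99 / 100 * lam * complexity_pen c d r (card M)))"]) auto
    finally show "exp (1 / 100 * lam * U S - a0)
      \<le> (\<Sum>M\<in>F. of_bool (N (Y S) = M) * exp (G S (b (Y S))) * exp (- (99 / 100 * lam * complexity_pen c d r (card M))))" .
  qed
  also have "\<dots> = (\<Sum>M\<in>F. (\<Sum>S\<in>Pow {..<n}. W S * (of_bool (N (Y S) = M) * exp (G S (b (Y S))))) * exp (- (99 / 100 * lam * complexity_pen c d r (card M))))"
    unfolding sum_distrib_left sum_distrib_right by (subst sum.swap) (simp only: mult.assoc)
  also have "\<dots> \<le> (\<Sum>M\<in>F. exp (C * (real (card M) + 1)) * exp (- (99 / 100 * lam * complexity_pen c d r (card M))))"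
    by (intro sum_mono mult_right_mono moment) auto
  also have "\<dots> = (\<Sum>M\<in>F. exp (C * (real (card M) + 1) - 99 / 100 * lam * complexity_pen c d r (card M)))"
    by (simp only: exp_split)
  also have "\<dots> \<le> 16 * exp C"
    unfolding F_def C_def by (rule penalized_union_bound[OF \<delta>' c lam H r1 rd Mr(2)])
  finally have total: "(\<Sum>S\<in>Pow {..<n}. W S * exp (1 / 100 * lam * U S - a0)) \<le> 16 * exp C" .
  \<comment> \<open>Jensen's inequality in the form \<open>x \<le> exp (x - a) + a - 1\<close>, with
    \<open>exp a\<close> equal to the bound on the exponential moment.\<close>
  define a where "a = C + ln 16"
  have ea: "exp a = 16 * exp C" by (simp add: a_def exp_add)
  have "(\<Sum>S\<in>Pow {..<n}. W S * (1 / 100 * lam * U S - a0)) \<le> (\<Sum>S\<in>Pow {..<n}. W S * (exp (1 / 100 * lam * U S - a0) * exp (- a) + (a - 1)))"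
  proof (intro sum_mono mult_left_mono W0)
    fix S
    have "1 + (1 / 100 * lam * U S - a0 + - a) \<le> exp (1 / 100 * lam * U S - a0 + - a)" by (rule exp_ge_add_one_self)
    then show "1 / 100 * lam * U S - a0 \<le> exp (1 / 100 * lam * U S - a0) * exp (- a) + (a - 1)"
      unfolding exp_add by simp
  qed
  also have "\<dots> = (\<Sum>S\<in>Pow {..<n}. W S * exp (1 / 100 * lam * U S - a0)) * exp (- a) + (a - 1)"
  proof -
    have "(\<Sum>S\<in>Pow {..<n}. W S * (g S * x + y)) = (\<Sum>S\<in>Pow {..<n}. W S * g S) * x + y"
      for g :: "nat set \<Rightarrow> real" and x y
      by (simp only: distrib_left sum.distrib mult.assoc[symmetric] sum_distrib_right[symmetric] W1 mult_1_left)
    then show ?thesis .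
  qed
  also have "\<dots> \<le> 16 * exp C * exp (- a) + (a - 1)"
    by (intro add_right_mono mult_right_mono total) auto
  also have "\<dots> = a" unfolding ea[symmetric] by (simp add: exp_minus)
  finally have le: "(\<Sum>S\<in>Pow {..<n}. W S * (1 / 100 * lam * U S - a0)) \<le> a" .
  define EU where "EU = (\<Sum>S\<in>Pow {..<n}. W S * U S)"
  have "(\<Sum>S\<in>Pow {..<n}. W S * (1 / 100 * lam * U S - a0)) = 1 / 100 * lam * EU - a0"
  proof -
    have "W S * (1 / 100 * lam * U S - a0) = 1 / 100 * lam * (W S * U S) - W S * a0" for S by (simp add: algebra_simps)
    then show ?thesis by (simp only: EU_def sum_subtractf sum_distrib_left[symmetric] sum_distrib_right[symmetric] W1 mult_1)
  qed
  with le have "1 / 100 * lam * EU - a0 \<le> a" by (simp only:)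
  moreover have "lam * x \<le> lam * (99 * q) + 100 * a" if "1 / 100 * lam * x - 99 / 100 * lam * q \<le> a" for x q :: real
    using that by (linarith | (simp add: algebra_simps) | (simp add: field_simps))
  ultimately have "lam * EU \<le> lam * (99 * (c * V + 1)) + 100 * a" unfolding a0_def by blast
  moreover have a: "0 \<le> a" "100 * a \<le> 100 * a * (8 * lam)"
  proof -
    show "0 \<le> a" using H \<delta>' by (simp add: a_def C_def)
    then have "100 * a * 1 \<le> 100 * a * (8 * lam)" using lam by (intro mult_left_mono) auto
    then show "100 * a \<le> 100 * a * (8 * lam)" by simp
  qed
  ultimately have "lam * EU \<le> lam * (99 * (c * V + 1) + 800 * a)" by (simp add: algebra_simps)
  then have EU: "EU \<le> 99 * (c * V + 1) + 800 * a" using lam by (simp add: mult_le_cancel_left_pos)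
  \<comment> \<open>\<open>4 / \<delta> < c\<close> bounds the term \<open>1 / \<delta>\<close> in
    \<open>C\<close> by a multiple of \<open>c\<close>, so that the final constant depends on
    \<open>c\<close> alone.\<close>
  have "a \<le> 16 + c / 8"
  proof -
    have "ln (16 :: real) \<le> 15" using ln_le_minus_one[of "16 :: real"] by simp
    moreover have "C \<le> (1 / 4 + 2 / (3 * \<delta>)) * (7 / 10)"
      unfolding C_def using H \<delta>' by (intro mult_left_mono add_nonneg_nonneg) auto
    moreover have "2 / (3 * \<delta>) = 2 / 3 * (1 / \<delta>)" by simp
    moreover have "v + l \<le> 16 + c / 8" if "l \<le> 15" "v \<le> (1 / 4 + y) * (7 / 10)" "y = 2 / 3 * x" "4 * x < c" for l v x y :: real
      using that c0 by (simp only: that(3)) (linarith | (simp add: algebra_simps) | (simp add: field_simps))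
    ultimately show ?thesis using c\<delta> unfolding a_def by blast
  qed
  then have "EU \<le> 99 * (c * V) + (99 + 800 * (16 + c / 8)) * 1" using EU by simp
  also have "\<dots> \<le> 99 * (c * V) + (99 + 800 * (16 + c / 8)) * V"
    using V c0 by (intro add_left_mono mult_left_mono) auto
  also have "\<dots> \<le> (200 * c + 13000) * V"
  proof -
    have "0 \<le> c * V" using V c0 by simp
    then show ?thesis using V by (simp add: algebra_simps)
  qed
  finally show ?thesis
    unfolding expectation_data_pmf dX EU_def W_def U_def Y_def .
qed

lemma excess_risk_bound:
  fixes c h \<Delta> \<delta> :: real
  assumes X: "X \<in> carrier_mat n d" and r: "vec_space.rank n X = r" and ind: "any_cols_indep X r"
    and h: "0 < h" "h < \<Delta>" "\<Delta> < 1 / 2" and \<delta>: "\<delta> = 1 / 2 - \<Delta>" and c: "4 / (\<delta> * (1 - \<delta>)) < c"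
    and d0: "1 \<le> d0" "d0 \<le> r" and sel: "\<And>y. is_selected_model c r X y (Mhat y)"
    and mle: "\<And>y. is_mle_predictor X y (Mhat y) (\<theta>hat y)" and \<beta>: "\<beta> \<in> admissible_coeffs X d0 h \<Delta>"
  defines "K \<equiv> 200 * \<bar>c\<bar> + 13000" and "V \<equiv> min (real d0 * ln (real d * exp 1 / real d0)) (real r)"
    and "\<phi> \<equiv> (1 - 4 * h\<^sup>2) / (1 - 4 * \<Delta>\<^sup>2)"
  shows "excess_risk X \<beta> (\<lambda>y i. \<theta>hat y i \<ge> 0)
    \<le> (4 * K + 100) * min (sqrt (\<phi> * (V / real n))) (\<phi> * (V / (real n * h)))"
proof -
  have dX: "dim_col X = d" "dim_row X = n" using X by auto
  define p where "p = success_prob X \<beta>"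
  have \<beta>': "\<beta> \<in> carrier_vec d" "l0_norm \<beta> \<le> d0"
    and p: "\<And>i. i < n \<Longrightarrow> h \<le> \<bar>p i - 1 / 2\<bar> \<and> \<bar>p i - 1 / 2\<bar> \<le> \<Delta>"
    using \<beta> by (auto simp: admissible_coeffs_def dX p_def)
  have rd: "r \<le> d" using rank_le_dim_col[OF X] r by simp
  have V: "1 \<le> V"
  proof -
    have "1 \<le> ln (real d * exp 1 / real d0)" using rd d0 by (simp add: ln_mult ln_div)
    then have "1 * 1 \<le> real d0 * ln (real d * exp 1 / real d0)" using d0 by (intro mult_mono) auto
    then show ?thesis using d0 by (simp add: V_def)
  qed
  have K: "13000 \<le> K" by (simp add: K_def)
  have "\<Delta>\<^sup>2 < (1 / 2)\<^sup>2" "h\<^sup>2 \<le> \<Delta>\<^sup>2" using h by (auto intro!: power_strict_mono power_mono)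
  then have "4 * \<Delta>\<^sup>2 < 1" "4 * h\<^sup>2 \<le> 4 * \<Delta>\<^sup>2" by (simp_all add: power_divide)
  \<comment> \<open>\<open>h < \<Delta>\<close> makes the ratio at least 1; it is inserted at the
    end into the bounds of \<open>main\<close>.\<close>
  then have \<phi>: "1 \<le> \<phi>" unfolding \<phi>_def by (subst le_divide_eq_1_pos) linarith+
  define mis where "mis y i \<longleftrightarrow> (0 \<le> \<theta>hat y i) \<noteq> bayes_classifier \<beta> (row X i)" for y i
  define P where "P i = measure_pmf.prob (data_pmf X \<beta>) {y. mis y i}" for i
  define e where "e = excess_risk X \<beta> (\<lambda>y i. \<theta>hat y i \<ge> 0)"
  have P01: "0 \<le> P i" "P i \<le> 1" for i by (simp_all add: P_def)
  have e: "e = (\<Sum>i<n. P i * \<bar>2 * p i - 1\<bar>) / real n"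
    unfolding e_def excess_risk_alt dX P_def mis_def p_def ..
  have main: "e \<le> (4 * K + 100) * sqrt (V / real n) \<and> e \<le> (4 * K + 100) * (V / (real n * h))" if n0: "0 < n"
  proof (cases "200 \<le> n")
    \<comment> \<open>The summand 100 of the constant serves this case: \<open>e \<le> 1\<close>,
      while for \<open>n < 200\<close> and \<open>h < 1/2\<close> both \<open>sqrt (V / n)\<close>
      and \<open>V / (n * h)\<close> are at least \<open>1/100\<close>.\<close>
    case False
    have "(\<Sum>i<n. P i * \<bar>2 * p i - 1\<bar>) \<le> (\<Sum>i<n. 1 * 1)"
    proof (intro sum_mono mult_mono P01)
      fix i assume "i \<in> {..<n}"
      then have "\<bar>p i - 1 / 2\<bar> \<le> 1 / 2" using p[of i] h by auto
      moreover have "\<bar>2 * p i - 1\<bar> = 2 * \<bar>p i - 1 / 2\<bar>" by (simp add: abs_if)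
      ultimately show "\<bar>2 * p i - 1\<bar> \<le> 1" by linarith
    qed auto
    then have e1: "e \<le> 1" unfolding e using n0 by simp
    have "(1 / 100)\<^sup>2 \<le> 1 / real n" using False n0 by (simp add: power2_eq_square field_simps)
    also have "\<dots> \<le> V / real n" using V by (intro divide_right_mono) auto
    finally have "1 / 100 \<le> sqrt (V / real n)" by (rule real_le_rsqrt)
    then have 1: "(4 * K + 100) * (1 / 100) \<le> (4 * K + 100) * sqrt (V / real n)" using K by (intro mult_left_mono) auto
    have "real n * h \<le> 200 * (1 / 2)" using False h by (intro mult_mono) auto
    then have "1 / 100 \<le> 1 / (real n * h)" using n0 h by (intro divide_left_mono) auto
    also have "\<dots> \<le> V / (real n * h)" using V h by (intro divide_right_mono) auto
    finally have 2: "(4 * K + 100) * (1 / 100) \<le> (4 * K + 100) * (V / (real n * h))" using K by (intro mult_left_mono) auto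
    have "1 \<le> (4 * K + 100) * (1 / 100)" using K by simp
    then show ?thesis using e1 1 2 by linarith
  next
    case n: True
    have "\<exists>b. b \<in> model_space d (Mhat y) \<and> max_loglik X y (Mhat y) - 1 \<le> loglik X y b \<and>
        (\<forall>i<n. mis y i \<longrightarrow> (p i - 1 / 2)\<^sup>2 \<le> 2 * (sg (b \<bullet> row X i) - p i)\<^sup>2)" for y
    proof (rule ex_near_maximizer[OF mle[of y] h(1)])
      show "h \<le> \<bar>success_prob X \<beta> i - 1 / 2\<bar>" if "i < dim_row X" for i
        using p[of i] that by (simp add: dX p_def)
    qed (unfold dX mis_def p_def, blast)
    then obtain b where b: "\<And>y. b y \<in> model_space d (Mhat y)"
        "\<And>y. max_loglik X y (Mhat y) - 1 \<le> loglik X y (b y)"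
        "\<And>y i. i < n \<Longrightarrow> mis y i \<Longrightarrow> (p i - 1 / 2)\<^sup>2 \<le> 2 * (sg (b y \<bullet> row X i) - p i)\<^sup>2"
      by metis
    define W where "W S = (\<Prod>i<n. coin p i (i \<in> S))" for S
    have W0: "0 \<le> W S" for S
      unfolding W_def p_def coin_success_prob by (intro prod_nonneg) (auto simp: sg_pos less_imp_le)
    define Y where "Y S = (\<lambda>i :: nat. i \<in> S)" for S
    define U where "U y = (\<Sum>i<n. (sg (b y \<bullet> row X i) - p i)\<^sup>2)" for y
    have "measure_pmf.expectation (data_pmf X \<beta>) U \<le> (200 * c + 13000) * V"
      unfolding U_def p_def V_def
      using p h V \<delta> by (intro prediction_error_bound[OF X r ind n h(1) h(3) \<delta> _ c d0 \<beta>' _ sel b(1,2)]) (auto simp: p_def V_def)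
    also have "\<dots> \<le> K * V" using V by (intro mult_right_mono) (auto simp: K_def)
    finally have EU: "(\<Sum>S\<in>Pow {..<n}. W S * U (Y S)) \<le> K * V"
      unfolding expectation_data_pmf dX W_def Y_def p_def .
    have P: "P i = (\<Sum>S\<in>Pow {..<n}. W S * of_bool (mis (Y S) i))" for i
    proof -
      have "P i = measure_pmf.expectation (data_pmf X \<beta>) (indicator {y. mis y i})" by (simp add: P_def)
      also have "\<dots> = (\<Sum>S\<in>Pow {..<n}. W S * indicator {y. mis y i} (Y S))"
        unfolding expectation_data_pmf dX W_def Y_def p_def ..
      finally show ?thesis by (simp add: indicator_def of_bool_def)
    qed
    define Q where "Q = (\<Sum>i<n. P i * (p i - 1 / 2)\<^sup>2)"
    have "Q = (\<Sum>S\<in>Pow {..<n}. W S * (\<Sum>i<n. of_bool (mis (Y S) i) * (p i - 1 / 2)\<^sup>2))"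
      unfolding Q_def P sum_distrib_right sum_distrib_left by (subst sum.swap) (simp only: mult.assoc)
    also have "\<dots> \<le> (\<Sum>S\<in>Pow {..<n}. W S * (\<Sum>i<n. 2 * (sg (b (Y S) \<bullet> row X i) - p i)\<^sup>2))"
    proof (intro sum_mono mult_left_mono W0)
      fix S i assume "i \<in> {..<n}"
      then show "of_bool (mis (Y S) i) * (p i - 1 / 2)\<^sup>2 \<le> 2 * (sg (b (Y S) \<bullet> row X i) - p i)\<^sup>2"
        using b(3)[of i "Y S"] by (cases "mis (Y S) i") auto
    qed
    also have "\<dots> = 2 * (\<Sum>S\<in>Pow {..<n}. W S * U (Y S))"
      unfolding U_def sum_distrib_left by (simp only: mult.left_commute)
    finally have Q: "Q \<le> 2 * (K * V)" using EU by linarith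
    define A where "A = (\<Sum>i<n. P i * \<bar>p i - 1 / 2\<bar>)"
    have eA: "e = 2 * A / real n"
    proof -
      have "\<bar>2 * p i - 1\<bar> = 2 * \<bar>p i - 1 / 2\<bar>" for i by (simp add: abs_if)
      then show ?thesis unfolding e A_def sum_distrib_left by (simp only: mult.left_commute)
    qed
    have A0: "0 \<le> A" unfolding A_def using P01 by (intro sum_nonneg) auto
    have "A * h \<le> Q"
      unfolding A_def Q_def sum_distrib_right
    proof (rule sum_mono)
      fix i assume "i \<in> {..<n}"
      then have "\<bar>p i - 1 / 2\<bar> * h \<le> \<bar>p i - 1 / 2\<bar> * \<bar>p i - 1 / 2\<bar>" using p[of i] by (intro mult_left_mono) auto
      also have "\<dots> = (p i - 1 / 2)\<^sup>2" by (simp only: power2_eq_square abs_mult_self_eq)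
      finally have "P i * (\<bar>p i - 1 / 2\<bar> * h) \<le> P i * (p i - 1 / 2)\<^sup>2" by (intro mult_left_mono P01)
      then show "P i * \<bar>p i - 1 / 2\<bar> * h \<le> P i * (p i - 1 / 2)\<^sup>2" by (simp only: mult.assoc)
    qed
    then have Ah: "A \<le> 2 * (K * V) / h" using Q h by (simp add: pos_le_divide_eq)
    have "e \<le> 2 * (2 * (K * V) / h) / real n"
      unfolding eA using Ah by (intro divide_right_mono) auto
    also have "\<dots> = 4 * K * (V / (real n * h))" using n0 h by (simp add: field_simps)
    also have "\<dots> \<le> (4 * K + 100) * (V / (real n * h))" using V h by (intro mult_right_mono) auto
    finally have b2: "e \<le> (4 * K + 100) * (V / (real n * h))" .
    have "A\<^sup>2 \<le> (\<Sum>i<n. (P i * \<bar>p i - 1 / 2\<bar>)\<^sup>2) * real (card {..<n})"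
      unfolding A_def by (rule sum_squared_le_sum_of_squares)
    also have "\<dots> \<le> Q * real n"
    proof -
      have "(P i * \<bar>p i - 1 / 2\<bar>)\<^sup>2 \<le> P i * (p i - 1 / 2)\<^sup>2" for i
      proof -
        have "(P i)\<^sup>2 \<le> P i * 1" unfolding power2_eq_square using P01 by (intro mult_left_mono) auto
        then have "(P i)\<^sup>2 * (p i - 1 / 2)\<^sup>2 \<le> P i * 1 * (p i - 1 / 2)\<^sup>2" by (intro mult_right_mono) auto
        then show ?thesis by (simp only: power_mult_distrib power2_abs mult_1_right)
      qed
      then have "(\<Sum>i<n. (P i * \<bar>p i - 1 / 2\<bar>)\<^sup>2) \<le> Q" unfolding Q_def by (intro sum_mono)
      then show ?thesis by (simp add: mult_right_mono)
    qed
    also have "\<dots> \<le> 2 * (K * V) * real n" using Q by (intro mult_right_mono) auto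
    finally have "(2 * A / real n)\<^sup>2 \<le> 4 / (real n)\<^sup>2 * (2 * (K * V) * real n)"
      by (simp add: power_divide power_mult_distrib divide_right_mono)
    also have "\<dots> = 8 * K * (V / real n)" using n0 by (simp add: power2_eq_square field_simps)
    also have "\<dots> \<le> (4 * K)\<^sup>2 * (V / real n)"
    proof (rule mult_right_mono)
      have "8 * K * 1 \<le> 8 * K * (2 * K)" using K by (intro mult_left_mono) auto
      then show "8 * K \<le> (4 * K)\<^sup>2" by (simp add: power2_eq_square)
    qed (use V in auto)
    finally have "e\<^sup>2 \<le> (4 * K)\<^sup>2 * (V / real n)" unfolding eA .
    then have "e \<le> sqrt ((4 * K)\<^sup>2 * (V / real n))" by (rule real_le_rsqrt)
    also have "\<dots> = 4 * K * sqrt (V / real n)" using K by (simp add: real_sqrt_mult real_sqrt_divide)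
    also have "\<dots> \<le> (4 * K + 100) * sqrt (V / real n)" using V by (intro mult_right_mono) auto
    finally show ?thesis using b2 by blast
  qed
  show ?thesis
  proof (cases "n = 0")
    \<comment> \<open>Both sides are 0, since division by 0 yields 0.\<close>
    case True
    then have "e = 0" by (simp add: e)
    then show ?thesis using True unfolding e_def[symmetric] by simp
  next
    case False
    have "1 * (V / real n) \<le> \<phi> * (V / real n)" using \<phi> V by (intro mult_right_mono) auto
    then have "(4 * K + 100) * sqrt (V / real n) \<le> (4 * K + 100) * sqrt (\<phi> * (V / real n))"
      using K by (intro mult_left_mono) auto
    moreover have "1 * (V / (real n * h)) \<le> \<phi> * (V / (real n * h))" using \<phi> V h by (intro mult_right_mono) auto
    then have "(4 * K + 100) * (V / (real n * h)) \<le> (4 * K + 100) * (\<phi> * (V / (real n * h)))"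
      using K by (intro mult_left_mono) auto
    ultimately show ?thesis using main False unfolding e_def[symmetric] min_def by auto
  qed
qed

theorem theorem3:
  fixes c :: real
  shows "\<exists>C1>0. \<forall>(n::nat) (d::nat) (r::nat) (d0::nat) (X::real mat) (h::real) (\<Delta>::real) (\<delta>::real)
      (Mhat :: (nat \<Rightarrow> bool) \<Rightarrow> nat set) (\<theta>hat :: (nat \<Rightarrow> bool) \<Rightarrow> nat \<Rightarrow> ereal).
      X \<in> carrier_mat n d \<longrightarrow>
      vec_space.rank n X = r \<longrightarrow>
      any_cols_indep X r \<longrightarrow>
      0 < h \<longrightarrow> h < \<Delta> \<longrightarrow> \<Delta> < 1/2 \<longrightarrow>
      \<delta> = 1/2 - \<Delta> \<longrightarrow>
      c > 4 / (\<delta> * (1 - \<delta>)) \<longrightarrow>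
      1 \<le> d0 \<longrightarrow> d0 \<le> r \<longrightarrow>
      (\<forall>y. is_selected_model c r X y (Mhat y)) \<longrightarrow>
      (\<forall>y. is_mle_predictor X y (Mhat y) (\<theta>hat y)) \<longrightarrow>
      (SUP \<beta> \<in> admissible_coeffs X d0 h \<Delta>.
          ereal (excess_risk X \<beta> (\<lambda>y i. \<theta>hat y i \<ge> 0)))
        \<le> ereal (C1 * min
            (sqrt ((1 - 4 * h\<^sup>2) / (1 - 4 * \<Delta>\<^sup>2)
                   * (min (real d0 * ln (real d * exp 1 / real d0)) (real r) / real n)))
            ((1 - 4 * h\<^sup>2) / (1 - 4 * \<Delta>\<^sup>2)
                   * (min (real d0 * ln (real d * exp 1 / real d0)) (real r) / (real n * h))))"
\<comment> \<open>The constant is fixed before \<open>\<Delta>\<close> and \<open>\<delta>\<close>;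
  the absolute value keeps it positive for every real \<open>c\<close>.\<close>
proof (rule exI[of _ "4 * (200 * \<bar>c\<bar> + 13000) + 100"], intro conjI allI impI, goal_cases)
  case 1
  show ?case by (simp add: add_nonneg_pos)
next
  case (2 n d r d0 X h \<Delta> \<delta> Mhat \<theta>hat)
  note sel = spec[OF 2(11)] and mle = spec[OF 2(12)]
  \<comment> \<open>The supremum is taken in \<open>ereal\<close>, where \<open>SUP_least\<close>
    also covers an empty class.\<close>
  show ?case
    by (rule SUP_least, subst ereal_less_eq(3)) (rule excess_risk_bound[OF 2(1-10) sel mle])
qed

end
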